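(* Let $n\ge 1$ and let $U_\lambda^{(n)}(z;q,t;a,b,c,d)$, $\lambda\in\mathbb{Z}^n$, be the nonsymmetric Koornwinder polynomials (defined in the context). The limit $\lim_{q\to 0}U_\lambda^{(n)}(z;q,t;a,b,c,d)$ (taken coefficientwise, for generic $t,a,b,c,d$) is well-defined. Moreover, for every partition $\lambda$ with $l(\lambda)\le n$, $$\lim_{q \rightarrow 0} U_{\lambda}^{(n)}(z; q,t; a,b,c,d) = E_{\lambda}^{(n)}(z;c,d),\qquad\text{where}\quad E_{\lambda}^{(n)}(z;c,d) = \prod_{i:\,\lambda_{i} > 0} z_{i}^{\lambda_{i}} (1-cz_{i}^{-1})(1-dz_{i}^{-1}).$$
   Context: A partition $\lambda=(\lambda_1,\dots,\lambda_n)$ with $l(\lambda)\le n$ is a non-increasing string of $n$ non-negative integers (zeros allowed), $l(\lambda)$ being the number of nonzero parts. Elements of $\mathbb{Z}^n$ are called compositions; $z^\mu=z_1^{\mu_1}\cdots z_n^{\mu_n}$. Dominance ordering on $\mathbb{Z}^n$: $\mu\le\lambda$ iff $\sum_{i=1}^k\mu_i\le\sum_{i=1}^k\lambda_i$ for all $1\le k\le n$; $\mu<\lambda$ means $\mu\le\lambda$, $\mu\neq\lambda$. For $\mu\in\mathbb{Z}^n$, $\mu^+$ is the partition obtained by rearranging the absolute values of the parts of $\mu$ in non-increasing order. Then $\mu\prec\lambda$ iff $\mu\ne\lambda$ and either (1) $\mu^+<\lambda^+$, or (2) $\mu^+=\lambda^+$ and $\mu\le\lambda$. Put $(x;q)=\prod_{k\ge0}(1-xq^k)$,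 $(x_1,\dots,x_l;q)=(x_1;q)\cdots(x_l;q)$, with $\pm$ exponents denoting the product over both sign choices. The nonsymmetric Koornwinder density is $$\Delta_{K}^{(n)}(z;q,t;a,b,c,d) = \prod_{1 \leq i \leq n} \frac{(z_{i}^{2}, qz_{i}^{-2};q)}{(az_{i}, bz_{i}, cz_{i}, dz_{i}, aqz_{i}^{-1}, bqz_{i}^{-1}, cz_{i}^{-1},dz_{i}^{-1};q)} \prod_{1 \leq i<j \leq n} \frac{(z_{i}z_{j}^{\pm 1},qz_{i}^{-1}z_{j}^{\pm 1};q)}{(tz_{i}z_{j}^{\pm 1}, qtz_{i}^{-1}z_{j}^{\pm 1};q)} .$$ With $T=\{|z_1|=\dots=|z_n|=1\}$ and $dT=\prod_{j=1}^n\frac{dz_j}{2\pi\sqrt{-1}z_j}$, set $$\langle f,g \rangle_{q} = \int_{T} f\, \bar{g}^{\iota}\, \Delta_{K}^{(n)}(z;q,t;a,b,c,d)\, dT ,$$ where $\bar{\phantom{g}}$ sends $z^\nu\mapsto z^{-\nu}$ and fixes parameters, and $\iota$ inverts each of the parameters $q,t,a,b,c,d$ in the coefficients and fixes each $z^\nu$ (so $\overline{z^\nu}^{\,\iota}=z^{-\nu}$); the parameters are taken of modulus less than $1$ for the integral. For (generic) parameters, the nonsymmetric Koornwinder polynomials $\{U_\mu^{(n)}(z;q,t;a,b,c,d)\}_{\mu\in\mathbb{Z}^n}$ are the Laurent polynomials uniquely determined by: (i) $U_{\mu} = z^{\mu} + \sum_{\nu \prec \mu} w_{\mu \nu} z^{\nu}$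 for some coefficients $w_{\mu\nu}$ depending on $q,t,a,b,c,d$; (ii) $\langle U_{\mu}, z^{\nu} \rangle_{q} = 0$ for all $\nu \prec \mu$. *)

theory Defs
  imports "HOL-Analysis.Analysis" "HOL-Library.Poly_Mapping"
begin

text \<open>
  Conventions. The variables are indexed by 0, ..., n-1. An element of Z^n is a finitely supported
  function \<^typ>\<open>nat \<Rightarrow>\<^sub>0 int\<close> supported in \<^term>\<open>{..<n}\<close>. A Laurent polynomial is a finitely supported
  coefficient function on exponents; the ring structure of \<^typ>\<open>(nat \<Rightarrow>\<^sub>0 int) \<Rightarrow>\<^sub>0 complex\<close>
  (convolution) is the multiplication of Laurent polynomials, and \<^term>\<open>Poly_Mapping.single \<nu> 1\<close> is
  the monomial with exponent \<^term>\<open>\<nu>\<close>.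
\<close>

type_synonym comp = "nat \<Rightarrow>\<^sub>0 int"
type_synonym laurent = "(nat \<Rightarrow>\<^sub>0 int) \<Rightarrow>\<^sub>0 complex"

text \<open>A parameter tuple is (q, t, a, b, c, d).\<close>

type_synonym params = "complex \<times> complex \<times> complex \<times> complex \<times> complex \<times> complex"


section \<open>Compositions, partitions and the orderings\<close>

definition compositions :: "nat \<Rightarrow> comp set" where
  "compositions n = {\<mu>. Poly_Mapping.keys \<mu> \<subseteq> {..<n}}"

definition partitions :: "nat \<Rightarrow> comp set" where
  "partitions n = {\<mu> \<in> compositions n.
     (\<forall>i<n. 0 \<le> Poly_Mapping.lookup \<mu> i) \<and>
     (\<forall>i j. i \<le> j \<and> j < n \<longrightarrow> Poly_Mapping.lookup \<mu> j \<le> Poly_Mapping.lookup \<mu> i)}"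

definition dom_le :: "nat \<Rightarrow> comp \<Rightarrow> comp \<Rightarrow> bool" where
  "dom_le n \<mu> \<kappa> \<longleftrightarrow>
     (\<forall>k\<in>{1..n}. (\<Sum>i<k. Poly_Mapping.lookup \<mu> i) \<le> (\<Sum>i<k. Poly_Mapping.lookup \<kappa> i))"

definition dom_less :: "nat \<Rightarrow> comp \<Rightarrow> comp \<Rightarrow> bool" where
  "dom_less n \<mu> \<kappa> \<longleftrightarrow> dom_le n \<mu> \<kappa> \<and> \<mu> \<noteq> \<kappa>"

text \<open>The partition obtained by sorting the absolute values of the parts; \<^const>\<open>Poly_Mapping.nth\<close>
  turns a list into a finitely supported function.\<close>

definition plus_part :: "nat \<Rightarrow> comp \<Rightarrow> comp" where
  "plus_part n \<mu> = Poly_Mapping.nth (rev (sort (map (\<lambda>i. \<bar>Poly_Mapping.lookup \<mu> i\<bar>) [0..<n])))"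

definition prec :: "nat \<Rightarrow> comp \<Rightarrow> comp \<Rightarrow> bool" where
  "prec n \<mu> \<kappa> \<longleftrightarrow> \<mu> \<noteq> \<kappa> \<and>
     (dom_less n (plus_part n \<mu>) (plus_part n \<kappa>) \<or>
      (plus_part n \<mu> = plus_part n \<kappa> \<and> dom_le n \<mu> \<kappa>))"


section \<open>The density and the inner product\<close>

definition qpoch_inf :: "complex \<Rightarrow> complex \<Rightarrow> complex" where
  "qpoch_inf x q = prodinf (\<lambda>k. 1 - x * q ^ k)"

text \<open>\<open>qp q [x\<^sub>1, \<dots>, x\<^sub>l]\<close> is the multi-argument symbol \<open>(x\<^sub>1, \<dots>, x\<^sub>l; q)\<close>.\<close>

definition qp :: "complex \<Rightarrow> complex list \<Rightarrow> complex" where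
  "qp q xs = prod_list (map (\<lambda>x. qpoch_inf x q) xs)"

fun koorn_density :: "nat \<Rightarrow> params \<Rightarrow> (nat \<Rightarrow> complex) \<Rightarrow> complex" where
  "koorn_density n (q, t, a, b, c, d) z =
     (\<Prod>i<n.
        qp q [(z i)\<^sup>2, q / (z i)\<^sup>2] /
        qp q [a * z i, b * z i, c * z i, d * z i,
              a * q / z i, b * q / z i, c / z i, d / z i]) *
     (\<Prod>j<n. \<Prod>i<j.
        qp q [z i * z j, z i / z j, q * z j / z i, q / (z i * z j)] /
        qp q [t * z i * z j, t * z i / z j, q * t * z j / z i, q * t / (z i * z j)])"

definition laurent_eval :: "nat \<Rightarrow> laurent \<Rightarrow> (nat \<Rightarrow> complex) \<Rightarrow> complex" where
  "laurent_eval n f z =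
     (\<Sum>\<nu>\<in>Poly_Mapping.keys f.
        Poly_Mapping.lookup f \<nu> * (\<Prod>i<n. z i powi Poly_Mapping.lookup \<nu> i))"

text \<open>The torus is parametrised by \<open>z\<^sub>j = exp (2 \<pi> \<i> \<theta>\<^sub>j)\<close> with \<open>\<theta>\<^sub>j\<close> in [0,1], so that
  \<open>dz\<^sub>j / (2 \<pi> \<i> z\<^sub>j) = d\<theta>\<^sub>j\<close>.\<close>

definition torus_integral :: "nat \<Rightarrow> ((nat \<Rightarrow> complex) \<Rightarrow> complex) \<Rightarrow> complex" where
  "torus_integral n F =
     (LINT \<theta> | Pi\<^sub>M {..<n} (\<lambda>_. restrict_space lborel {0..1::real}). F (\<lambda>j. cis (2 * pi * \<theta> j)))"

text \<open>The map \<open>z\<^sup>\<nu> \<mapsto> z\<^sup>-\<^sup>\<nu>\<close> fixing the coefficients.\<close>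

definition bar :: "laurent \<Rightarrow> laurent" where
  "bar f = Poly_Mapping.map_key uminus f"

fun inv_params :: "params \<Rightarrow> params" where
  "inv_params (q, t, a, b, c, d) =
     (inverse q, inverse t, inverse a, inverse b, inverse c, inverse d)"

text \<open>The coefficients of the two arguments may depend on the parameters, so the arguments are
  families of Laurent polynomials indexed by parameter tuples, and the involution inverting the
  parameters is composition with \<^const>\<open>inv_params\<close>. The value of the pairing at the parameter
  tuple \<open>p\<close> depends on \<open>f\<close> only through \<open>f p\<close>.\<close>

definition koorn_inner ::
    "nat \<Rightarrow> (params \<Rightarrow> laurent) \<Rightarrow> (params \<Rightarrow> laurent) \<Rightarrow> params \<Rightarrow> complex" where
  "koorn_inner n f g p =
     torus_integral n (\<lambda>z. laurent_eval n (f p) z * laurent_eval n (bar (g (inv_params p))) z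
                           * koorn_density n p z)"


section \<open>Nonsymmetric Koornwinder polynomials\<close>

definition is_koornwinder :: "nat \<Rightarrow> comp \<Rightarrow> params \<Rightarrow> laurent \<Rightarrow> bool" where
  "is_koornwinder n \<mu> p U \<longleftrightarrow>
     Poly_Mapping.lookup U \<mu> = 1 \<and>
     Poly_Mapping.keys U \<subseteq> insert \<mu> {\<nu> \<in> compositions n. prec n \<nu> \<mu>} \<and>
     (\<forall>\<nu>\<in>compositions n. prec n \<nu> \<mu> \<longrightarrow>
        koorn_inner n (\<lambda>_. U) (\<lambda>_. Poly_Mapping.single \<nu> 1) p = 0)"

text \<open>Meaningful only at parameter tuples where exactly one such polynomial exists.\<close>

definition koornwinder :: "nat \<Rightarrow> comp \<Rightarrow> params \<Rightarrow> laurent" where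
  "koornwinder n \<mu> p = (THE U. is_koornwinder n \<mu> p U)"

definition E_poly :: "nat \<Rightarrow> comp \<Rightarrow> complex \<Rightarrow> complex \<Rightarrow> laurent" where
  "E_poly n \<kappa> c d =
     (\<Prod>i\<in>{i. i < n \<and> 0 < Poly_Mapping.lookup \<kappa> i}.
        Poly_Mapping.single (Poly_Mapping.single i (Poly_Mapping.lookup \<kappa> i)) 1 *
        (1 - Poly_Mapping.single (Poly_Mapping.single i (- 1)) c) *
        (1 - Poly_Mapping.single (Poly_Mapping.single i (- 1)) d))"


section \<open>Limits and genericity\<close>

definition coeffwise_limit :: "(complex \<Rightarrow> laurent) \<Rightarrow> laurent \<Rightarrow> bool" where
  "coeffwise_limit F L \<longleftrightarrow>
     (\<forall>\<nu>. ((\<lambda>q. Poly_Mapping.lookup (F q) \<nu>) \<longlongrightarrow> Poly_Mapping.lookup L \<nu>) (at 0))"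

text \<open>A property holds for generic (t, a, b, c, d) if it holds for all parameters of modulus less
  than 1 (where the integral is defined) at which some fixed nonzero polynomial does not vanish.
  The polynomial is given by its coefficients, indexed by the exponents of t, a, b, c, d.\<close>

definition poly5_eval ::
    "((nat \<times> nat \<times> nat \<times> nat \<times> nat) \<Rightarrow>\<^sub>0 complex) \<Rightarrow>
     complex \<Rightarrow> complex \<Rightarrow> complex \<Rightarrow> complex \<Rightarrow> complex \<Rightarrow> complex" where
  "poly5_eval P t a b c d =
     (\<Sum>(i, j, k, l, m)\<in>Poly_Mapping.keys P.
        Poly_Mapping.lookup P (i, j, k, l, m) * t ^ i * a ^ j * b ^ k * c ^ l * d ^ m)"

definition generic_params ::
    "(complex \<Rightarrow> complex \<Rightarrow> complex \<Rightarrow> complex \<Rightarrow> complex \<Rightarrow> bool) \<Rightarrow> bool" where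
  "generic_params Q \<longleftrightarrow>
     (\<exists>P. P \<noteq> 0 \<and>
        (\<forall>t a b c d. norm t < 1 \<and> norm a < 1 \<and> norm b < 1 \<and> norm c < 1 \<and> norm d < 1 \<and>
           poly5_eval P t a b c d \<noteq> 0 \<longrightarrow> Q t a b c d))"

end

theory Submission
  imports Defs "HOL-Library.Multiset" "HOL-Probability.Infinite_Product_Measure"
    "Jordan_Normal_Form.Determinant"
begin

text \<open>
  Write \<open>K(q, \<rho>)\<close> for the integral of \<open>z^\<rho>\<close> against the density (\<open>moment\<close> below). The polynomial with
  index \<open>\<mu>\<close> is the solution of the finite linear system with matrix \<open>K(q, \<kappa> - \<nu>)\<close>, where \<open>\<nu>\<close> and \<open>\<kappa>\<close>
  range over the compositions below \<open>\<mu>\<close>. On the torus the density is bounded uniformly for small \<open>q\<close> and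
  converges pointwise to its value at \<open>q = 0\<close>, so \<open>K(q, \<rho>)\<close> converges to \<open>K(0, \<rho>)\<close>
  (\<open>tendsto_moment\<close>). By Cramer's rule (\<open>cramer_limit\<close>), everything follows once the matrix at \<open>q = 0\<close>
  is nonsingular: for small \<open>q\<close> there is then exactly one solution, and it converges to the unique
  solution at \<open>q = 0\<close>.

  At \<open>q = 0\<close> the density is a finite product of factors \<open>1 - z^\<gamma>\<close> and \<open>1 / (1 - m z^\<beta>)\<close>, where \<open>m\<close> is one
  of the parameters. Such functions are uniform limits on the torus of Laurent polynomials whose
  exponents are confined to a half space, and their integral vanishes if the half space does not
  contain \<open>0\<close> (\<open>torus_integral_positive_weight\<close>). This principle is used three times, each time with
  another weight on the exponents.

  \<^item> With weight one on a single variable it eliminates that variable: partial fractions separate the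
    factors with positive from those with negative exponent, and then the geometric series can be
    expanded until the integrand has no constant term. So \<open>K(0, \<rho>)\<close> is a rational function of
    \<open>(t, a, b, c, d)\<close> without poles in the polydisc (\<open>is_rational_torus_integral\<close>), and so is the
    determinant.

  \<^item> If all parameters vanish, the density is \<open>1\<close> plus monomials in the positive root cone. With
    weights that are positive on this cone, the matrix is unitriangular, and the determinant does not
    vanish (\<open>nondegenerate_zero_params\<close>). Hence its numerator is a nonzero polynomial, which is the
    polynomial that defines genericity.

  \<^item> For a partition \<open>\<kappa>\<close>, the product \<open>E_\<kappa>\<close> cancels the factors \<open>1 / (1 - c / z_i)\<close> and \<open>1 / (1 - d / z_i)\<close>
    of the density for all \<open>i\<close> with \<open>\<kappa>_i > 0\<close>. What remains of \<open>E_\<kappa>\<close> times the density is \<open>z^\<kappa>\<close> times a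
    function with exponents of nonnegative weight, for the weight that adds up the partial sums ending
    at a positive part of \<open>\<kappa>\<close>. Since every \<open>\<nu>\<close> below \<open>\<kappa>\<close> has smaller weight than \<open>\<kappa>\<close>, the product \<open>E_\<kappa>\<close>
    is orthogonal to \<open>z^\<nu>\<close> (\<open>is_koornwinder_E_poly\<close>), so it is the solution at \<open>q = 0\<close>.
\<close>


section \<open>Laurent polynomials on the torus\<close>

definition zpow :: "nat \<Rightarrow> comp \<Rightarrow> (nat \<Rightarrow> complex) \<Rightarrow> complex" where
  "zpow n \<nu> z = (\<Prod>i<n. z i powi Poly_Mapping.lookup \<nu> i)"

definition torus :: "(nat \<Rightarrow> complex) set" where
  "torus = {z. \<forall>i. norm (z i) = 1}"

definition weight :: "nat \<Rightarrow> (nat \<Rightarrow> int) \<Rightarrow> comp \<Rightarrow> int" where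
  "weight n w \<nu> = (\<Sum>i<n. w i * Poly_Mapping.lookup \<nu> i)"

lemma torus_nonzero: "z \<in> torus \<Longrightarrow> z i \<noteq> 0"
  by (auto simp: torus_def dest: spec[of _ i])

lemma norm_zpow: "z \<in> torus \<Longrightarrow> norm (zpow n \<nu> z) = 1"
  by (auto simp: zpow_def torus_def norm_power_int simp flip: prod_norm)

lemma zpow_0 [simp]: "zpow n 0 z = 1"
  by (simp add: zpow_def)

lemma zpow_add: "z \<in> torus \<Longrightarrow> zpow n (\<mu> + \<nu>) z = zpow n \<mu> z * zpow n \<nu> z"
  by (simp add: zpow_def lookup_add power_int_add torus_nonzero prod.distrib)

lemma zpow_single:
  assumes "i < n"
  shows "zpow n (Poly_Mapping.single i k) z = z i powi k"
proof -
  have "zpow n (Poly_Mapping.single i k) z = (\<Prod>j<n. if i = j then z j powi k else 1)"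
    unfolding zpow_def by (intro prod.cong) (auto simp: lookup_single when_def)
  thus ?thesis using assms by simp
qed

lemma weight_0 [simp]: "weight n w 0 = 0"
  by (simp add: weight_def)

lemma weight_add: "weight n w (\<mu> + \<nu>) = weight n w \<mu> + weight n w \<nu>"
  by (simp add: weight_def lookup_add algebra_simps sum.distrib)

lemma weight_diff: "weight n w (\<mu> - \<nu>) = weight n w \<mu> - weight n w \<nu>"
  by (simp add: weight_def lookup_minus algebra_simps sum_subtractf)

lemma weight_single:
  assumes "i < n"
  shows "weight n w (Poly_Mapping.single i k) = w i * k"
proof -
  have "weight n w (Poly_Mapping.single i k) = (\<Sum>j<n. if i = j then w j * k else 0)"
    unfolding weight_def by (intro sum.cong) (auto simp: lookup_single when_def)
  thus ?thesis using assms by simp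
qed

lemma compositions_0 [simp]: "0 \<in> compositions n"
  by (simp add: compositions_def)

lemma compositions_add: "\<mu> \<in> compositions n \<Longrightarrow> \<nu> \<in> compositions n \<Longrightarrow> \<mu> + \<nu> \<in> compositions n"
  using keys_add[of \<mu> \<nu>] by (auto simp: compositions_def)

lemma compositions_diff: "\<mu> \<in> compositions n \<Longrightarrow> \<nu> \<in> compositions n \<Longrightarrow> \<mu> - \<nu> \<in> compositions n"
  using keys_diff[of \<mu> \<nu>] by (auto simp: compositions_def)

lemma compositions_single [simp]: "i < n \<Longrightarrow> Poly_Mapping.single i k \<in> compositions n"
  by (auto simp: compositions_def)

lemma lookup_compositions_eq_0: "\<mu> \<in> compositions n \<Longrightarrow> n \<le> i \<Longrightarrow> Poly_Mapping.lookup \<mu> i = 0"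
  by (auto simp: compositions_def subset_iff simp flip: not_in_keys_iff_lookup_eq_zero)

lemma poly_mapping_single_plus_induct [case_names zero add]:
  assumes "P 0" "\<And>k c f. P f \<Longrightarrow> k \<notin> Poly_Mapping.keys f \<Longrightarrow> P (Poly_Mapping.single k c + f)"
  shows "P (f :: 'a \<Rightarrow>\<^sub>0 'b::comm_monoid_add)"
proof (induction f rule: update_induct)
  case const thus ?case by (rule assms(1))
next
  case (update f a b)
  have "Poly_Mapping.update a b f = Poly_Mapping.single a b + f"
    using update(1) by (intro poly_mapping_eqI)
      (auto simp: lookup_update lookup_add lookup_single when_def in_keys_iff)
  thus ?case using assms(2) update by simp
qed

lemma laurent_eval_superset:
  assumes "finite A" "Poly_Mapping.keys f \<subseteq> A"
  shows "laurent_eval n f z = (\<Sum>\<nu>\<in>A. Poly_Mapping.lookup f \<nu> * zpow n \<nu> z)"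
  unfolding laurent_eval_def zpow_def
  using assms by (intro sum.mono_neutral_left) (auto simp: in_keys_iff)

lemma laurent_eval_eq_sum_zpow:
  "laurent_eval n f z = (\<Sum>\<nu>\<in>Poly_Mapping.keys f. Poly_Mapping.lookup f \<nu> * zpow n \<nu> z)"
  by (simp add: laurent_eval_def zpow_def)

lemma laurent_eval_0 [simp]: "laurent_eval n 0 z = 0"
  by (simp add: laurent_eval_def)

lemma laurent_eval_single [simp]: "laurent_eval n (Poly_Mapping.single \<nu> c) z = c * zpow n \<nu> z"
  by (simp add: laurent_eval_superset[of "{\<nu>}"])

lemma laurent_eval_one [simp]: "laurent_eval n 1 z = 1"
  by (simp flip: single_one)

lemma laurent_eval_add: "laurent_eval n (f + g) z = laurent_eval n f z + laurent_eval n g z"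
  using keys_add[of f g]
  by (simp add: laurent_eval_superset[of "Poly_Mapping.keys f \<union> Poly_Mapping.keys g"]
       lookup_add algebra_simps sum.distrib)

lemma laurent_eval_diff: "laurent_eval n (f - g) z = laurent_eval n f z - laurent_eval n g z"
  using keys_diff[of f g]
  by (simp add: laurent_eval_superset[of "Poly_Mapping.keys f \<union> Poly_Mapping.keys g"]
       lookup_minus algebra_simps sum_subtractf)

lemma laurent_eval_mult:
  assumes "z \<in> torus"
  shows "laurent_eval n (f * g) z = laurent_eval n f z * laurent_eval n g z"
proof (induction f rule: poly_mapping_single_plus_induct)
  case (add k c f)
  have "laurent_eval n (Poly_Mapping.single k c * g) z = c * zpow n k z * laurent_eval n g z"
  proof (induction g rule: poly_mapping_single_plus_induct)
    case (add l d g)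
    thus ?case using assms
      by (simp add: distrib_left mult_single laurent_eval_add zpow_add algebra_simps)
  qed simp
  thus ?case using add by (simp add: distrib_right laurent_eval_add)
qed simp

lemma laurent_eval_prod:
  assumes "z \<in> torus"
  shows "laurent_eval n (\<Prod>i\<in>A. f i) z = (\<Prod>i\<in>A. laurent_eval n (f i) z)"
  by (induction A rule: infinite_finite_induct) (simp_all add: laurent_eval_mult[OF assms])

lemma norm_laurent_eval_le:
  assumes "z \<in> torus"
  shows "norm (laurent_eval n f z) \<le> (\<Sum>\<nu>\<in>Poly_Mapping.keys f. norm (Poly_Mapping.lookup f \<nu>))"
  unfolding laurent_eval_eq_sum_zpow
  by (rule sum_norm_le) (simp add: norm_mult norm_zpow[OF assms])

text \<open>Uniform limits on the torus of Laurent polynomials all of whose exponents have weight at least \<open>s\<close>.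
  Working with approximations instead of series avoids multiple infinite sums: the class is closed
  under products and contains the geometric factors, and all that matters about its members is that
  their constant terms vanish when \<open>s\<close> is positive.\<close>

definition weight_limit :: "nat \<Rightarrow> (nat \<Rightarrow> int) \<Rightarrow> int \<Rightarrow> ((nat \<Rightarrow> complex) \<Rightarrow> complex) \<Rightarrow> bool" where
  "weight_limit n w s F \<longleftrightarrow>
     (\<forall>\<epsilon>>0. \<exists>f. (\<forall>\<nu>\<in>Poly_Mapping.keys f. \<nu> \<in> compositions n \<and> s \<le> weight n w \<nu>) \<and>
               (\<forall>z\<in>torus. norm (F z - laurent_eval n f z) \<le> \<epsilon>))"

lemma weight_limit_cong:
  "(\<And>z. z \<in> torus \<Longrightarrow> F z = G z) \<Longrightarrow> weight_limit n w s F \<longleftrightarrow> weight_limit n w s G"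
  by (simp add: weight_limit_def)

lemma weight_limit_laurent:
  assumes "\<And>\<nu>. \<nu> \<in> Poly_Mapping.keys f \<Longrightarrow> \<nu> \<in> compositions n \<and> s \<le> weight n w \<nu>"
  shows "weight_limit n w s (laurent_eval n f)"
  unfolding weight_limit_def using assms by (intro allI impI exI[of _ f]) auto

lemma weight_limit_zpow:
  assumes "\<nu> \<in> compositions n" "s \<le> weight n w \<nu>"
  shows "weight_limit n w s (\<lambda>z. c * zpow n \<nu> z)"
proof -
  have "weight_limit n w s (laurent_eval n (Poly_Mapping.single \<nu> c))"
    using assms by (intro weight_limit_laurent) (auto split: if_splits)
  moreover have "laurent_eval n (Poly_Mapping.single \<nu> c) = (\<lambda>z. c * zpow n \<nu> z)" by auto
  ultimately show ?thesis by simp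
qed

lemma weight_limit_const [intro]: "weight_limit n w 0 (\<lambda>z. c)"
  using weight_limit_zpow[of 0 n 0 w c] by simp

text \<open>The class is closed under uniform limits; this is how the geometric factors enter it.\<close>

lemma weight_limit_uniform:
  assumes "\<And>\<epsilon>. \<epsilon> > 0 \<Longrightarrow> \<exists>G. weight_limit n w s G \<and> (\<forall>z\<in>torus. norm (F z - G z) \<le> \<epsilon>)"
  shows "weight_limit n w s F"
  unfolding weight_limit_def
proof (intro allI impI)
  fix \<epsilon> :: real assume "\<epsilon> > 0"
  then obtain G where G: "weight_limit n w s G" "\<forall>z\<in>torus. norm (F z - G z) \<le> \<epsilon> / 2"
    using assms[of "\<epsilon> / 2"] by auto
  then obtain f where f: "\<forall>\<nu>\<in>Poly_Mapping.keys f. \<nu> \<in> compositions n \<and> s \<le> weight n w \<nu>"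
    "\<forall>z\<in>torus. norm (G z - laurent_eval n f z) \<le> \<epsilon> / 2"
    unfolding weight_limit_def using \<open>\<epsilon> > 0\<close> by (metis half_gt_zero)
  have "norm (F z - laurent_eval n f z) \<le> \<epsilon>" if "z \<in> torus" for z
    using norm_triangle_le[of "F z - G z" "G z - laurent_eval n f z" \<epsilon>] G(2) f(2) that by force
  thus "\<exists>f. (\<forall>\<nu>\<in>Poly_Mapping.keys f. \<nu> \<in> compositions n \<and> s \<le> weight n w \<nu>) \<and>
            (\<forall>z\<in>torus. norm (F z - laurent_eval n f z) \<le> \<epsilon>)" using f by blast
qed

lemma weight_limit_bounded:
  assumes "weight_limit n w s F"
  obtains B where "B > 0" "\<And>z. z \<in> torus \<Longrightarrow> norm (F z) \<le> B"
proof -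
  obtain f where f: "\<forall>z\<in>torus. norm (F z - laurent_eval n f z) \<le> 1"
    using assms[unfolded weight_limit_def, rule_format, of 1] by auto
  define B where "B = 1 + (\<Sum>\<nu>\<in>Poly_Mapping.keys f. norm (Poly_Mapping.lookup f \<nu>))"
  have "norm (F z) \<le> B" if "z \<in> torus" for z
    using norm_triangle_sub[of "F z" "laurent_eval n f z"] bspec[OF f that]
      norm_laurent_eval_le[OF that, of n f] by (simp add: B_def)
  moreover have "B > 0" unfolding B_def by (intro add_pos_nonneg sum_nonneg) auto
  ultimately show thesis using that by blast
qed

lemma weight_limit_add:
  assumes "weight_limit n w s F" "weight_limit n w s G"
  shows "weight_limit n w s (\<lambda>z. F z + G z)"
  unfolding weight_limit_def
proof (intro allI impI)
  fix \<epsilon> :: real assume "\<epsilon> > 0"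
  obtain f g where f: "\<forall>\<nu>\<in>Poly_Mapping.keys f. \<nu> \<in> compositions n \<and> s \<le> weight n w \<nu>"
    "\<forall>z\<in>torus. norm (F z - laurent_eval n f z) \<le> \<epsilon> / 2"
    and g: "\<forall>\<nu>\<in>Poly_Mapping.keys g. \<nu> \<in> compositions n \<and> s \<le> weight n w \<nu>"
    "\<forall>z\<in>torus. norm (G z - laurent_eval n g z) \<le> \<epsilon> / 2"
    using assms \<open>\<epsilon> > 0\<close> unfolding weight_limit_def by (metis half_gt_zero)
  have "norm (F z + G z - laurent_eval n (f + g) z) \<le> \<epsilon>" if "z \<in> torus" for z
    using norm_triangle_le[of "F z - laurent_eval n f z" "G z - laurent_eval n g z" \<epsilon>] f(2) g(2) that
    by (force simp: laurent_eval_add algebra_simps)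
  thus "\<exists>f. (\<forall>\<nu>\<in>Poly_Mapping.keys f. \<nu> \<in> compositions n \<and> s \<le> weight n w \<nu>) \<and>
            (\<forall>z\<in>torus. norm (F z + G z - laurent_eval n f z) \<le> \<epsilon>)"
    using f(1) g(1) keys_add[of f g] by (intro exI[of _ "f + g"]) blast
qed

text \<open>Weights add up because the exponents do; both functions are bounded, so the product of
  approximations approximates the product.\<close>

lemma weight_limit_mult:
  assumes F: "weight_limit n w s F" and G: "weight_limit n w s' G"
  shows "weight_limit n w (s + s') (\<lambda>z. F z * G z)"
  unfolding weight_limit_def
proof (intro allI impI)
  fix \<epsilon> :: real assume "\<epsilon> > 0"
  obtain A where A: "A > 0" "\<And>z. z \<in> torus \<Longrightarrow> norm (F z) \<le> A"
    using weight_limit_bounded[OF F] by blast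
  define \<delta> where "\<delta> = \<epsilon> / (2 * A)"
  have "\<delta> > 0" using A(1) \<open>\<epsilon> > 0\<close> by (simp add: \<delta>_def)
  then obtain g where g: "\<forall>\<nu>\<in>Poly_Mapping.keys g. \<nu> \<in> compositions n \<and> s' \<le> weight n w \<nu>"
    "\<forall>z\<in>torus. norm (G z - laurent_eval n g z) \<le> \<delta>"
    using G unfolding weight_limit_def by blast
  define B where "B = 1 + (\<Sum>\<nu>\<in>Poly_Mapping.keys g. norm (Poly_Mapping.lookup g \<nu>))"
  have B: "B > 0" unfolding B_def by (intro add_pos_nonneg sum_nonneg) auto
  have gB: "norm (laurent_eval n g z) \<le> B" if "z \<in> torus" for z
    using norm_laurent_eval_le[OF that, of n g] by (simp add: B_def)
  define \<eta> where "\<eta> = \<epsilon> / (2 * B)"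
  have "\<eta> > 0" using B \<open>\<epsilon> > 0\<close> by (simp add: \<eta>_def)
  then obtain f where f: "\<forall>\<nu>\<in>Poly_Mapping.keys f. \<nu> \<in> compositions n \<and> s \<le> weight n w \<nu>"
    "\<forall>z\<in>torus. norm (F z - laurent_eval n f z) \<le> \<eta>"
    using F unfolding weight_limit_def by blast
  have "norm (F z * G z - laurent_eval n (f * g) z) \<le> \<epsilon>" if z: "z \<in> torus" for z
  proof -
    have "F z * G z - laurent_eval n (f * g) z =
          F z * (G z - laurent_eval n g z) + (F z - laurent_eval n f z) * laurent_eval n g z"
      by (simp add: laurent_eval_mult[OF z] algebra_simps)
    also have "norm \<dots> \<le> A * \<delta> + \<eta> * B"
      using A(2)[OF z] gB[OF z] bspec[OF f(2) z] bspec[OF g(2) z] A(1) \<open>\<eta> > 0\<close>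
      by (intro order.trans[OF norm_triangle_ineq] add_mono) (auto simp: norm_mult intro!: mult_mono)
    also have "\<dots> = \<epsilon>" using A(1) B by (simp add: \<delta>_def \<eta>_def)
    finally show ?thesis .
  qed
  moreover have "\<nu> \<in> compositions n \<and> s + s' \<le> weight n w \<nu>" if \<nu>: "\<nu> \<in> Poly_Mapping.keys (f * g)" for \<nu>
  proof -
    obtain \<alpha> \<beta> where "\<nu> = \<alpha> + \<beta>" "\<alpha> \<in> Poly_Mapping.keys f" "\<beta> \<in> Poly_Mapping.keys g"
      using subsetD[OF keys_mult \<nu>] by blast
    thus ?thesis using f(1) g(1) by (auto simp: weight_add intro: compositions_add add_mono)
  qed
  ultimately show "\<exists>f. (\<forall>\<nu>\<in>Poly_Mapping.keys f. \<nu> \<in> compositions n \<and> s + s' \<le> weight n w \<nu>) \<and>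
            (\<forall>z\<in>torus. norm (F z * G z - laurent_eval n f z) \<le> \<epsilon>)" by blast
qed

lemma weight_limit_mult0:
  "weight_limit n w 0 F \<Longrightarrow> weight_limit n w 0 G \<Longrightarrow> weight_limit n w 0 (\<lambda>z. F z * G z)"
  using weight_limit_mult[of n w 0 F 0 G] by simp

lemma weight_limit_scale:
  "weight_limit n w s F \<Longrightarrow> weight_limit n w s (\<lambda>z. c * F z)"
  using weight_limit_mult[OF weight_limit_const, of n w s F c] by simp

lemma weight_limit_prod:
  assumes "\<And>i. i \<in> A \<Longrightarrow> weight_limit n w 0 (F i)"
  shows "weight_limit n w 0 (\<lambda>z. \<Prod>i\<in>A. F i z)"
  using assms
  by (induction A rule: infinite_finite_induct) (auto intro: weight_limit_mult0)

lemma weight_limit_power: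
  assumes "weight_limit n w 0 F"
  shows "weight_limit n w 0 (\<lambda>z. F z ^ k)"
  using weight_limit_prod[of "{..<k}" n w "\<lambda>_. F"] assms by simp

lemma weight_limit_sum:
  assumes "\<And>i. i \<in> A \<Longrightarrow> weight_limit n w 0 (F i)"
  shows "weight_limit n w 0 (\<lambda>z. \<Sum>i\<in>A. F i z)"
  using assms
  by (induction A rule: infinite_finite_induct) (auto intro: weight_limit_add)

text \<open>The partial sums of the geometric series converge uniformly, since \<open>z^\<beta>\<close> has modulus one on the torus.\<close>

lemma weight_limit_geometric:
  assumes "\<beta> \<in> compositions n" "0 \<le> weight n w \<beta>" "norm m < 1"
  shows "weight_limit n w 0 (\<lambda>z. 1 / (1 - m * zpow n \<beta> z))"
proof (rule weight_limit_uniform)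
  fix \<epsilon> :: real assume "\<epsilon> > 0"
  have "(\<lambda>N. norm m ^ N / (1 - norm m)) \<longlonglongrightarrow> 0 / (1 - norm m)"
    using assms(3) by (intro tendsto_divide LIMSEQ_power_zero tendsto_const) auto
  hence "eventually (\<lambda>N. norm m ^ N / (1 - norm m) < \<epsilon>) sequentially"
    using \<open>\<epsilon> > 0\<close> by (simp add: order_tendsto_iff)
  then obtain N where N: "norm m ^ N / (1 - norm m) < \<epsilon>"
    unfolding eventually_sequentially by blast
  define G where "G = (\<lambda>z. \<Sum>k<N. (m * zpow n \<beta> z) ^ k)"
  have "weight_limit n w 0 G"
    unfolding G_def using assms by (intro weight_limit_sum weight_limit_power weight_limit_zpow) auto
  moreover have "norm (1 / (1 - m * zpow n \<beta> z) - G z) \<le> \<epsilon>" if z: "z \<in> torus" for z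
  proof -
    define y where "y = m * zpow n \<beta> z"
    have y: "norm y = norm m" by (simp add: y_def norm_mult norm_zpow[OF z])
    hence "y \<noteq> 1" using assms(3) by auto
    have "G z = (1 - y ^ N) / (1 - y)"
      unfolding G_def y_def[symmetric] by (rule sum_gp_strict[THEN trans]) (use \<open>y \<noteq> 1\<close> in auto)
    hence "1 / (1 - y) - G z = y ^ N / (1 - y)"
      by (simp add: diff_divide_distrib)
    hence "norm (1 / (1 - y) - G z) = norm m ^ N / norm (1 - y)"
      by (simp add: norm_divide norm_power y)
    also have "\<dots> \<le> norm m ^ N / (1 - norm m)"
      using norm_triangle_ineq2[of 1 y] y assms(3) by (intro divide_left_mono mult_pos_pos) auto
    finally show ?thesis using N by (simp add: y_def)
  qed
  ultimately show "\<exists>G. weight_limit n w 0 G \<and> (\<forall>z\<in>torus. norm (1 / (1 - m * zpow n \<beta> z) - G z) \<le> \<epsilon>)"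
    by blast
qed

section \<open>Integration over the torus\<close>

abbreviation unit_interval_measure :: "real measure" where
  "unit_interval_measure \<equiv> restrict_space lborel {0..1::real}"

abbreviation torus_measure :: "nat \<Rightarrow> (nat \<Rightarrow> real) measure" where
  "torus_measure n \<equiv> Pi\<^sub>M {..<n} (\<lambda>_. unit_interval_measure)"

definition torus_point :: "(nat \<Rightarrow> real) \<Rightarrow> nat \<Rightarrow> complex" where
  "torus_point \<theta> = (\<lambda>j. cis (2 * pi * \<theta> j))"

lemma torus_point_in_torus [simp]: "torus_point \<theta> \<in> torus"
  by (simp add: torus_point_def torus_def)

lemma torus_integral_torus_point: "torus_integral n F = (LINT \<theta>|torus_measure n. F (torus_point \<theta>))"
  by (simp add: torus_integral_def torus_point_def)

lemma torus_integral_cong: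
  "(\<And>z. z \<in> torus \<Longrightarrow> F z = G z) \<Longrightarrow> torus_integral n F = torus_integral n G"
  by (simp add: torus_integral_torus_point)

lemma prob_space_unit_interval: "prob_space unit_interval_measure"
  by (intro prob_spaceI) (simp add: emeasure_restrict_space)

lemma prob_space_torus: "prob_space (torus_measure n)"
proof -
  interpret prob_space unit_interval_measure by (rule prob_space_unit_interval)
  interpret product_prob_space "\<lambda>_. unit_interval_measure" "{..<n}" ..
  show ?thesis by (rule P.prob_space_axioms)
qed

lemma integral_unit_interval_cis:
  "(LINT x|unit_interval_measure. cis (2 * pi * (of_int k * x))) = (if k = 0 then 1 else 0)"
proof (cases "k = 0")
  case True
  interpret prob_space unit_interval_measure by (rule prob_space_unit_interval)
  show ?thesis using True prob_space by simp
next
  case False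
  define f where "f = (\<lambda>w. exp (2 * pi * \<i> * of_int k * w) / (2 * pi * \<i> * of_int k))"
  define F where "F = (\<lambda>x. f (complex_of_real x))"
  have cis_exp: "cis (2 * pi * (of_int k * x)) = exp (2 * pi * \<i> * of_int k * complex_of_real x)" for x
    by (simp add: cis_conv_exp mult_ac)
  have "(f has_field_derivative exp (2 * pi * \<i> * of_int k * w)) (at w)" for w
    unfolding f_def using False by (auto intro!: derivative_eq_intros)
  hence deriv: "(F has_vector_derivative cis (2 * pi * (of_int k * x))) (at x within {0..1})" for x
    unfolding F_def cis_exp by (rule has_vector_derivative_real_field)
  have "((\<lambda>x. cis (2 * pi * (of_int k * x))) has_integral F 1 - F 0) {0..1}"
  proof (rule fundamental_theorem_of_calculus)
    fix x :: real
    show "(F has_vector_derivative cis (2 * pi * (of_int k * x))) (at x within {0..1})" by (rule deriv)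
  qed simp
  moreover have "F 1 = F 0"
    using cis_exp[of 1] cis_multiple_2pi[of "of_int k"] by (simp add: F_def f_def)
  ultimately have "integral {0..1} (\<lambda>x. cis (2 * pi * (of_int k * x))) = 0"
    by (simp add: integral_unique)
  moreover have "set_integrable lborel {0..1} (\<lambda>x. cis (2 * pi * (of_int k * x)))"
    by (intro borel_integrable_atLeastAtMost') (auto intro!: continuous_intros)
  ultimately have "(LINT x:{0..1}|lborel. cis (2 * pi * (of_int k * x))) = 0"
    by (simp add: set_borel_integral_eq_integral)
  thus ?thesis using False
    by (simp add: integral_restrict_space set_lebesgue_integral_def)
qed

lemma zpow_torus_point: "zpow n \<nu> (torus_point \<theta>) = (\<Prod>i<n. cis (2 * pi * (of_int (Poly_Mapping.lookup \<nu> i) * \<theta> i)))"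
  by (simp add: zpow_def torus_point_def cis_power_int mult_ac)

lemma measurable_zpow [measurable]: "(\<lambda>\<theta>. zpow n \<nu> (torus_point \<theta>)) \<in> borel_measurable (torus_measure n)"
proof -
  have "(\<lambda>\<theta>. cis (2 * pi * (of_int k * \<theta> i))) \<in> borel_measurable (torus_measure n)" if "i < n" for i k
  proof -
    have 1: "(\<lambda>\<theta>. \<theta> i) \<in> torus_measure n \<rightarrow>\<^sub>M unit_interval_measure"
      using that by (intro measurable_component_singleton) simp
    have 2: "(\<lambda>x. cis (2 * pi * (of_int k * x))) \<in> borel_measurable unit_interval_measure"
      by (intro measurable_restrict_space1) (auto intro!: borel_measurable_continuous_onI continuous_intros)
    show ?thesis by (rule measurable_compose[OF 1 2])
  qed
  thus ?thesis unfolding zpow_torus_point by (intro borel_measurable_prod) auto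
qed

lemma integrable_cis: "integrable unit_interval_measure (\<lambda>x. cis (2 * pi * (of_int k * x)))"
proof -
  interpret prob_space unit_interval_measure by (rule prob_space_unit_interval)
  have "(\<lambda>x. cis (2 * pi * (of_int k * x))) \<in> borel_measurable unit_interval_measure"
    by (intro measurable_restrict_space1) (auto intro!: borel_measurable_continuous_onI continuous_intros)
  thus ?thesis by (intro integrable_const_bound[where B = 1]) auto
qed

lemma torus_integral_zpow:
  assumes "\<nu> \<in> compositions n"
  shows "torus_integral n (zpow n \<nu>) = (if \<nu> = 0 then 1 else 0)"
proof -
  interpret prob_space unit_interval_measure by (rule prob_space_unit_interval)
  interpret product_prob_space "\<lambda>_. unit_interval_measure" "{..<n}" ..
  have "torus_integral n (zpow n \<nu>) =
        (\<Prod>i<n. LINT x|unit_interval_measure. cis (2 * pi * (of_int (Poly_Mapping.lookup \<nu> i) * x)))"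
    unfolding torus_integral_torus_point zpow_torus_point
    by (rule product_integral_prod) (auto intro: integrable_cis)
  also have "\<dots> = (\<Prod>i<n. if Poly_Mapping.lookup \<nu> i = 0 then 1 else 0)"
    by (simp add: integral_unit_interval_cis)
  also have "\<dots> = (if \<nu> = 0 then 1 else 0)"
  proof (cases "\<nu> = 0")
    case False
    then obtain i where "Poly_Mapping.lookup \<nu> i \<noteq> 0" by (metis poly_mapping_eqI lookup_zero)
    moreover from this have "i < n" using lookup_compositions_eq_0[OF assms, of i] by force
    ultimately show ?thesis using False by auto
  qed simp
  finally show ?thesis .
qed

lemma measurable_laurent_eval [measurable]:
  "(\<lambda>\<theta>. laurent_eval n f (torus_point \<theta>)) \<in> borel_measurable (torus_measure n)"
  unfolding laurent_eval_eq_sum_zpow by measurable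

lemma measurable_weight_limit:
  assumes "weight_limit n w s F"
  shows "(\<lambda>\<theta>. F (torus_point \<theta>)) \<in> borel_measurable (torus_measure n)"
proof -
  have "\<exists>f. \<forall>z\<in>torus. norm (F z - laurent_eval n f z) \<le> inverse (real (Suc k))" for k
  proof -
    have "inverse (real (Suc k)) > 0" by simp
    thus ?thesis using assms unfolding weight_limit_def by blast
  qed
  then obtain f where f: "\<And>k z. z \<in> torus \<Longrightarrow> norm (F z - laurent_eval n (f k) z) \<le> inverse (real (Suc k))"
    by metis
  show ?thesis
  proof (rule borel_measurable_LIMSEQ_metric)
    fix \<theta>
    have "(\<lambda>k. F (torus_point \<theta>) - laurent_eval n (f k) (torus_point \<theta>)) \<longlonglongrightarrow> 0"
      by (rule Lim_null_comparison[OF _ LIMSEQ_inverse_real_of_nat]) (use f in auto)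
    from tendsto_diff[OF tendsto_const this, of "F (torus_point \<theta>)"]
    show "(\<lambda>k. laurent_eval n (f k) (torus_point \<theta>)) \<longlonglongrightarrow> F (torus_point \<theta>)" by simp
  qed measurable
qed

lemma integrable_torus_bounded:
  assumes "(\<lambda>\<theta>. F (torus_point \<theta>)) \<in> borel_measurable (torus_measure n)"
    and "\<And>z. z \<in> torus \<Longrightarrow> norm (F z :: complex) \<le> B"
  shows "integrable (torus_measure n) (\<lambda>\<theta>. F (torus_point \<theta>))"
proof -
  interpret prob_space "torus_measure n" by (rule prob_space_torus)
  show ?thesis using assms by (intro integrable_const_bound[where B = B]) auto
qed

lemma norm_torus_integral_le:
  assumes "(\<lambda>\<theta>. F (torus_point \<theta>)) \<in> borel_measurable (torus_measure n)"
    and "\<And>z. z \<in> torus \<Longrightarrow> norm (F z) \<le> B"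
  shows "norm (torus_integral n F) \<le> B"
proof -
  interpret prob_space "torus_measure n" by (rule prob_space_torus)
  have int: "integrable (torus_measure n) (\<lambda>\<theta>. F (torus_point \<theta>))"
    using assms by (rule integrable_torus_bounded)
  have "norm (torus_integral n F) \<le> (LINT \<theta>|torus_measure n. norm (F (torus_point \<theta>)))"
    unfolding torus_integral_torus_point by (rule integral_norm_bound)
  also have "\<dots> \<le> (LINT \<theta>|torus_measure n. B)"
    using int assms(2) by (intro integral_mono) auto
  also have "\<dots> = B" using prob_space by simp
  finally show ?thesis .
qed

lemma integrable_weight_limit:
  assumes "weight_limit n w s F"
  shows "integrable (torus_measure n) (\<lambda>\<theta>. F (torus_point \<theta>))"
proof -
  obtain B where "\<And>z. z \<in> torus \<Longrightarrow> norm (F z) \<le> B" using weight_limit_bounded[OF assms] by blast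
  thus ?thesis using measurable_weight_limit[OF assms] by (intro integrable_torus_bounded) auto
qed

lemma torus_integral_add:
  assumes "weight_limit n w s F" "weight_limit n w' s' G"
  shows "torus_integral n (\<lambda>z. F z + G z) = torus_integral n F + torus_integral n G"
  using assms unfolding torus_integral_torus_point
  by (intro Bochner_Integration.integral_add integrable_weight_limit)

lemma torus_integral_diff:
  assumes "weight_limit n w s F" "weight_limit n w' s' G"
  shows "torus_integral n (\<lambda>z. F z - G z) = torus_integral n F - torus_integral n G"
  using assms unfolding torus_integral_torus_point
  by (intro Bochner_Integration.integral_diff integrable_weight_limit)

lemma torus_integral_scale: "torus_integral n (\<lambda>z. c * F z) = c * torus_integral n F"
  unfolding torus_integral_torus_point by simp

lemma torus_integral_laurent_positive_weight:
  assumes "\<forall>\<nu>\<in>Poly_Mapping.keys f. \<nu> \<in> compositions n \<and> s \<le> weight n w \<nu>" "s > 0"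
  shows "torus_integral n (laurent_eval n f) = 0"
proof -
  have "integrable (torus_measure n) (\<lambda>\<theta>. c * zpow n \<nu> (torus_point \<theta>))" for c \<nu>
    by (rule integrable_torus_bounded[where F = "\<lambda>z. c * zpow n \<nu> z" and B = "norm c"])
       (auto simp: norm_mult norm_zpow)
  hence "torus_integral n (laurent_eval n f) =
        (\<Sum>\<nu>\<in>Poly_Mapping.keys f. Poly_Mapping.lookup f \<nu> * torus_integral n (zpow n \<nu>))"
    unfolding torus_integral_torus_point laurent_eval_eq_sum_zpow
    by (subst Bochner_Integration.integral_sum) auto
  also have "\<dots> = 0"
    using assms by (intro sum.neutral) (auto simp: torus_integral_zpow)
  finally show ?thesis .
qed

text \<open>No approximating Laurent polynomial has a constant term, and only the constant term contributes to
  the integral over the torus.\<close>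

lemma torus_integral_positive_weight:
  assumes "weight_limit n w s F" "s > 0"
  shows "torus_integral n F = 0"
proof -
  have "norm (torus_integral n F) \<le> \<epsilon>" if \<epsilon>: "\<epsilon> > 0" for \<epsilon>
  proof -
    obtain f where f: "\<forall>\<nu>\<in>Poly_Mapping.keys f. \<nu> \<in> compositions n \<and> s \<le> weight n w \<nu>"
      "\<And>z. z \<in> torus \<Longrightarrow> norm (F z - laurent_eval n f z) \<le> \<epsilon>"
      using assms(1)[unfolded weight_limit_def, rule_format, OF \<epsilon>] by blast
    have "weight_limit n w s (laurent_eval n f)" using f(1) by (intro weight_limit_laurent) auto
    hence "torus_integral n (\<lambda>z. F z - laurent_eval n f z) = torus_integral n F"
      using torus_integral_laurent_positive_weight[OF f(1) assms(2)]
      by (subst torus_integral_diff[OF assms(1)]) auto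
    moreover have "norm (torus_integral n (\<lambda>z. F z - laurent_eval n f z)) \<le> \<epsilon>"
      using f(2) measurable_weight_limit[OF assms(1)] by (intro norm_torus_integral_le) auto
    ultimately show ?thesis by simp
  qed
  hence "norm (torus_integral n F) \<le> 0 + \<epsilon>" if "\<epsilon> > 0" for \<epsilon> using that by simp
  hence "norm (torus_integral n F) \<le> 0" by (rule field_le_epsilon)
  thus ?thesis by simp
qed

section \<open>Polynomial and rational functions of the parameters\<close>

type_synonym par = "complex \<times> complex \<times> complex \<times> complex \<times> complex"

definition polydisc :: "par set" where
  "polydisc = {(t, a, b, c, d). norm t < 1 \<and> norm a < 1 \<and> norm b < 1 \<and> norm c < 1 \<and> norm d < 1}"

definition is_poly :: "(par \<Rightarrow> complex) \<Rightarrow> bool" where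
  "is_poly f \<longleftrightarrow> (\<exists>P. \<forall>t a b c d. f (t, a, b, c, d) = poly5_eval P t a b c d)"

fun monom5 :: "nat \<times> nat \<times> nat \<times> nat \<times> nat \<Rightarrow> par \<Rightarrow> complex" where
  "monom5 (i, j, k, l, m) (t, a, b, c, d) = t ^ i * a ^ j * b ^ k * c ^ l * d ^ m"

lemma monom5_add: "monom5 (x + y) p = monom5 x p * monom5 y p"
  by (cases x; cases y; cases p) (simp add: power_add)

lemma poly5_eval_superset:
  assumes "finite A" "Poly_Mapping.keys P \<subseteq> A"
  shows "poly5_eval P t a b c d = (\<Sum>x\<in>A. Poly_Mapping.lookup P x * monom5 x (t, a, b, c, d))"
  unfolding poly5_eval_def
  using assms by (intro sum.mono_neutral_cong_left) (auto simp: in_keys_iff mult.assoc)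

lemma poly5_eval_single [simp]: "poly5_eval (Poly_Mapping.single x c0) t a b c d = c0 * monom5 x (t, a, b, c, d)"
  by (simp add: poly5_eval_superset[of "{x}"])

lemma poly5_eval_0 [simp]: "poly5_eval 0 t a b c d = 0"
  by (simp add: poly5_eval_def)

lemma poly5_eval_add:
  "poly5_eval (P + Q) t a b c d = poly5_eval P t a b c d + poly5_eval Q t a b c d"
  using keys_add[of P Q]
  by (simp add: poly5_eval_superset[of "Poly_Mapping.keys P \<union> Poly_Mapping.keys Q"]
       lookup_add algebra_simps sum.distrib)

lemma poly5_eval_mult:
  "poly5_eval (P * Q) t a b c d = poly5_eval P t a b c d * poly5_eval Q t a b c d"
proof (induction P rule: poly_mapping_single_plus_induct)
  case (add k c0 P)
  have "poly5_eval (Poly_Mapping.single k c0 * Q) t a b c d =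
        c0 * monom5 k (t, a, b, c, d) * poly5_eval Q t a b c d"
  proof (induction Q rule: poly_mapping_single_plus_induct)
    case (add l d0 Q)
    thus ?case
      by (simp add: distrib_left mult_single poly5_eval_add monom5_add algebra_simps)
  qed simp
  thus ?case using add by (simp add: distrib_right poly5_eval_add)
qed simp

lemma is_poly_const: "is_poly (\<lambda>p. c0)"
  unfolding is_poly_def by (rule exI[of _ "Poly_Mapping.single (0, 0, 0, 0, 0) c0"]) simp

lemma is_poly_add: "is_poly f \<Longrightarrow> is_poly g \<Longrightarrow> is_poly (\<lambda>p. f p + g p)"
  unfolding is_poly_def by (metis poly5_eval_add)

lemma is_poly_mult: "is_poly f \<Longrightarrow> is_poly g \<Longrightarrow> is_poly (\<lambda>p. f p * g p)"
  unfolding is_poly_def by (metis poly5_eval_mult)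

lemma is_poly_coord:
  "is_poly (\<lambda>(t, a, b, c, d). t)" "is_poly (\<lambda>(t, a, b, c, d). a)" "is_poly (\<lambda>(t, a, b, c, d). b)"
  "is_poly (\<lambda>(t, a, b, c, d). c)" "is_poly (\<lambda>(t, a, b, c, d). d)"
  unfolding is_poly_def
  subgoal by (rule exI[of _ "Poly_Mapping.single (1, 0, 0, 0, 0) 1"]) simp
  subgoal by (rule exI[of _ "Poly_Mapping.single (0, 1, 0, 0, 0) 1"]) simp
  subgoal by (rule exI[of _ "Poly_Mapping.single (0, 0, 1, 0, 0) 1"]) simp
  subgoal by (rule exI[of _ "Poly_Mapping.single (0, 0, 0, 1, 0) 1"]) simp
  subgoal by (rule exI[of _ "Poly_Mapping.single (0, 0, 0, 0, 1) 1"]) simp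
  done

text \<open>Rational functions without poles in the polydisc. The values outside the polydisc are left open
  because the torus integrals only make sense inside.\<close>

definition is_rational :: "(par \<Rightarrow> complex) \<Rightarrow> bool" where
  "is_rational f \<longleftrightarrow>
     (\<exists>A B. is_poly A \<and> is_poly B \<and> (\<forall>p\<in>polydisc. B p \<noteq> 0 \<and> f p = A p / B p))"

lemma is_rational_poly: "is_poly f \<Longrightarrow> is_rational f"
  unfolding is_rational_def by (rule exI[of _ f], rule exI[of _ "\<lambda>p. 1"]) (simp add: is_poly_const)

lemma is_rational_const: "is_rational (\<lambda>p. c)"
  by (intro is_rational_poly is_poly_const)

lemma is_rational_cong:
  "(\<And>p. p \<in> polydisc \<Longrightarrow> f p = g p) \<Longrightarrow> is_rational g \<Longrightarrow> is_rational f"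
  unfolding is_rational_def by metis

lemma is_rational_add:
  assumes "is_rational f" "is_rational g"
  shows "is_rational (\<lambda>p. f p + g p)"
proof -
  obtain A B C D where "is_poly A" "is_poly B" "is_poly C" "is_poly D"
    "\<forall>p\<in>polydisc. B p \<noteq> 0 \<and> f p = A p / B p" "\<forall>p\<in>polydisc. D p \<noteq> 0 \<and> g p = C p / D p"
    using assms unfolding is_rational_def by blast
  thus ?thesis unfolding is_rational_def
    by (intro exI[of _ "\<lambda>p. A p * D p + C p * B p"] exI[of _ "\<lambda>p. B p * D p"])
       (auto intro: is_poly_add is_poly_mult simp: add_frac_eq)
qed

lemma is_rational_mult:
  assumes "is_rational f" "is_rational g"
  shows "is_rational (\<lambda>p. f p * g p)"
proof -
  obtain A B C D where "is_poly A" "is_poly B" "is_poly C" "is_poly D"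
    "\<forall>p\<in>polydisc. B p \<noteq> 0 \<and> f p = A p / B p" "\<forall>p\<in>polydisc. D p \<noteq> 0 \<and> g p = C p / D p"
    using assms unfolding is_rational_def by blast
  thus ?thesis unfolding is_rational_def
    by (intro exI[of _ "\<lambda>p. A p * C p"] exI[of _ "\<lambda>p. B p * D p"])
       (auto intro: is_poly_mult)
qed

lemma is_rational_diff:
  assumes "is_rational f" "is_rational g"
  shows "is_rational (\<lambda>p. f p - g p)"
  using is_rational_add[OF assms(1) is_rational_mult[OF is_rational_const[of "-1"] assms(2)]] by simp

lemma is_rational_sum: "(\<And>i. i \<in> A \<Longrightarrow> is_rational (f i)) \<Longrightarrow> is_rational (\<lambda>p. \<Sum>i\<in>A. f i p)"
  by (induction A rule: infinite_finite_induct) (auto intro: is_rational_add is_rational_const)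

lemma is_rational_prod: "(\<And>i. i \<in> A \<Longrightarrow> is_rational (f i)) \<Longrightarrow> is_rational (\<lambda>p. \<Prod>i\<in>A. f i p)"
  by (induction A rule: infinite_finite_induct) (auto intro: is_rational_mult is_rational_const)

lemma is_rational_geometric:
  assumes "is_poly m" "\<And>p. p \<in> polydisc \<Longrightarrow> norm (m p) < 1"
  shows "is_rational (\<lambda>p. 1 / (1 - m p))"
proof -
  have "is_poly (\<lambda>p. 1 + (-1) * m p)"
    by (intro is_poly_add is_poly_mult is_poly_const assms)
  moreover have "m p \<noteq> 1" if "p \<in> polydisc" for p using assms(2)[OF that] by auto
  ultimately show ?thesis unfolding is_rational_def
    by (intro exI[of _ "\<lambda>p. 1"] exI[of _ "\<lambda>p. 1 + (-1) * m p"]) (auto intro: is_poly_const)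
qed

text \<open>Wherever the numerator does not vanish, neither does the function; and the numerator is a nonzero
  polynomial because it does not vanish at the origin.\<close>

lemma generic_params_rational_nonzero:
  assumes "is_rational f" "f (0, 0, 0, 0, 0) \<noteq> 0"
    and "\<And>t a b c d. (t, a, b, c, d) \<in> polydisc \<Longrightarrow> f (t, a, b, c, d) \<noteq> 0 \<Longrightarrow> Q t a b c d"
  shows "generic_params Q"
proof -
  obtain A B where AB: "is_poly A" "\<forall>p\<in>polydisc. B p \<noteq> 0 \<and> f p = A p / B p"
    using assms(1) unfolding is_rational_def by blast
  obtain P where P: "\<And>t a b c d. A (t, a, b, c, d) = poly5_eval P t a b c d"
    using AB(1) unfolding is_poly_def by blast
  have "(0, 0, 0, 0, 0) \<in> polydisc" by (simp add: polydisc_def)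
  hence "A (0, 0, 0, 0, 0) \<noteq> 0" using AB(2) assms(2) by fastforce
  hence "P \<noteq> 0" using P by auto
  moreover have "Q t a b c d"
    if "(t, a, b, c, d) \<in> polydisc" "poly5_eval P t a b c d \<noteq> 0" for t a b c d
    using that AB(2) assms(3) P by force
  ultimately show ?thesis unfolding generic_params_def by (auto simp: polydisc_def)
qed

section \<open>Rationality of torus integrals\<close>

text \<open>The pair \<open>(m, \<beta>)\<close> stands for the factor \<open>1 / (1 - m(p) z^\<beta>)\<close>, where \<open>p\<close> is the tuple of parameters.\<close>

type_synonym factor = "(par \<Rightarrow> complex) \<times> comp"

definition geom_factor :: "nat \<Rightarrow> par \<Rightarrow> (nat \<Rightarrow> complex) \<Rightarrow> factor \<Rightarrow> complex" where
  "geom_factor n p z x = 1 / (1 - fst x p * zpow n (snd x) z)"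

definition geom_term :: "nat \<Rightarrow> comp \<Rightarrow> factor multiset \<Rightarrow> par \<Rightarrow> (nat \<Rightarrow> complex) \<Rightarrow> complex" where
  "geom_term n \<nu> L p z = zpow n \<nu> z * (\<Prod>x\<in>#L. geom_factor n p z x)"

text \<open>The exponents of the denominators that occur when the variables are integrated out in increasing
  order, those below \<open>k\<close> being gone. All coordinates of such an exponent are at most one in modulus, and
  if two coordinates are nonzero, the first of them is \<open>1\<close>; so the only exponent that is negative in
  coordinate \<open>k\<close> is \<open>- e_k\<close>. This is why the set is stable under elimination of \<open>z_k\<close>.\<close>

inductive_set short_exponents :: "nat \<Rightarrow> nat \<Rightarrow> comp set" for n k where
  zero: "0 \<in> short_exponents n k"
| one: "k \<le> i \<Longrightarrow> i < n \<Longrightarrow> s \<in> {1, -1} \<Longrightarrow> Poly_Mapping.single i s \<in> short_exponents n k"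
| two: "k \<le> i \<Longrightarrow> i < j \<Longrightarrow> j < n \<Longrightarrow> s \<in> {1, -1} \<Longrightarrow>
    Poly_Mapping.single i 1 + Poly_Mapping.single j s \<in> short_exponents n k"

lemma short_exponents_compositions: "\<beta> \<in> short_exponents n k \<Longrightarrow> \<beta> \<in> compositions n"
  by (induction rule: short_exponents.induct) (auto intro!: compositions_add)

lemma short_exponents_n: "\<beta> \<in> short_exponents n n \<Longrightarrow> \<beta> = 0"
  by (auto elim!: short_exponents.cases)

lemma short_exponents_lookup:
  "\<beta> \<in> short_exponents n k \<Longrightarrow> Poly_Mapping.lookup \<beta> k \<in> {-1, 0, 1}"
  by (auto elim!: short_exponents.cases simp: lookup_add lookup_single when_def)

lemma short_exponents_Suc:
  "\<beta> \<in> short_exponents n k \<Longrightarrow> Poly_Mapping.lookup \<beta> k = 0 \<Longrightarrow> \<beta> \<in> short_exponents n (Suc k)"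
  by (erule short_exponents.cases)
     (auto simp: lookup_add lookup_single when_def intro!: short_exponents.intros split: if_splits)

text \<open>Partial fractions in \<open>z_k\<close> produce denominators whose exponent is the sum of two exponents with
  opposite \<open>k\<close>-coordinates.\<close>

lemma short_exponents_cancel:
  assumes "\<alpha> \<in> short_exponents n k" "\<beta> \<in> short_exponents n k"
    "Poly_Mapping.lookup \<alpha> k = 1" "Poly_Mapping.lookup \<beta> k = -1"
  shows "\<alpha> + \<beta> \<in> short_exponents n (Suc k)"
proof -
  have \<beta>: "\<beta> = Poly_Mapping.single k (-1)"
    using assms(2,4) by (auto elim!: short_exponents.cases simp: lookup_add lookup_single when_def split: if_splits)
  show ?thesis using assms(1)
  proof cases
    case (one i s)
    hence "\<alpha> = Poly_Mapping.single k 1" using assms(3) by (auto simp: lookup_single when_def split: if_splits)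
    thus ?thesis by (simp add: \<beta> short_exponents.zero flip: single_add)
  next
    case (two i j s)
    hence "i = k" using assms(3) by (auto simp: lookup_add lookup_single when_def split: if_splits)
    hence "\<alpha> + \<beta> = Poly_Mapping.single j s"
      unfolding two(1) \<beta> by (intro poly_mapping_eqI) (auto simp: lookup_add lookup_single when_def)
    moreover have "Poly_Mapping.single j s \<in> short_exponents n (Suc k)"
      using two \<open>i = k\<close> by (intro short_exponents.one) auto
    ultimately show ?thesis by (simp only:)
  qed (use assms(3) in simp)
qed

definition good_factor :: "nat \<Rightarrow> nat \<Rightarrow> factor \<Rightarrow> bool" where
  "good_factor n k x \<longleftrightarrow> is_poly (fst x) \<and> (\<forall>p\<in>polydisc. norm (fst x p) < 1) \<and> snd x \<in> short_exponents n k"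

lemma weight_limit_geom_factors:
  assumes "p \<in> polydisc" "\<And>x. x \<in># L \<Longrightarrow> good_factor n k x \<and> 0 \<le> weight n w (snd x)"
  shows "weight_limit n w 0 (\<lambda>z. \<Prod>x\<in>#L. geom_factor n p z x)"
  using assms(2)
proof (induction L)
  case (add x L)
  have "weight_limit n w 0 (\<lambda>z. geom_factor n p z x)"
    unfolding geom_factor_def using add.prems[of x] assms(1)
    by (intro weight_limit_geometric) (auto simp: good_factor_def short_exponents_compositions)
  thus ?case using add by (auto intro: weight_limit_mult0)
qed (auto intro: weight_limit_const)

lemma weight_limit_geom_term:
  assumes "p \<in> polydisc" "\<And>x. x \<in># L \<Longrightarrow> good_factor n k x \<and> 0 \<le> weight n w (snd x)"
    "\<nu> \<in> compositions n"
  shows "weight_limit n w (weight n w \<nu>) (geom_term n \<nu> L p)"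
  unfolding geom_term_def
  using weight_limit_mult[OF weight_limit_zpow[OF assms(3) order.refl, where c = 1]
      weight_limit_geom_factors[OF assms(1,2)]]
  by simp

lemma weight_delta: "k < n \<Longrightarrow> weight n (\<lambda>i. if i = k then s else 0) \<nu> = s * Poly_Mapping.lookup \<nu> k"
  by (simp add: weight_def if_distrib[of "\<lambda>x. x * _"] sum.delta cong: if_cong)

lemma geom_factor_denominator_nonzero:
  assumes "p \<in> polydisc" "z \<in> torus" "good_factor n k x"
  shows "1 - fst x p * zpow n (snd x) z \<noteq> 0"
proof -
  have "norm (fst x p * zpow n (snd x) z) < 1"
    using assms by (simp add: norm_mult norm_zpow good_factor_def)
  thus ?thesis by auto
qed

text \<open>The statement that is proved by downward induction on \<open>k\<close>: integrals whose integrand only involves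
  the variables from \<open>z_k\<close> on are rational in the parameters.\<close>

definition rational_integrals :: "nat \<Rightarrow> nat \<Rightarrow> bool" where
  "rational_integrals n k \<longleftrightarrow>
     (\<forall>\<nu> L. Poly_Mapping.keys \<nu> \<subseteq> {k..<n} \<longrightarrow> (\<forall>x\<in>#L. good_factor n k x) \<longrightarrow>
        is_rational (\<lambda>p. torus_integral n (geom_term n \<nu> L p)))"

lemma rational_integrals_base: "rational_integrals n n"
  unfolding rational_integrals_def
proof (intro allI impI)
  fix \<nu> :: comp and L
  assume "Poly_Mapping.keys \<nu> \<subseteq> {n..<n}" and L: "\<forall>x\<in>#L. good_factor n n x"
  hence [simp]: "\<nu> = 0" by auto
  define r where "r = (\<lambda>p. \<Prod>x\<in>#L. 1 / (1 - fst x p))"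
  have "is_rational r" unfolding r_def using L
  proof (induction L)
    case (add x L)
    have "is_rational (\<lambda>p. 1 / (1 - fst x p) * (\<Prod>x\<in>#L. 1 / (1 - fst x p)))"
      using add by (intro is_rational_mult is_rational_geometric) (auto simp: good_factor_def)
    thus ?case by simp
  qed (simp add: is_rational_const)
  moreover have "torus_integral n (geom_term n \<nu> L p) = r p" for p
  proof -
    have exps: "snd x = 0" if "x \<in># L" for x
      using L that by (auto simp: good_factor_def dest!: short_exponents_n)
    have "(\<Prod>x\<in>#L. geom_factor n p z x) = r p" for z
      unfolding r_def by (intro arg_cong[of _ _ prod_mset] image_mset_cong) (simp add: geom_factor_def exps)
    hence "geom_term n \<nu> L p = (\<lambda>z. r p * zpow n 0 z)"
      by (simp add: geom_term_def fun_eq_iff)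
    thus ?thesis by (simp add: torus_integral_scale torus_integral_zpow del: zpow_0)
  qed
  ultimately show "is_rational (\<lambda>p. torus_integral n (geom_term n \<nu> L p))" by simp
qed

text \<open>Both elimination steps replace an integrand by a combination of two others; here \<open>c\<close> may depend on the
  parameters but not on \<open>z\<close>.\<close>

lemma torus_integral_add_geom_term:
  assumes p: "p \<in> polydisc"
    and "\<And>x. x \<in># L \<Longrightarrow> good_factor n k x" "\<And>x. x \<in># L' \<Longrightarrow> good_factor n k' x"
    and "\<nu> \<in> compositions n" "\<nu>' \<in> compositions n"
    and eq: "\<And>z. z \<in> torus \<Longrightarrow> F z = geom_term n \<nu> L p z + c * geom_term n \<nu>' L' p z"
  shows "torus_integral n F = torus_integral n (geom_term n \<nu> L p) + c * torus_integral n (geom_term n \<nu>' L' p)"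
proof -
  have w0: "weight n (\<lambda>_. 0) \<nu> = 0" for \<nu> by (simp add: weight_def)
  have 1: "weight_limit n (\<lambda>_. 0) (weight n (\<lambda>_. 0) \<nu>) (geom_term n \<nu> L p)"
    using assms by (intro weight_limit_geom_term) (auto simp: w0)
  have 2: "weight_limit n (\<lambda>_. 0) (weight n (\<lambda>_. 0) \<nu>') (geom_term n \<nu>' L' p)"
    using assms by (intro weight_limit_geom_term[where k = k']) (auto simp: w0)
  have "torus_integral n F = torus_integral n (\<lambda>z. geom_term n \<nu> L p z + c * geom_term n \<nu>' L' p z)"
    by (rule torus_integral_cong) (rule eq)
  also have "\<dots> = torus_integral n (geom_term n \<nu> L p) + torus_integral n (\<lambda>z. c * geom_term n \<nu>' L' p z)"
    by (rule torus_integral_add[OF 1 weight_limit_scale[OF 2]])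
  also have "torus_integral n (\<lambda>z. c * geom_term n \<nu>' L' p z) = c * torus_integral n (geom_term n \<nu>' L' p)"
    by (rule torus_integral_scale)
  finally show ?thesis .
qed

lemma good_factor_mono:
  assumes "good_factor n (Suc k) x" shows "good_factor n k x"
proof -
  have "\<beta> \<in> short_exponents n (Suc k) \<Longrightarrow> \<beta> \<in> short_exponents n k" for \<beta>
    by (induction rule: short_exponents.induct) (auto intro: short_exponents.intros)
  thus ?thesis using assms by (auto simp: good_factor_def)
qed

lemma keys_add_range:
  assumes "Poly_Mapping.keys \<nu> \<subseteq> {k..<n}" "\<beta> \<in> short_exponents n k"
  shows "Poly_Mapping.keys (\<nu> + \<beta>) \<subseteq> {k..<n}"
proof -
  have "Poly_Mapping.keys \<beta> \<subseteq> {k..<n}"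
    using assms(2)
  proof cases
    case (two i j s)
    thus ?thesis using keys_add[of "Poly_Mapping.single i 1" "Poly_Mapping.single j s"]
      by (auto split: if_splits)
  qed (auto split: if_splits)
  thus ?thesis using assms(1) keys_add[of \<nu> \<beta>] by blast
qed

lemma partial_fractions:
  fixes X Y :: complex
  assumes "X \<noteq> 1" "Y \<noteq> 1" "X * Y \<noteq> 1"
  shows "1 / (1 - X) * (1 / (1 - Y)) =
    1 / (1 - X * Y) * (1 / (1 - X)) + Y * (1 / (1 - X * Y) * (1 / (1 - Y)))"
proof -
  have "1 - X \<noteq> 0" "1 - Y \<noteq> 0" "1 - X * Y \<noteq> 0" using assms by auto
  thus ?thesis by (simp add: divide_simps) (simp add: algebra_simps)
qed

text \<open>Elimination of \<open>z_k\<close>. As long as two denominators have opposite signs in \<open>z_k\<close>, partial fractions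
  give a sum of two terms, each with only one of them and a denominator free of \<open>z_k\<close>. Once all signs
  agree with some sign \<open>s\<close>, the identity \<open>1 / (1 - X) = 1 + X / (1 - X)\<close> either removes a denominator or
  moves the power of \<open>z_k\<close> one step in direction \<open>s\<close>; as soon as this power points in direction \<open>s\<close>, the
  integral vanishes.\<close>

lemma rational_integrals_step:
  assumes k: "k < n" and IH: "rational_integrals n (Suc k)"
  shows "rational_integrals n k"
proof -
  define act where "act = (\<lambda>x::factor. Poly_Mapping.lookup (snd x) k \<noteq> 0)"
  have main: "is_rational (\<lambda>p. torus_integral n (geom_term n \<nu> L p))"
    if "Poly_Mapping.keys \<nu> \<subseteq> {k..<n}" "\<forall>x\<in>#L. good_factor n k x" for \<nu> L
    using that
  proof (induction "size (filter_mset act L)" arbitrary: \<nu> L rule: less_induct)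
    case (less L \<nu>)
    have fewer: "is_rational (\<lambda>p. torus_integral n (geom_term n \<nu>' L' p))"
      if "Poly_Mapping.keys \<nu>' \<subseteq> {k..<n}" "\<forall>x\<in>#L'. good_factor n k x"
        "size (filter_mset act L') < size (filter_mset act L)" for \<nu>' L'
      using less.hyps that by blast
    have comps: "\<nu>' \<in> compositions n" if "Poly_Mapping.keys \<nu>' \<subseteq> {k..<n}" for \<nu>'
      using that by (auto simp: compositions_def)
    show ?case
    \<comment> \<open>opposite signs in \<open>z_k\<close>: each of the two new terms has one active factor less\<close>
    proof (cases "\<exists>x y. x \<in># L \<and> y \<in># L \<and> Poly_Mapping.lookup (snd x) k = 1 \<and> Poly_Mapping.lookup (snd y) k = -1")
      case True
      then obtain x y where xy: "x \<in># L" "y \<in># L" "Poly_Mapping.lookup (snd x) k = 1" "Poly_Mapping.lookup (snd y) k = -1"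
        by blast
      then obtain L1 where L1: "L = add_mset x L1" by (meson multi_member_split)
      have "y \<in># L1" using xy L1 by auto
      then obtain L2 where L2: "L1 = add_mset y L2" by (meson multi_member_split)
      \<comment> \<open>the denominator \<open>1 - X Y\<close>, from which \<open>z_k\<close> has cancelled\<close>
      define v where "v = (\<lambda>p. fst x p * fst y p, snd x + snd y)"
      have gx: "good_factor n k x" and gy: "good_factor n k y" and gL2: "\<forall>x\<in>#L2. good_factor n k x"
        using less.prems L1 L2 by auto
      have "norm (fst x p * fst y p) < 1" if "p \<in> polydisc" for p
        using gx gy that mult_strict_mono[of "norm (fst x p)" 1 "norm (fst y p)" 1]
        by (cases "fst x p = 0") (auto simp: good_factor_def norm_mult)
      hence gv': "good_factor n (Suc k) v"
        using gx gy xy by (auto simp: good_factor_def v_def intro: is_poly_mult short_exponents_cancel)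
      hence gv: "good_factor n k v" by (rule good_factor_mono)
      have v_inactive: "\<not> act v" using xy by (simp add: act_def v_def lookup_add)
      have actxy: "act x" "act y" using xy by (auto simp: act_def)
      have ky: "Poly_Mapping.keys (\<nu> + snd y) \<subseteq> {k..<n}"
        using less.prems gy by (intro keys_add_range) (auto simp: good_factor_def)
      define La where "La = add_mset v (add_mset x L2)"
      define Lb where "Lb = add_mset v (add_mset y L2)"
      have "torus_integral n (geom_term n \<nu> L p) =
            torus_integral n (geom_term n \<nu> La p) + fst y p * torus_integral n (geom_term n (\<nu> + snd y) Lb p)"
        if p: "p \<in> polydisc" for p
      proof (rule torus_integral_add_geom_term[OF p])
        fix z assume z: "z \<in> torus"
        define X Y where "X = fst x p * zpow n (snd x) z" and "Y = fst y p * zpow n (snd y) z"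
        define R where "R = (\<Prod>x\<in>#L2. geom_factor n p z x)"
        have v: "fst v p * zpow n (snd v) z = X * Y"
          by (simp add: v_def X_def Y_def zpow_add[OF z])
        have "1 / (1 - X) * (1 / (1 - Y)) =
              1 / (1 - X * Y) * (1 / (1 - X)) + Y * (1 / (1 - X * Y) * (1 / (1 - Y)))"
          using geom_factor_denominator_nonzero[OF p z gx] geom_factor_denominator_nonzero[OF p z gy]
            geom_factor_denominator_nonzero[OF p z gv]
          unfolding v by (intro partial_fractions) (auto simp: X_def Y_def)
        hence "zpow n \<nu> z * (1 / (1 - X) * (1 / (1 - Y))) * R =
               zpow n \<nu> z * (1 / (1 - X * Y) * (1 / (1 - X)) + Y * (1 / (1 - X * Y) * (1 / (1 - Y)))) * R"
          by (rule arg_cong)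
        moreover have "geom_term n \<nu> L p z = zpow n \<nu> z * (1 / (1 - X) * (1 / (1 - Y))) * R"
          by (simp add: geom_term_def L1 L2 geom_factor_def[of _ _ _ x] geom_factor_def[of _ _ _ y] X_def Y_def R_def)
        moreover have "geom_term n \<nu> La p z = zpow n \<nu> z * (1 / (1 - X * Y) * (1 / (1 - X))) * R"
          by (simp add: geom_term_def La_def geom_factor_def[of _ _ _ x] geom_factor_def[of _ _ _ v] v)
             (simp add: X_def R_def)
        moreover have "fst y p * geom_term n (\<nu> + snd y) Lb p z = zpow n \<nu> z * (Y * (1 / (1 - X * Y) * (1 / (1 - Y)))) * R"
          by (simp add: geom_term_def Lb_def geom_factor_def[of _ _ _ y] geom_factor_def[of _ _ _ v] v zpow_add[OF z])
             (simp add: Y_def R_def)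
        ultimately show "geom_term n \<nu> L p z = geom_term n \<nu> La p z + fst y p * geom_term n (\<nu> + snd y) Lb p z"
          by (simp only: distrib_left distrib_right)
      qed (use gx gy gv gL2 comps less.prems(1) ky in \<open>auto simp: La_def Lb_def\<close>)
      moreover have "is_rational (\<lambda>p. torus_integral n (geom_term n \<nu> La p) +
                       fst y p * torus_integral n (geom_term n (\<nu> + snd y) Lb p))"
        using gx gy gv gL2 less.prems(1) ky actxy v_inactive
        by (intro is_rational_add is_rational_mult fewer is_rational_poly)
           (auto simp: La_def Lb_def L1 L2 good_factor_def)
      ultimately show ?thesis by (rule is_rational_cong)
    next
      case False
      have vals: "Poly_Mapping.lookup (snd x) k \<in> {-1, 0, 1}" if "x \<in># L" for x
        using less.prems(2) that by (auto simp: good_factor_def dest!: short_exponents_lookup)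
      have "\<exists>s\<in>{1, -1::int}. \<forall>x\<in>#L. act x \<longrightarrow> Poly_Mapping.lookup (snd x) k = s"
      proof (cases "\<exists>x\<in>#L. Poly_Mapping.lookup (snd x) k = 1")
        case True
        thus ?thesis using False vals by (intro bexI[of _ 1]) (fastforce simp: act_def)+
      next
        case False
        thus ?thesis using vals by (intro bexI[of _ "-1"]) (fastforce simp: act_def)+
      qed
      then obtain s :: int where s: "s = 1 \<or> s = -1" "\<forall>x\<in>#L. act x \<longrightarrow> Poly_Mapping.lookup (snd x) k = s"
        by blast
      \<comment> \<open>with weight \<open>s'\<close> on coordinate \<open>k\<close> alone\<close>
      have vanish: "torus_integral n (geom_term n \<rho> L p) = 0"
        if "0 < s' * Poly_Mapping.lookup \<rho> k" "\<rho> \<in> compositions n" "p \<in> polydisc"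
           "\<forall>x\<in>#L. 0 \<le> s' * Poly_Mapping.lookup (snd x) k" for \<rho> p s'
        using weight_limit_geom_term[of p L n k "\<lambda>i. if i = k then s' else 0" \<rho>] that less.prems(2) k
        by (intro torus_integral_positive_weight[where w = "\<lambda>i. if i = k then s' else 0"]) (auto simp: weight_delta)
      have s_nonneg: "\<forall>x\<in>#L. 0 \<le> s * Poly_Mapping.lookup (snd x) k"
        using s by (auto simp: act_def)
      show ?thesis
      proof (cases "filter_mset act L = {#}")
        case True
        hence "set_mset (filter_mset act L) = {}" by simp
        hence inactive: "\<forall>x\<in>#L. Poly_Mapping.lookup (snd x) k = 0"
          by (auto simp: act_def)
        show ?thesis
        proof (cases "Poly_Mapping.lookup \<nu> k = 0")
          case True
          have "Poly_Mapping.keys \<nu> \<subseteq> {Suc k..<n}"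
            using less.prems(1) True by (force simp: in_keys_iff subset_iff Suc_le_eq order.strict_iff_order)
          moreover have "\<forall>x\<in>#L. good_factor n (Suc k) x"
            using less.prems(2) inactive by (auto simp: good_factor_def intro: short_exponents_Suc)
          ultimately show ?thesis using IH unfolding rational_integrals_def by blast
        next
          case False
          have "torus_integral n (geom_term n \<nu> L p) = 0" if "p \<in> polydisc" for p
            using vanish[of "sgn (Poly_Mapping.lookup \<nu> k)" \<nu> p] that False inactive comps less.prems(1)
            by (auto simp: sgn_if split: if_splits)
          thus ?thesis by (rule is_rational_cong[OF _ is_rational_const])
        qed
      next
        case False
        then obtain x where "x \<in># filter_mset act L" by (meson multiset_nonemptyE)
        hence x: "x \<in># L" "act x" by auto
        then obtain L1 where L1: "L = add_mset x L1" by (meson multi_member_split)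
        have gx: "good_factor n k x" and gL1: "\<forall>x\<in>#L1. good_factor n k x"
          using less.prems(2) L1 by auto
        have xs: "s * Poly_Mapping.lookup (snd x) k = 1" using s x by auto
        have "is_rational (\<lambda>p. torus_integral n (geom_term n \<rho> L p))"
          if "Poly_Mapping.keys \<rho> \<subseteq> {k..<n}" for \<rho>
          using that
        \<comment> \<open>the power of \<open>z_k\<close> moves in direction \<open>s\<close> until it points there\<close>
        proof (induction "nat (1 - s * Poly_Mapping.lookup \<rho> k)" arbitrary: \<rho> rule: less_induct)
          case (less \<rho>)
          show ?case
          proof (cases "0 < s * Poly_Mapping.lookup \<rho> k")
            case True
            have "torus_integral n (geom_term n \<rho> L p) = 0" if "p \<in> polydisc" for p
              using vanish[OF True] that s_nonneg comps less.prems by blast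
            thus ?thesis by (rule is_rational_cong[OF _ is_rational_const])
          next
            case False
            have kx: "Poly_Mapping.keys (\<rho> + snd x) \<subseteq> {k..<n}"
              using less.prems gx by (intro keys_add_range) (auto simp: good_factor_def)
            have "torus_integral n (geom_term n \<rho> L p) =
                  torus_integral n (geom_term n \<rho> L1 p) + fst x p * torus_integral n (geom_term n (\<rho> + snd x) L p)"
              if p: "p \<in> polydisc" for p
            proof (rule torus_integral_add_geom_term[OF p])
              fix z assume z: "z \<in> torus"
              show "geom_term n \<rho> L p z = geom_term n \<rho> L1 p z + fst x p * geom_term n (\<rho> + snd x) L p z"
                using geom_factor_denominator_nonzero[OF p z gx]
                by (simp add: geom_term_def L1 geom_factor_def[of _ _ _ x] zpow_add[OF z] field_simps)
            qed (use gx gL1 L1 comps kx less.prems in auto)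
            moreover have "is_rational (\<lambda>p. torus_integral n (geom_term n \<rho> L1 p) +
                             fst x p * torus_integral n (geom_term n (\<rho> + snd x) L p))"
            proof (rule is_rational_add[OF _ is_rational_mult[OF is_rational_poly]])
              show "is_rational (\<lambda>p. torus_integral n (geom_term n \<rho> L1 p))"
                using less.prems gL1 x by (intro fewer) (auto simp: L1)
              show "is_rational (\<lambda>p. torus_integral n (geom_term n (\<rho> + snd x) L p))"
                using kx xs False by (intro less.hyps) (auto simp: lookup_add distrib_left)
              show "is_poly (fst x)" using gx by (simp add: good_factor_def)
            qed
            ultimately show ?thesis by (rule is_rational_cong)
          qed
        qed
        thus ?thesis using less.prems(1) by blast
      qed
    qed
  qed
  thus ?thesis by (auto simp: rational_integrals_def)
qed

lemma rational_integrals_all: "k \<le> n \<Longrightarrow> rational_integrals n k"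
  by (induction rule: inc_induct) (auto intro: rational_integrals_base rational_integrals_step)

text \<open>The shape of the density at \<open>q = 0\<close>; the equation is only required where the integrals are taken.\<close>

definition factored :: "nat \<Rightarrow> (par \<Rightarrow> (nat \<Rightarrow> complex) \<Rightarrow> complex) \<Rightarrow> bool" where
  "factored n F \<longleftrightarrow>
     (\<exists>\<Gamma> L. (\<forall>\<gamma>\<in>#\<Gamma>. \<gamma> \<in> compositions n) \<and> (\<forall>x\<in>#L. good_factor n 0 x) \<and>
        (\<forall>p\<in>polydisc. \<forall>z\<in>torus. F p z = (\<Prod>\<gamma>\<in>#\<Gamma>. 1 - zpow n \<gamma> z) * (\<Prod>x\<in>#L. geom_factor n p z x)))"

lemma factored_one: "factored n (\<lambda>p z. 1)"
  unfolding factored_def by (intro exI[of _ "{#}"]) simp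

lemma factored_mult:
  assumes "factored n F" "factored n G"
  shows "factored n (\<lambda>p z. F p z * G p z)"
proof -
  obtain \<Gamma> L \<Gamma>' L' where
    "\<forall>\<gamma>\<in>#\<Gamma>. \<gamma> \<in> compositions n" "\<forall>x\<in>#L. good_factor n 0 x"
    "\<forall>p\<in>polydisc. \<forall>z\<in>torus. F p z = (\<Prod>\<gamma>\<in>#\<Gamma>. 1 - zpow n \<gamma> z) * (\<Prod>x\<in>#L. geom_factor n p z x)"
    "\<forall>\<gamma>\<in>#\<Gamma>'. \<gamma> \<in> compositions n" "\<forall>x\<in>#L'. good_factor n 0 x"
    "\<forall>p\<in>polydisc. \<forall>z\<in>torus. G p z = (\<Prod>\<gamma>\<in>#\<Gamma>'. 1 - zpow n \<gamma> z) * (\<Prod>x\<in>#L'. geom_factor n p z x)"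
    using assms unfolding factored_def by blast
  thus ?thesis unfolding factored_def
    by (intro exI[of _ "\<Gamma> + \<Gamma>'"] exI[of _ "L + L'"]) auto
qed

lemma factored_prod:
  "(\<And>i. i \<in> A \<Longrightarrow> factored n (F i)) \<Longrightarrow> factored n (\<lambda>p z. \<Prod>i\<in>A. F i p z)"
  by (induction A rule: infinite_finite_induct) (auto intro: factored_mult factored_one)

lemma factored_numerator: "\<gamma> \<in> compositions n \<Longrightarrow> factored n (\<lambda>p z. 1 - zpow n \<gamma> z)"
  unfolding factored_def by (intro exI[of _ "{#\<gamma>#}"] exI[of _ "{#}"]) simp

lemma factored_denominator:
  assumes "is_poly m" "\<And>p. p \<in> polydisc \<Longrightarrow> norm (m p) < 1" "\<beta> \<in> short_exponents n 0"
  shows "factored n (\<lambda>p z. 1 / (1 - m p * zpow n \<beta> z))"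
  unfolding factored_def using assms
  by (rule_tac exI[of _ "{#}"], rule_tac exI[of _ "{#(m, \<beta>)#}"])
     (simp add: geom_factor_def good_factor_def)

lemma is_rational_torus_integral:
  assumes F: "factored n F" and \<nu>: "\<nu> \<in> compositions n"
  shows "is_rational (\<lambda>p. torus_integral n (\<lambda>z. zpow n \<nu> z * F p z))"
proof -
  obtain \<Gamma> L where \<Gamma>: "\<forall>\<gamma>\<in>#\<Gamma>. \<gamma> \<in> compositions n" and L: "\<forall>x\<in>#L. good_factor n 0 x"
    and eq: "\<And>p z. p \<in> polydisc \<Longrightarrow> z \<in> torus \<Longrightarrow> F p z = (\<Prod>\<gamma>\<in>#\<Gamma>. 1 - zpow n \<gamma> z) * (\<Prod>x\<in>#L. geom_factor n p z x)"
    using F unfolding factored_def by blast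
  define H where "H = (\<lambda>\<Gamma> \<nu> p z. zpow n \<nu> z * (\<Prod>\<gamma>\<in>#\<Gamma>. 1 - zpow n \<gamma> z) * (\<Prod>x\<in>#L. geom_factor n p z x))"
  have w0: "weight n (\<lambda>_. 0) \<nu> = 0" for \<nu> by (simp add: weight_def)
  have lim: "weight_limit n (\<lambda>_. 0) 0 (H \<Gamma> \<nu> p)"
    if "\<forall>\<gamma>\<in>#\<Gamma>. \<gamma> \<in> compositions n" "\<nu> \<in> compositions n" "p \<in> polydisc" for \<Gamma> \<nu> p
  proof -
    have "weight_limit n (\<lambda>_. 0) 0 (\<lambda>z. \<Prod>\<gamma>\<in>#\<Gamma>. 1 - zpow n \<gamma> z)" using that(1)
    proof (induction \<Gamma>)
      case (add \<gamma> \<Gamma>)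
      have "weight_limit n (\<lambda>_. 0) 0 (\<lambda>z. 1 + (-1) * zpow n \<gamma> z)"
        using add.prems by (intro weight_limit_add weight_limit_const weight_limit_zpow) (auto simp: w0)
      thus ?case using add by (auto intro!: weight_limit_mult0)
    qed (auto intro: weight_limit_const)
    moreover have "weight_limit n (\<lambda>_. 0) 0 (\<lambda>z. \<Prod>x\<in>#L. geom_factor n p z x)"
      using that L by (intro weight_limit_geom_factors) (auto simp: w0)
    moreover have "weight_limit n (\<lambda>_. 0) 0 (zpow n \<nu>)"
      using weight_limit_zpow[OF that(2), of 0 "\<lambda>_. 0" 1] by (simp add: w0)
    ultimately show ?thesis unfolding H_def by (intro weight_limit_mult0)
  qed
  have "is_rational (\<lambda>p. torus_integral n (H \<Gamma> \<nu> p))"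
    if "\<forall>\<gamma>\<in>#\<Gamma>. \<gamma> \<in> compositions n" "\<nu> \<in> compositions n" for \<Gamma> \<nu>
    using that
  proof (induction \<Gamma> arbitrary: \<nu>)
    case empty
    have "H {#} \<nu> p = geom_term n \<nu> L p" for p by (simp add: H_def geom_term_def fun_eq_iff)
    moreover have "is_rational (\<lambda>p. torus_integral n (geom_term n \<nu> L p))"
      using rational_integrals_all[of 0 n] empty L
      unfolding rational_integrals_def compositions_def by (auto simp: atLeast0LessThan)
    ultimately show ?case by simp
  next
    case (add \<gamma> \<Gamma>)
    have \<nu>\<gamma>: "\<nu> + \<gamma> \<in> compositions n" using add.prems by (auto intro: compositions_add)
    have "torus_integral n (H (add_mset \<gamma> \<Gamma>) \<nu> p) = torus_integral n (H \<Gamma> \<nu> p) - torus_integral n (H \<Gamma> (\<nu> + \<gamma>) p)"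
      if "p \<in> polydisc" for p
    proof -
      have "torus_integral n (H (add_mset \<gamma> \<Gamma>) \<nu> p) = torus_integral n (\<lambda>z. H \<Gamma> \<nu> p z - H \<Gamma> (\<nu> + \<gamma>) p z)"
        by (rule torus_integral_cong) (simp add: H_def zpow_add algebra_simps)
      also have "\<dots> = torus_integral n (H \<Gamma> \<nu> p) - torus_integral n (H \<Gamma> (\<nu> + \<gamma>) p)"
        using add.prems \<nu>\<gamma> that by (intro torus_integral_diff[OF lim lim]) auto
      finally show ?thesis .
    qed
    moreover have "is_rational (\<lambda>p. torus_integral n (H \<Gamma> \<nu> p) - torus_integral n (H \<Gamma> (\<nu> + \<gamma>) p))"
      by (rule is_rational_diff; rule add.IH) (use add.prems \<nu>\<gamma> in simp_all)
    ultimately show ?case by (rule is_rational_cong)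
  qed
  hence "is_rational (\<lambda>p. torus_integral n (H \<Gamma> \<nu> p))" using \<Gamma> \<nu> by blast
  thus ?thesis
  proof (rule is_rational_cong[rotated])
    fix p assume "p \<in> polydisc"
    thus "torus_integral n (\<lambda>z. zpow n \<nu> z * F p z) = torus_integral n (H \<Gamma> \<nu> p)"
      by (intro torus_integral_cong) (simp add: eq H_def)
  qed
qed

section \<open>The density as q tends to 0\<close>

text \<open>The infinite product without its first factor. It tends to one uniformly for \<open>\<bar>x\<bar> \<le> 1\<close> as
  \<open>q\<close> tends to zero, so it controls both the limit of the density and its bounds.\<close>

definition euler_tail :: "complex \<Rightarrow> complex \<Rightarrow> complex" where
  "euler_tail x q = prodinf (\<lambda>k. 1 - x * q ^ Suc k)"

lemma qpoch_convergent:
  assumes "norm (q::complex) < 1"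
  shows "convergent_prod (\<lambda>k. 1 - x * q ^ k)" "convergent_prod (\<lambda>k. 1 - x * q ^ Suc k)"
proof -
  have *: "summable (\<lambda>k. norm (- y * q ^ k))" for y
    using assms by (simp add: norm_mult norm_power summable_mult summable_geometric)
  have "convergent_prod (\<lambda>k. 1 + (- y * q ^ k))" for y
    by (rule abs_convergent_prod_imp_convergent_prod) (use *[of y] in \<open>simp add: abs_convergent_prod_conv_summable\<close>)
  from this[of x] this[of "x * q"]
  show "convergent_prod (\<lambda>k. 1 - x * q ^ k)" "convergent_prod (\<lambda>k. 1 - x * q ^ Suc k)"
    by (simp_all add: mult_ac)
qed

lemma qpoch_inf_eq: 
  assumes "norm q < 1"
  shows "qpoch_inf x q = (1 - x) * euler_tail x q"
  unfolding qpoch_inf_def euler_tail_def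
  using has_prod_ignore_initial_segment'[OF qpoch_convergent(1)[OF assms, of x], of 1]
  by (simp add: has_prod_iff)

lemma euler_tail_LIMSEQ:
  assumes "norm q < 1"
  shows "(\<lambda>N. \<Prod>k\<le>N. 1 - x * q ^ Suc k) \<longlonglongrightarrow> euler_tail x q"
  unfolding euler_tail_def using convergent_prod_LIMSEQ[OF qpoch_convergent(2)[OF assms]] .

text \<open>The product differs from one by at most \<open>exp s - 1\<close>, where \<open>s\<close> is the sum of the moduli \<open>\<bar>q\<bar>^(k+1)\<close>,
  which is at most \<open>2 \<bar>q\<bar>\<close>.\<close>

lemma norm_euler_tail_minus_one_le:
  assumes q: "norm q \<le> 1 / 8" and x: "norm x \<le> 1"
  shows "norm (euler_tail x q - 1) \<le> exp (2 * norm q) - 1"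
proof -
  have "norm ((\<Prod>k\<le>N. 1 - x * q ^ Suc k) - 1) \<le> exp (2 * norm q) - 1" for N
  proof -
    have "norm ((\<Prod>k\<le>N. 1 + (- x * q ^ Suc k)) - 1) \<le> (\<Prod>k\<le>N. 1 + norm (- x * q ^ Suc k)) - 1"
      by (rule norm_prod_minus1_le_prod_minus1)
    also have "(\<Prod>k\<le>N. 1 + norm (- x * q ^ Suc k)) \<le> exp (\<Sum>k\<le>N. norm (- x * q ^ Suc k))"
      by (rule prod_le_exp_sum) auto
    also have "(\<Sum>k\<le>N. norm (- x * q ^ Suc k)) \<le> (\<Sum>k\<le>N. norm q * norm q ^ k)"
      using x by (intro sum_mono) (auto simp: norm_mult norm_power intro!: mult_left_le_one_le)
    also have "\<dots> = norm q * (\<Sum>k\<le>N. norm q ^ k)" by (simp add: sum_distrib_left)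
    also have "\<dots> \<le> norm q * 2"
    proof (rule mult_left_mono)
      have "(\<Sum>k\<le>N. norm q ^ k) \<le> (\<Sum>k\<le>N. (1/2) ^ k)"
        using q by (intro sum_mono power_mono) auto
      also have "\<dots> \<le> 2" unfolding sum_gp0 by simp
      finally show "(\<Sum>k\<le>N. norm q ^ k) \<le> 2" .
    qed simp
    finally show ?thesis by (simp add: mult.commute)
  qed
  moreover have "(\<lambda>N. norm ((\<Prod>k\<le>N. 1 - x * q ^ Suc k) - 1)) \<longlonglongrightarrow> norm (euler_tail x q - 1)"
    using q by (intro tendsto_intros euler_tail_LIMSEQ) auto
  ultimately show ?thesis by (intro LIMSEQ_le_const2) auto
qed

lemma norm_euler_tail_bounds:
  assumes q: "norm q \<le> 1 / 8" and x: "norm x \<le> 1"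
  shows "norm (euler_tail x q) \<le> 2" "1 / 2 \<le> norm (euler_tail x q)"
proof -
  have "exp (2 * norm q) \<le> exp (1 / 4)" using q by simp
  also have "exp (1 / 4 :: real) \<le> 3 / 2"
    using exp_bound[of "1 / 4 :: real"] by (simp add: power2_eq_square)
  finally have *: "norm (euler_tail x q - 1) \<le> 1 / 2"
    using norm_euler_tail_minus_one_le[OF assms] by simp
  show "norm (euler_tail x q) \<le> 2" "1 / 2 \<le> norm (euler_tail x q)"
    using * norm_triangle_ineq2[of "euler_tail x q" 1] norm_triangle_ineq3[of "euler_tail x q" 1] by auto
qed

text \<open>The hypotheses of dominated convergence for \<open>q\<close> tending to zero. The radius \<open>1/8\<close> only serves to keep
  the products \<open>euler_tail\<close> away from zero.\<close>

definition tame :: "nat \<Rightarrow> (complex \<Rightarrow> (nat \<Rightarrow> complex) \<Rightarrow> complex) \<Rightarrow> bool" where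
  "tame n F \<longleftrightarrow>
     (\<forall>q. norm q \<le> 1 / 8 \<longrightarrow> (\<lambda>\<theta>. F q (torus_point \<theta>)) \<in> borel_measurable (torus_measure n)) \<and>
     (\<exists>B. \<forall>q. norm q \<le> 1 / 8 \<longrightarrow> (\<forall>z\<in>torus. norm (F q z) \<le> B)) \<and>
     (\<forall>z\<in>torus. ((\<lambda>q. F q z) \<longlongrightarrow> F 0 z) (at 0))"

lemma tame_cong:
  assumes "\<And>q z. z \<in> torus \<Longrightarrow> F q z = G q z"
  shows "tame n F \<longleftrightarrow> tame n G"
  using assms by (simp add: tame_def)

lemma tame_mult:
  assumes "tame n F" "tame n G"
  shows "tame n (\<lambda>q z. F q z * G q z)"
proof -
  obtain A B where A: "\<And>q z. norm q \<le> 1 / 8 \<Longrightarrow> z \<in> torus \<Longrightarrow> norm (F q z) \<le> A"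
    and B: "\<And>q z. norm q \<le> 1 / 8 \<Longrightarrow> z \<in> torus \<Longrightarrow> norm (G q z) \<le> B"
    using assms unfolding tame_def by blast
  have "norm (F q z * G q z) \<le> A * B" if "norm q \<le> 1 / 8" "z \<in> torus" for q z
    using A[OF that] B[OF that] order.trans[OF norm_ge_zero A[OF that]] unfolding norm_mult
    by (intro mult_mono) auto
  thus ?thesis using assms unfolding tame_def
    by (auto intro!: borel_measurable_times tendsto_mult)
qed

lemma tame_zpow: "tame n (\<lambda>q z. zpow n \<nu> z)"
  unfolding tame_def by (auto intro!: exI[of _ 1] simp: norm_zpow)

lemma tame_prod:
  "(\<And>i. i \<in> A \<Longrightarrow> tame n (F i)) \<Longrightarrow> tame n (\<lambda>q z. \<Prod>i\<in>A. F i q z)"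
proof (induction A rule: infinite_finite_induct)
  case (insert x A)
  thus ?case by (auto intro!: tame_mult)
qed (use tame_zpow[of n 0] in simp_all)

lemma tame_inverse:
  assumes F: "tame n F" and r: "r > 0"
    and low: "\<And>q z. norm q \<le> 1 / 8 \<Longrightarrow> z \<in> torus \<Longrightarrow> r \<le> norm (F q z)"
  shows "tame n (\<lambda>q z. 1 / F q z)"
proof -
  have "F 0 z \<noteq> 0" if "z \<in> torus" for z using low[of 0 z] that r by auto
  moreover have "norm (1 / F q z) \<le> 1 / r" if "norm q \<le> 1 / 8" "z \<in> torus" for q z
    using low[OF that] r by (simp add: norm_divide frac_le)
  ultimately show ?thesis using F unfolding tame_def
    by (auto intro!: borel_measurable_divide tendsto_divide exI[of _ "1 / r"])
qed

lemma tame_qpoch: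
  assumes c: "norm c \<le> 1"
  shows "tame n (\<lambda>q z. qpoch_inf (c * q ^ e * zpow n \<beta> z) q)"
proof -
  have x1: "norm (c * q ^ e * zpow n \<beta> z) \<le> 1" if "norm q \<le> 1 / 8" "z \<in> torus" for q z
    using that c power_le_one[of "norm q" e]
    by (auto simp: norm_mult norm_power norm_zpow intro!: mult_le_one)
  have bound: "norm (qpoch_inf (c * q ^ e * zpow n \<beta> z) q) \<le> 2 * 2" if "norm q \<le> 1 / 8" "z \<in> torus" for q z
  proof -
    have "norm (1 - c * q ^ e * zpow n \<beta> z) \<le> 2"
      using norm_triangle_ineq4[of 1 "c * q ^ e * zpow n \<beta> z"] x1[OF that] by simp
    hence "norm (1 - c * q ^ e * zpow n \<beta> z) * norm (euler_tail (c * q ^ e * zpow n \<beta> z) q) \<le> 2 * 2"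
      using norm_euler_tail_bounds(1)[OF that(1) x1[OF that]] by (intro mult_mono) auto
    thus ?thesis using that(1) by (simp add: qpoch_inf_eq norm_mult)
  qed
  have meas: "(\<lambda>\<theta>. qpoch_inf (c * q ^ e * zpow n \<beta> (torus_point \<theta>)) q) \<in> borel_measurable (torus_measure n)"
    if "norm q \<le> 1 / 8" for q
  proof (rule borel_measurable_LIMSEQ_metric)
    fix \<theta>
    show "(\<lambda>N. \<Prod>k\<le>N. 1 - c * q ^ e * zpow n \<beta> (torus_point \<theta>) * q ^ k)
            \<longlonglongrightarrow> qpoch_inf (c * q ^ e * zpow n \<beta> (torus_point \<theta>)) q"
      unfolding qpoch_inf_def using that
      by (intro convergent_prod_LIMSEQ qpoch_convergent) auto
  qed measurable
  have lim: "((\<lambda>q. qpoch_inf (c * q ^ e * zpow n \<beta> z) q) \<longlongrightarrow> qpoch_inf (c * 0 ^ e * zpow n \<beta> z) 0) (at 0)"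
    if z: "z \<in> torus" for z
  proof -
    have small: "\<forall>\<^sub>F q::complex in at 0. norm q \<le> 1 / 8"
      unfolding eventually_at by (intro exI[of _ "1/8"]) auto
    have "((\<lambda>q. exp (2 * norm q) - 1) \<longlongrightarrow> exp (2 * norm (0::complex)) - 1) (at (0::complex))"
      by (intro tendsto_intros)
    hence "((\<lambda>q. exp (2 * norm q) - 1) \<longlongrightarrow> 0) (at (0::complex))" by simp
    hence "((\<lambda>q. euler_tail (c * q ^ e * zpow n \<beta> z) q - 1) \<longlongrightarrow> 0) (at 0)"
      by (rule Lim_null_comparison[rotated])
         (use small x1[OF _ z] norm_euler_tail_minus_one_le in \<open>auto elim!: eventually_mono\<close>)
    hence tail: "((\<lambda>q. euler_tail (c * q ^ e * zpow n \<beta> z) q) \<longlongrightarrow> 1) (at 0)"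
      by (simp add: LIM_zero_iff)
    have "((\<lambda>q. (1 - c * q ^ e * zpow n \<beta> z) * euler_tail (c * q ^ e * zpow n \<beta> z) q)
            \<longlongrightarrow> (1 - c * 0 ^ e * zpow n \<beta> z) * 1) (at 0)"
      by (intro tendsto_intros tail)
    moreover have "\<forall>\<^sub>F q in at 0. (1 - c * q ^ e * zpow n \<beta> z) * euler_tail (c * q ^ e * zpow n \<beta> z) q
         = qpoch_inf (c * q ^ e * zpow n \<beta> z) q"
      using small by eventually_elim (rule qpoch_inf_eq[symmetric], simp)
    moreover have "qpoch_inf (c * 0 ^ e * zpow n \<beta> z) 0 = 1 - c * 0 ^ e * zpow n \<beta> z"
      by (simp add: qpoch_inf_eq euler_tail_def)
    ultimately show ?thesis by (auto elim: Lim_transform_eventually)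
  qed
  show ?thesis unfolding tame_def using bound meas lim by blast
qed

lemma tame_inverse_qpoch:
  assumes c: "norm c < 1"
  shows "tame n (\<lambda>q z. 1 / qpoch_inf (c * q ^ e * zpow n \<beta> z) q)"
proof (rule tame_inverse)
  show "tame n (\<lambda>q z. qpoch_inf (c * q ^ e * zpow n \<beta> z) q)" using c by (intro tame_qpoch) simp
  show "(1 - norm c) * (1 / 2) > 0" using c by simp
  fix q z assume q: "norm (q::complex) \<le> 1 / 8" and z: "z \<in> torus"
  have "norm (c * q ^ e * zpow n \<beta> z) = norm c * norm q ^ e"
    by (simp add: norm_mult norm_power norm_zpow z)
  also have "\<dots> \<le> norm c * 1"
    using q by (intro mult_left_mono power_le_one) auto
  finally have x: "norm (c * q ^ e * zpow n \<beta> z) \<le> norm c" by simp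
  have "(1 - norm c) * (1 / 2) \<le> norm (1 - c * q ^ e * zpow n \<beta> z) * norm (euler_tail (c * q ^ e * zpow n \<beta> z) q)"
    using x c norm_triangle_ineq2[of 1 "c * q ^ e * zpow n \<beta> z"] norm_euler_tail_bounds(2)[OF q, of "c * q ^ e * zpow n \<beta> z"]
    by (intro mult_mono) auto
  thus "(1 - norm c) * (1 / 2) \<le> norm (qpoch_inf (c * q ^ e * zpow n \<beta> z) q)"
    using q by (simp add: qpoch_inf_eq norm_mult)
qed

lemma integrable_tame:
  assumes "tame n F" "norm q \<le> 1 / 8"
  shows "integrable (torus_measure n) (\<lambda>\<theta>. F q (torus_point \<theta>))"
proof -
  obtain B where "\<And>z. z \<in> torus \<Longrightarrow> norm (F q z) \<le> B"
    using assms unfolding tame_def by blast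
  moreover have "(\<lambda>\<theta>. F q (torus_point \<theta>)) \<in> borel_measurable (torus_measure n)"
    using assms by (simp add: tame_def)
  ultimately show ?thesis by (rule integrable_torus_bounded[rotated])
qed

lemma tendsto_torus_integral_tame:
  assumes "tame n F"
  shows "((\<lambda>q. torus_integral n (F q)) \<longlongrightarrow> torus_integral n (F 0)) (at 0)"
proof (rule tendsto_at_iff_sequentially[THEN iffD2], intro allI impI)
  fix X :: "nat \<Rightarrow> complex"
  assume X: "\<forall>i. X i \<in> UNIV - {0}" and X0: "X \<longlonglongrightarrow> 0"
  interpret prob_space "torus_measure n" by (rule prob_space_torus)
  obtain B where B: "\<And>q z. norm q \<le> 1 / 8 \<Longrightarrow> z \<in> torus \<Longrightarrow> norm (F q z) \<le> B"
    using assms unfolding tame_def by blast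
  have "\<forall>\<^sub>F i in sequentially. norm (X i) < 1 / 8"
    using order_tendstoD(2)[OF tendsto_norm[OF X0], of "1 / 8"] by simp
  then obtain N where N: "\<And>i. i \<ge> N \<Longrightarrow> norm (X i) \<le> 1 / 8"
    unfolding eventually_sequentially by (meson less_imp_le)
  have "(\<lambda>i. LINT \<theta>|torus_measure n. F (X (i + N)) (torus_point \<theta>)) \<longlonglongrightarrow> (LINT \<theta>|torus_measure n. F 0 (torus_point \<theta>))"
  proof (rule integral_dominated_convergence[where w = "\<lambda>_. B"])
    show "AE \<theta> in torus_measure n. (\<lambda>i. F (X (i + N)) (torus_point \<theta>)) \<longlonglongrightarrow> F 0 (torus_point \<theta>)"
    proof (rule AE_I2)
      fix \<theta>
      have "((\<lambda>q. F q (torus_point \<theta>)) \<longlongrightarrow> F 0 (torus_point \<theta>)) (at 0)"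
        using assms unfolding tame_def by simp
      hence "(\<lambda>i. F (X i) (torus_point \<theta>)) \<longlonglongrightarrow> F 0 (torus_point \<theta>)"
        using X X0 unfolding tendsto_at_iff_sequentially comp_def by blast
      thus "(\<lambda>i. F (X (i + N)) (torus_point \<theta>)) \<longlonglongrightarrow> F 0 (torus_point \<theta>)"
        by (rule LIMSEQ_ignore_initial_segment)
    qed
  qed (use assms N B in \<open>auto simp: tame_def\<close>)
  hence "(\<lambda>i. torus_integral n (F (X (i + N)))) \<longlonglongrightarrow> torus_integral n (F 0)"
    by (simp add: torus_integral_torus_point)
  thus "((\<lambda>q. torus_integral n (F q)) \<circ> X) \<longlonglongrightarrow> torus_integral n (F 0)"
    unfolding comp_def by (rule LIMSEQ_offset)
qed

section \<open>Linear systems depending on a parameter\<close>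

text \<open>Nonsingularity of a matrix indexed by a finite set, in a form that needs no enumeration of the set.\<close>

definition nondegenerate_on :: "'i set \<Rightarrow> ('i \<Rightarrow> 'i \<Rightarrow> complex) \<Rightarrow> bool" where
  "nondegenerate_on S G \<longleftrightarrow>
     (\<forall>w. (\<forall>i\<in>S. (\<Sum>j\<in>S. G i j * w j) = 0) \<longrightarrow> (\<forall>j\<in>S. w j = 0))"

definition gram_det :: "'i list \<Rightarrow> ('i \<Rightarrow> 'i \<Rightarrow> complex) \<Rightarrow> complex" where
  "gram_det xs G = Determinant.det (Matrix.mat (length xs) (length xs) (\<lambda>(i, j). G (xs ! i) (xs ! j)))"

lemma sum_set_nth:
  assumes "distinct xs"
  shows "(\<Sum>j\<in>set xs. f j) = (\<Sum>j<length xs. f (xs ! j))"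
  using assms by (simp add: sum.list_conv_set_nth flip: sum_list_distinct_conv_sum_set)
    (simp add: sum_list_sum_nth atLeast0LessThan)

lemma mult_mat_vec_nth:
  assumes "i < N"
  shows "vec_index (Matrix.mat N N A *\<^sub>v Matrix.vec N w) i = (\<Sum>j<N. A (i, j) * w j)"
  using assms by (simp add: scalar_prod_def atLeast0LessThan)

lemma nondegenerate_on_iff_gram_det:
  assumes "distinct xs"
  shows "nondegenerate_on (set xs) G \<longleftrightarrow> gram_det xs G \<noteq> 0"
proof -
  define N where "N = length xs"
  define A where "A = Matrix.mat N N (\<lambda>(i, j). G (xs ! i) (xs ! j))"
  have A: "A \<in> carrier_mat N N" by (simp add: A_def)
  have "gram_det xs G = 0 \<longleftrightarrow> (\<exists>v. v \<in> carrier_vec N \<and> v \<noteq> 0\<^sub>v N \<and> A *\<^sub>v v = 0\<^sub>v N)"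
    unfolding gram_det_def using det_0_iff_vec_prod_zero_field[OF A] by (simp add: A_def N_def)
  also have "\<dots> \<longleftrightarrow> \<not> nondegenerate_on (set xs) G"
  proof
    assume "\<exists>v. v \<in> carrier_vec N \<and> v \<noteq> 0\<^sub>v N \<and> A *\<^sub>v v = 0\<^sub>v N"
    then obtain v where v: "v \<in> carrier_vec N" "v \<noteq> 0\<^sub>v N" "A *\<^sub>v v = 0\<^sub>v N" by blast
    define idx where "idx = inv_into {..<N} ((!) xs)"
    have idx: "idx (xs ! j) = j" if "j < N" for j
      unfolding idx_def using that assms by (intro inv_into_f_f) (auto simp: inj_on_def N_def nth_eq_iff_index_eq)
    define w where "w = (\<lambda>x. vec_index v (idx x))"
    have vw: "v = Matrix.vec N (\<lambda>j. w (xs ! j))" using v(1) by (auto simp: w_def idx)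
    have "(\<Sum>j\<in>set xs. G (xs ! i) j * w j) = 0" if "i < N" for i
    proof -
      have "(\<Sum>j\<in>set xs. G (xs ! i) j * w j) = vec_index (A *\<^sub>v v) i"
        unfolding vw A_def mult_mat_vec_nth[OF that] sum_set_nth[OF assms] by (simp add: N_def)
      also have "\<dots> = 0" using v(3) that by simp
      finally show ?thesis .
    qed
    hence 1: "\<forall>i\<in>set xs. (\<Sum>j\<in>set xs. G i j * w j) = 0"
      by (metis in_set_conv_nth N_def)
    have "\<exists>j<N. w (xs ! j) \<noteq> 0" using v(2) unfolding vw by (auto simp: zero_vec_def)
    thus "\<not> nondegenerate_on (set xs) G" using 1 unfolding nondegenerate_on_def N_def
      by (meson nth_mem)
  next
    assume "\<not> nondegenerate_on (set xs) G"
    then obtain w j where w: "\<forall>i\<in>set xs. (\<Sum>j\<in>set xs. G i j * w j) = 0" "j \<in> set xs" "w j \<noteq> 0"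
      unfolding nondegenerate_on_def by blast
    define v where "v = Matrix.vec N (\<lambda>j. w (xs ! j))"
    obtain k where k: "k < N" "xs ! k = j" using w(2) by (auto simp: in_set_conv_nth N_def)
    have "vec_index v k \<noteq> 0" using k w(3) by (simp add: v_def)
    hence "v \<noteq> 0\<^sub>v N" using k by auto
    moreover have "A *\<^sub>v v = 0\<^sub>v N"
    proof (rule eq_vecI)
      fix i assume "i < dim_vec (0\<^sub>v N :: complex Matrix.vec)"
      hence i: "i < N" by simp
      have "vec_index (A *\<^sub>v v) i = (\<Sum>j\<in>set xs. G (xs ! i) j * w j)"
        unfolding v_def A_def mult_mat_vec_nth[OF i] sum_set_nth[OF assms] by (simp add: N_def)
      also have "\<dots> = 0" using w(1) i by (simp add: N_def)
      finally show "vec_index (A *\<^sub>v v) i = vec_index (0\<^sub>v N) i" using i by simp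
    qed (simp add: A_def)
    ultimately show "\<exists>v. v \<in> carrier_vec N \<and> v \<noteq> 0\<^sub>v N \<and> A *\<^sub>v v = 0\<^sub>v N"
      by (intro exI[of _ v]) (simp add: v_def)
  qed
  finally show ?thesis by blast
qed

lemma tendsto_det:
  assumes A: "\<And>x. A x \<in> carrier_mat N N" and B: "B \<in> carrier_mat N N"
    and lim: "\<And>i j. i < N \<Longrightarrow> j < N \<Longrightarrow> ((\<lambda>x. A x $$ (i, j)) \<longlongrightarrow> (B $$ (i, j) :: complex)) F"
  shows "((\<lambda>x. Determinant.det (A x)) \<longlongrightarrow> Determinant.det B) F"
proof -
  have "((\<lambda>x. \<Sum>p\<in>{p. p permutes {0..<N}}. signof p * (\<Prod>i = 0..<N. A x $$ (i, p i)))
         \<longlongrightarrow> (\<Sum>p\<in>{p. p permutes {0..<N}}. signof p * (\<Prod>i = 0..<N. B $$ (i, p i)))) F"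
    by (intro tendsto_sum tendsto_mult tendsto_const tendsto_prod lim)
       (auto dest: permutes_in_image)
  thus ?thesis by (simp add: det_def'[OF A] det_def'[OF B])
qed

text \<open>Cramer's rule expresses the solution by determinants, which depend continuously on the entries.\<close>

lemma cramer_limit:
  fixes G :: "'x \<Rightarrow> 'i \<Rightarrow> 'i \<Rightarrow> complex" and b :: "'x \<Rightarrow> 'i \<Rightarrow> complex"
  assumes "finite S" and nd: "nondegenerate_on S G0"
    and G: "\<And>i j. i \<in> S \<Longrightarrow> j \<in> S \<Longrightarrow> ((\<lambda>x. G x i j) \<longlongrightarrow> G0 i j) F"
    and b: "\<And>i. i \<in> S \<Longrightarrow> ((\<lambda>x. b x i) \<longlongrightarrow> b0 i) F"
  obtains w w0 where
    "\<And>j. j \<in> S \<Longrightarrow> ((\<lambda>x. w x j) \<longlongrightarrow> w0 j) F"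
    "\<And>i. i \<in> S \<Longrightarrow> (\<Sum>j\<in>S. G0 i j * w0 j) = b0 i"
    "\<forall>\<^sub>F x in F. nondegenerate_on S (G x) \<and> (\<forall>i\<in>S. (\<Sum>j\<in>S. G x i j * w x j) = b x i)"
proof -
  obtain xs where xs: "set xs = S" "distinct xs" using finite_distinct_list[OF \<open>finite S\<close>] by blast
  define N where "N = length xs"
  define M where "M = (\<lambda>H::'i \<Rightarrow> 'i \<Rightarrow> complex. Matrix.mat N N (\<lambda>(i, j). H (xs ! i) (xs ! j)))"
  have M: "M H \<in> carrier_mat N N" for H by (simp add: M_def)
  have det_M: "Determinant.det (M H) = gram_det xs H" for H by (simp add: M_def gram_det_def N_def)
  \<comment> \<open>the adjugate matrix applied to the right-hand side, divided by the determinant\<close>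
  define sol where "sol = (\<lambda>(H::'i \<Rightarrow> 'i \<Rightarrow> complex) (e::'i \<Rightarrow> complex) i.
     (\<Sum>j<N. adj_mat (M H) $$ (i, j) * e (xs ! j)) / Determinant.det (M H))"
  define idx where "idx = inv_into {..<N} ((!) xs)"
  have idx: "idx (xs ! j) = j" if "j < N" for j
    unfolding idx_def using that xs by (intro inv_into_f_f) (auto simp: inj_on_def N_def nth_eq_iff_index_eq)
  have idx_less: "idx j < N" if "j \<in> S" for j
    using that idx xs by (metis in_set_conv_nth N_def)
  have solves: "(\<Sum>j\<in>S. H i j * sol H e (idx j)) = e i"
    if nondeg: "nondegenerate_on S H" and iS: "i \<in> S" for H e i
  proof -
    have d: "Determinant.det (M H) \<noteq> 0"
      using nondegenerate_on_iff_gram_det[OF xs(2), of H] nondeg xs(1) det_M by simp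
    obtain k where k: "k < N" "xs ! k = i" using iS xs by (metis in_set_conv_nth N_def)
    have adj: "(\<Sum>j<N. M H $$ (k, j) * adj_mat (M H) $$ (j, l)) = (if k = l then Determinant.det (M H) else 0)"
      if "l < N" for l
    proof -
      have "(M H * adj_mat (M H)) $$ (k, l) = (\<Sum>j<N. M H $$ (k, j) * adj_mat (M H) $$ (j, l))"
        using k that M[of H] adj_mat(1)[OF M[of H]] by (simp add: scalar_prod_def atLeast0LessThan)
      thus ?thesis using adj_mat(2)[OF M[of H]] k that by (cases "k = l") simp_all
    qed
    have "(\<Sum>j\<in>S. H i j * sol H e (idx j)) = (\<Sum>j<N. M H $$ (k, j) * sol H e j)"
      unfolding xs(1)[symmetric] sum_set_nth[OF xs(2)] using k by (simp add: idx N_def[symmetric] M_def)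
    also have "\<dots> = (\<Sum>l<N. (\<Sum>j<N. M H $$ (k, j) * adj_mat (M H) $$ (j, l)) * e (xs ! l)) / Determinant.det (M H)"
      unfolding sol_def sum_distrib_right sum_distrib_left sum_divide_distrib
      by (subst sum.swap) (simp add: mult.assoc)
    also have "\<dots> = (\<Sum>l<N. if k = l then Determinant.det (M H) * e (xs ! l) else 0) / Determinant.det (M H)"
      by (intro arg_cong2[of _ _ _ _ "(/)"] sum.cong) (auto simp: adj)
    also have "\<dots> = e i" using k d by simp
    finally show ?thesis .
  qed
  have entries: "((\<lambda>x. M (G x) $$ (i, j)) \<longlongrightarrow> M G0 $$ (i, j)) F" if "i < N" "j < N" for i j
    using that xs G[of "xs ! i" "xs ! j"] nth_mem[of i xs] nth_mem[of j xs] by (simp add: M_def N_def)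
  have lim_det: "((\<lambda>x. Determinant.det (M (G x))) \<longlongrightarrow> Determinant.det (M G0)) F"
    by (rule tendsto_det[OF M M entries])
  have det0: "Determinant.det (M G0) \<noteq> 0"
    using nondegenerate_on_iff_gram_det[OF xs(2), of G0] nd xs(1) det_M by simp
  have lim_adj: "((\<lambda>x. adj_mat (M (G x)) $$ (i, j)) \<longlongrightarrow> adj_mat (M G0) $$ (i, j)) F"
    if ij: "i < N" "j < N" for i j
  proof -
    have dels: "mat_delete (M H) j i \<in> carrier_mat (N - 1) (N - 1)" for H
      using mat_delete_carrier[OF M[of H]] .
    have "((\<lambda>x. Determinant.det (mat_delete (M (G x)) j i)) \<longlongrightarrow> Determinant.det (mat_delete (M G0) j i)) F"
    proof (rule tendsto_det[OF dels dels])
      fix k l assume "k < N - 1" "l < N - 1"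
      thus "((\<lambda>x. mat_delete (M (G x)) j i $$ (k, l)) \<longlongrightarrow> mat_delete (M G0) j i $$ (k, l)) F"
        by (auto simp: mat_delete_def carrier_matD[OF M] intro!: entries)
    qed
    thus ?thesis using ij
      by (auto simp: adj_mat_def cofactor_def carrier_matD[OF M] intro!: tendsto_mult)
  qed
  have ev: "\<forall>\<^sub>F x in F. nondegenerate_on S (G x)"
    using tendsto_imp_eventually_ne[OF lim_det det0]
    by eventually_elim (use nondegenerate_on_iff_gram_det[OF xs(2)] xs(1) det_M in simp)
  show thesis
  proof (rule that[of "\<lambda>x j. sol (G x) (b x) (idx j)" "\<lambda>j. sol G0 b0 (idx j)"])
    fix j assume "j \<in> S"
    show "((\<lambda>x. sol (G x) (b x) (idx j)) \<longlongrightarrow> sol G0 b0 (idx j)) F"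
      unfolding sol_def using xs idx_less[OF \<open>j \<in> S\<close>] det0
      by (intro tendsto_divide tendsto_sum tendsto_mult lim_adj lim_det b) (auto simp: N_def)
  next
    show "\<forall>\<^sub>F x in F. nondegenerate_on S (G x) \<and>
       (\<forall>i\<in>S. (\<Sum>j\<in>S. G x i j * sol (G x) (b x) (idx j)) = b x i)"
      using ev by eventually_elim (use solves in blast)
  qed (use solves nd in blast)
qed

section \<open>Dominance and the partition of absolute values\<close>

text \<open>The bound on the right does not depend on the order of the list, and for a non-increasing list it is
  attained by a suitable threshold \<open>\<tau>\<close>. So sums of leading entries of sorted lists can be compared
  without following the sorting permutation.\<close>

lemma sum_take_le_threshold:
  fixes xs :: "int list"
  assumes "k \<le> length xs"
  shows "(\<Sum>i<k. xs ! i) \<le> int k * \<tau> + (\<Sum>x\<leftarrow>xs. max (x - \<tau>) 0)"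
proof -
  have "(\<Sum>i<k. xs ! i) \<le> (\<Sum>i<k. \<tau> + max (xs ! i - \<tau>) 0)"
    by (rule sum_mono) auto
  also have "\<dots> = int k * \<tau> + (\<Sum>i<k. max (xs ! i - \<tau>) 0)"
    by (simp add: sum.distrib)
  also have "(\<Sum>i<k. max (xs ! i - \<tau>) 0) \<le> (\<Sum>i<length xs. max (xs ! i - \<tau>) 0)"
    using assms by (intro sum_mono2) auto
  also have "\<dots> = (\<Sum>x\<leftarrow>xs. max (x - \<tau>) 0)"
    by (simp add: sum_list_sum_nth atLeast0LessThan)
  finally show ?thesis by simp
qed

text \<open>The optimal threshold is the last entry of the sum.\<close>

lemma sum_take_eq_threshold:
  fixes xs :: "int list"
  assumes "1 \<le> k" "k \<le> length xs" "sorted (rev xs)"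
  shows "(\<Sum>i<k. xs ! i) = int k * (xs ! (k - 1)) + (\<Sum>x\<leftarrow>xs. max (x - xs ! (k - 1)) 0)"
proof -
  define \<tau> where "\<tau> = xs ! (k - 1)"
  have desc: "xs ! j \<le> xs ! i" if "i \<le> j" "j < length xs" for i j
    using assms(3) that by (auto simp: sorted_rev_iff_nth_mono)
  have "(\<Sum>x\<leftarrow>xs. max (x - \<tau>) 0) = (\<Sum>i<length xs. max (xs ! i - \<tau>) 0)"
    by (simp add: sum_list_sum_nth atLeast0LessThan)
  also have "\<dots> = (\<Sum>i<k. max (xs ! i - \<tau>) 0)"
    using assms(1,2) desc[of "k - 1"] by (intro sum.mono_neutral_right) (auto simp: \<tau>_def)
  also have "\<dots> = (\<Sum>i<k. xs ! i - \<tau>)"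
    using assms(1,2) desc[of _ "k - 1"] by (intro sum.cong) (auto simp: \<tau>_def)
  finally show ?thesis by (simp add: sum_subtractf \<tau>_def)
qed

definition abs_parts :: "nat \<Rightarrow> comp \<Rightarrow> int list" where
  "abs_parts n \<mu> = map (\<lambda>i. \<bar>Poly_Mapping.lookup \<mu> i\<bar>) [0..<n]"

lemma length_abs_parts [simp]: "length (abs_parts n \<mu>) = n"
  by (simp add: abs_parts_def)

lemma sum_list_sort: "sum_list (map f (sort xs)) = (sum_list (map f xs) :: int)"
  by (metis mset_map mset_sort sum_mset_sum_list)

lemma sum_plus_part:
  assumes "k \<le> n"
  shows "(\<Sum>i<k. Poly_Mapping.lookup (plus_part n \<mu>) i) = (\<Sum>i<k. rev (sort (abs_parts n \<mu>)) ! i)"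
  using assms by (intro sum.cong) (auto simp: plus_part_def abs_parts_def nth_default_def)

lemma plus_part_le_threshold:
  assumes "k \<le> n"
  shows "(\<Sum>i<k. Poly_Mapping.lookup (plus_part n \<mu>) i) \<le>
         int k * \<tau> + (\<Sum>i<n. max (\<bar>Poly_Mapping.lookup \<mu> i\<bar> - \<tau>) 0)"
  using sum_take_le_threshold[of k "rev (sort (abs_parts n \<mu>))" \<tau>] assms
  by (simp add: sum_plus_part sum_list_sort rev_map[symmetric])
     (simp add: abs_parts_def comp_def sum_list_sum_nth atLeast0LessThan)

lemma plus_part_eq_threshold:
  assumes "1 \<le> k" "k \<le> n"
  obtains \<tau> where "(\<Sum>i<k. Poly_Mapping.lookup (plus_part n \<mu>) i) =
         int k * \<tau> + (\<Sum>i<n. max (\<bar>Poly_Mapping.lookup \<mu> i\<bar> - \<tau>) 0)"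
proof
  show "(\<Sum>i<k. Poly_Mapping.lookup (plus_part n \<mu>) i) =
         int k * (rev (sort (abs_parts n \<mu>)) ! (k - 1)) +
         (\<Sum>i<n. max (\<bar>Poly_Mapping.lookup \<mu> i\<bar> - (rev (sort (abs_parts n \<mu>)) ! (k - 1))) 0)"
    using sum_take_eq_threshold[of k "rev (sort (abs_parts n \<mu>))"] assms
    by (simp add: sum_plus_part sum_list_sort rev_map[symmetric])
       (simp add: abs_parts_def comp_def sum_list_sum_nth atLeast0LessThan)
qed

lemma sum_le_sum_plus_part:
  assumes "1 \<le> k" "k \<le> n"
  shows "(\<Sum>i<k. \<bar>Poly_Mapping.lookup \<mu> i\<bar>) \<le> (\<Sum>i<k. Poly_Mapping.lookup (plus_part n \<mu>) i)"
proof -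
  obtain \<tau> where \<tau>: "(\<Sum>i<k. Poly_Mapping.lookup (plus_part n \<mu>) i) =
         int k * \<tau> + (\<Sum>i<n. max (\<bar>Poly_Mapping.lookup \<mu> i\<bar> - \<tau>) 0)"
    using plus_part_eq_threshold[OF assms] .
  have "(\<Sum>i<k. \<bar>Poly_Mapping.lookup \<mu> i\<bar>) = (\<Sum>i<k. abs_parts n \<mu> ! i)"
    using assms by (intro sum.cong) (auto simp: abs_parts_def)
  also have "\<dots> \<le> int k * \<tau> + (\<Sum>x\<leftarrow>abs_parts n \<mu>. max (x - \<tau>) 0)"
    using assms by (intro sum_take_le_threshold) simp
  also have "\<dots> = int k * \<tau> + (\<Sum>i<n. max (\<bar>Poly_Mapping.lookup \<mu> i\<bar> - \<tau>) 0)"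
    by (simp add: abs_parts_def comp_def sum_list_sum_nth atLeast0LessThan)
  finally show ?thesis using \<tau> by simp
qed

lemma sum_plus_part_all:
  "(\<Sum>i<n. Poly_Mapping.lookup (plus_part n \<mu>) i) = (\<Sum>i<n. \<bar>Poly_Mapping.lookup \<mu> i\<bar>)"
proof -
  have "(\<Sum>i<n. Poly_Mapping.lookup (plus_part n \<mu>) i) = sum_list (rev (sort (abs_parts n \<mu>)))"
    by (simp only: sum_plus_part order.refl sum_list_sum_nth atLeast0LessThan length_rev length_sort length_abs_parts)
  also have "\<dots> = sum_list (abs_parts n \<mu>)"
    using sum_list_sort[of "\<lambda>x. x" "abs_parts n \<mu>"] by simp
  also have "\<dots> = (\<Sum>i<n. \<bar>Poly_Mapping.lookup \<mu> i\<bar>)"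
    by (simp add: abs_parts_def sum_list_sum_nth atLeast0LessThan)
  finally show ?thesis .
qed

text \<open>The threshold that is optimal for \<open>\<mu>\<close> also gives a bound for \<open>\<nu>\<close>.\<close>

lemma dom_le_plus_part_mono:
  assumes "\<And>i. i < n \<Longrightarrow> \<bar>Poly_Mapping.lookup \<nu> i\<bar> \<le> \<bar>Poly_Mapping.lookup \<mu> i\<bar>"
  shows "dom_le n (plus_part n \<nu>) (plus_part n \<mu>)"
  unfolding dom_le_def
proof
  fix k assume "k \<in> {1..n}"
  hence k: "1 \<le> k" "k \<le> n" by auto
  obtain \<tau> where \<tau>: "(\<Sum>i<k. Poly_Mapping.lookup (plus_part n \<mu>) i) =
         int k * \<tau> + (\<Sum>i<n. max (\<bar>Poly_Mapping.lookup \<mu> i\<bar> - \<tau>) 0)"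
    using plus_part_eq_threshold[OF k] .
  have "(\<Sum>i<k. Poly_Mapping.lookup (plus_part n \<nu>) i)
        \<le> int k * \<tau> + (\<Sum>i<n. max (\<bar>Poly_Mapping.lookup \<nu> i\<bar> - \<tau>) 0)"
    using plus_part_le_threshold[OF k(2)] .
  also have "\<dots> \<le> int k * \<tau> + (\<Sum>i<n. max (\<bar>Poly_Mapping.lookup \<mu> i\<bar> - \<tau>) 0)"
  proof (intro add_left_mono sum_mono)
    fix i assume "i \<in> {..<n}"
    thus "max (\<bar>Poly_Mapping.lookup \<nu> i\<bar> - \<tau>) 0 \<le> max (\<bar>Poly_Mapping.lookup \<mu> i\<bar> - \<tau>) 0"
      using assms[of i] by (simp add: max_def)
  qed
  finally show "(\<Sum>i<k. Poly_Mapping.lookup (plus_part n \<nu>) i) \<le> (\<Sum>i<k. Poly_Mapping.lookup (plus_part n \<mu>) i)"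
    using \<tau> by simp
qed

lemma prec_imp_dom_le_plus_part:
  assumes "prec n \<nu> \<mu>"
  shows "dom_le n (plus_part n \<nu>) (plus_part n \<mu>)"
  using assms by (auto simp: prec_def dom_less_def dom_le_def)

text \<open>The sum of the absolute values does not increase along the ordering, so all parts are bounded.\<close>

lemma finite_prec: "finite {\<nu> \<in> compositions n. prec n \<nu> \<mu>}"
proof -
  \<comment> \<open>also an upper bound for every \<open>\<bar>\<nu>_i\<bar>\<close> with \<open>\<nu>\<close> below \<open>\<mu>\<close>\<close>
  define B where "B = (\<Sum>i<n. \<bar>Poly_Mapping.lookup \<mu> i\<bar>)"
  define F where "F = PiE {..<n} (\<lambda>_. {-B..B})"
  have "finite F" unfolding F_def by (intro finite_PiE) auto
  have "inj_on (\<lambda>\<nu>. restrict (Poly_Mapping.lookup \<nu>) {..<n}) (compositions n)"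
  proof (rule inj_onI, rule poly_mapping_eqI)
    fix \<nu> \<rho> i assume *: "\<nu> \<in> compositions n" "\<rho> \<in> compositions n"
      "restrict (Poly_Mapping.lookup \<nu>) {..<n} = restrict (Poly_Mapping.lookup \<rho>) {..<n}"
    show "Poly_Mapping.lookup \<nu> i = Poly_Mapping.lookup \<rho> i"
    proof (cases "i < n")
      case True
      thus ?thesis using fun_cong[OF *(3), of i] by simp
    next
      case False
      hence "i \<notin> Poly_Mapping.keys \<nu>" "i \<notin> Poly_Mapping.keys \<rho>" using * by (auto simp: compositions_def)
      thus ?thesis by (simp add: in_keys_iff)
    qed
  qed
  hence inj: "inj_on (\<lambda>\<nu>. restrict (Poly_Mapping.lookup \<nu>) {..<n}) {\<nu> \<in> compositions n. prec n \<nu> \<mu>}"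
    by (rule inj_on_subset) auto
  have "restrict (Poly_Mapping.lookup \<nu>) {..<n} \<in> F" if \<nu>: "prec n \<nu> \<mu>" for \<nu>
  proof -
    have "\<bar>Poly_Mapping.lookup \<nu> i\<bar> \<le> B" if i: "i < n" for i
    proof -
      have "\<bar>Poly_Mapping.lookup \<nu> i\<bar> \<le> (\<Sum>i<n. \<bar>Poly_Mapping.lookup \<nu> i\<bar>)"
        using i by (intro member_le_sum) auto
      also have "\<dots> = (\<Sum>i<n. Poly_Mapping.lookup (plus_part n \<nu>) i)"
        by (rule sum_plus_part_all[symmetric])
      also have "\<dots> \<le> (\<Sum>i<n. Poly_Mapping.lookup (plus_part n \<mu>) i)"
        using prec_imp_dom_le_plus_part[OF \<nu>] i by (auto simp: dom_le_def)
      also have "\<dots> = B" by (simp add: B_def sum_plus_part_all)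
      finally show ?thesis .
    qed
    thus ?thesis by (auto simp: F_def abs_le_iff minus_le_iff)
  qed
  hence "(\<lambda>\<nu>. restrict (Poly_Mapping.lookup \<nu>) {..<n}) ` {\<nu> \<in> compositions n. prec n \<nu> \<mu>} \<subseteq> F" by auto
  thus ?thesis using finite_imageD[OF _ inj] \<open>finite F\<close> finite_subset by blast
qed

lemma plus_part_partition:
  assumes "\<kappa> \<in> partitions n"
  shows "plus_part n \<kappa> = \<kappa>"
proof -
  have p: "\<kappa> \<in> compositions n" "\<And>i. i < n \<Longrightarrow> 0 \<le> Poly_Mapping.lookup \<kappa> i"
    "\<And>i j. i \<le> j \<Longrightarrow> j < n \<Longrightarrow> Poly_Mapping.lookup \<kappa> j \<le> Poly_Mapping.lookup \<kappa> i"
    using assms by (auto simp: partitions_def)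
  have "sorted (rev (abs_parts n \<kappa>))"
    using p(2,3) by (auto simp: sorted_rev_iff_nth_mono abs_parts_def)
  moreover have "sort (abs_parts n \<kappa>) = sort (rev (abs_parts n \<kappa>))"
    by (metis mset_rev mset_sort properties_for_sort sorted_sort)
  ultimately have *: "rev (sort (abs_parts n \<kappa>)) = abs_parts n \<kappa>"
    by (simp add: sorted_sort_id)
  show ?thesis
  proof (rule poly_mapping_eqI)
    fix i
    have "i \<ge> n \<Longrightarrow> Poly_Mapping.lookup \<kappa> i = 0"
      using p(1) by (auto simp: compositions_def subset_iff in_keys_iff)
    thus "Poly_Mapping.lookup (plus_part n \<kappa>) i = Poly_Mapping.lookup \<kappa> i"
      using p(2) * unfolding plus_part_def abs_parts_def[symmetric]
      by (cases "i < n") (auto simp: nth_default_def abs_parts_def)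
  qed
qed

section \<open>Moments of the density and the defining linear system\<close>

lemma zpow_pair:
  assumes "i < n" "j < n" "z \<in> torus"
  shows "zpow n (Poly_Mapping.single i r + Poly_Mapping.single j s) z = z i powi r * z j powi s"
  using assms by (simp add: zpow_add zpow_single)

lemma tame_koorn_density:
  assumes "(t, a, b, c, d) \<in> polydisc"
  shows "tame n (\<lambda>q. koorn_density n (q, t, a, b, c, d))"
proof -
  have p: "norm t < 1" "norm a < 1" "norm b < 1" "norm c < 1" "norm d < 1"
    using assms by (auto simp: polydisc_def)
  have site: "tame n (\<lambda>q z. qp q [(z i)\<^sup>2, q / (z i)\<^sup>2] /
        qp q [a * z i, b * z i, c * z i, d * z i, a * q / z i, b * q / z i, c / z i, d / z i])"
    if i: "i < n" for i
  proof -
    define P where "P = (\<lambda>e x s q z. qpoch_inf (x * q ^ e * zpow n (Poly_Mapping.single i s) z) q)"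
    have P: "P 0 x 1 q z = qpoch_inf (x * z i) q" "P 0 x (-1) q z = qpoch_inf (x / z i) q"
      "P 1 x (-1) q z = qpoch_inf (x * q / z i) q"
      "P 0 1 2 q z = qpoch_inf ((z i)\<^sup>2) q" "P 1 1 (-2) q z = qpoch_inf (q / (z i)\<^sup>2) q"
      for x q z
      using i by (simp_all add: P_def zpow_single power_int_minus field_simps)
    have "tame n (\<lambda>q z. P 0 1 2 q z * P 1 1 (-2) q z * (1 / P 0 a 1 q z) * (1 / P 0 b 1 q z) *
            (1 / P 0 c 1 q z) * (1 / P 0 d 1 q z) * (1 / P 1 a (-1) q z) * (1 / P 1 b (-1) q z) *
            (1 / P 0 c (-1) q z) * (1 / P 0 d (-1) q z))"
      unfolding P_def by (intro tame_mult tame_qpoch tame_inverse_qpoch) (use p in auto)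
    thus ?thesis by (simp add: P qp_def divide_inverse mult_ac del: One_nat_def)
  qed
  have pair: "tame n (\<lambda>q z. qp q [z i * z j, z i / z j, q * z j / z i, q / (z i * z j)] /
        qp q [t * z i * z j, t * z i / z j, q * t * z j / z i, q * t / (z i * z j)])"
    if ij: "i < n" "j < n" for i j
  proof -
    define P where "P = (\<lambda>e x r s q z. qpoch_inf (x * q ^ e * zpow n (Poly_Mapping.single i r + Poly_Mapping.single j s) z) q)"
    have P: "P 0 x 1 1 q z = qpoch_inf (x * z i * z j) q" "P 0 x 1 (-1) q z = qpoch_inf (x * z i / z j) q"
      "P 1 x (-1) 1 q z = qpoch_inf (q * x * z j / z i) q" "P 1 x (-1) (-1) q z = qpoch_inf (q * x / (z i * z j)) q"
      if "z \<in> torus" for x q z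
      using ij that by (simp_all add: P_def zpow_pair power_int_minus field_simps)
    have "tame n (\<lambda>q z. P 0 1 1 1 q z * P 0 1 1 (-1) q z * P 1 1 (-1) 1 q z * P 1 1 (-1) (-1) q z *
            (1 / P 0 t 1 1 q z) * (1 / P 0 t 1 (-1) q z) * (1 / P 1 t (-1) 1 q z) * (1 / P 1 t (-1) (-1) q z))"
      unfolding P_def by (intro tame_mult tame_qpoch tame_inverse_qpoch) (use p in auto)
    thus ?thesis
      by (rule tame_cong[THEN iffD1, rotated]) (simp add: P qp_def divide_inverse mult_ac del: One_nat_def)
  qed
  show ?thesis unfolding koorn_density.simps
    by (intro tame_mult tame_prod site pair) auto
qed

text \<open>The two groups of factors of the density at \<open>q = 0\<close>, written with monomials. The two factors
  with negative powers of a single variable are kept together because \<open>E_poly\<close> cancels them.\<close>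

fun site_density :: "nat \<Rightarrow> nat \<Rightarrow> par \<Rightarrow> (nat \<Rightarrow> complex) \<Rightarrow> complex" where
  "site_density n i (t, a, b, c, d) z =
     (1 - zpow n (Poly_Mapping.single i 2) z) *
     (1 / (1 - a * zpow n (Poly_Mapping.single i 1) z)) *
     (1 / (1 - b * zpow n (Poly_Mapping.single i 1) z)) *
     (1 / (1 - c * zpow n (Poly_Mapping.single i 1) z)) *
     (1 / (1 - d * zpow n (Poly_Mapping.single i 1) z)) *
     ((1 / (1 - c * zpow n (Poly_Mapping.single i (-1)) z)) *
      (1 / (1 - d * zpow n (Poly_Mapping.single i (-1)) z)))"

fun pair_density :: "nat \<Rightarrow> nat \<Rightarrow> nat \<Rightarrow> par \<Rightarrow> (nat \<Rightarrow> complex) \<Rightarrow> complex" where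
  "pair_density n i j (t, a, b, c, d) z =
     (1 - zpow n (Poly_Mapping.single i 1 + Poly_Mapping.single j 1) z) *
     (1 - zpow n (Poly_Mapping.single i 1 + Poly_Mapping.single j (-1)) z) *
     (1 / (1 - t * zpow n (Poly_Mapping.single i 1 + Poly_Mapping.single j 1) z)) *
     (1 / (1 - t * zpow n (Poly_Mapping.single i 1 + Poly_Mapping.single j (-1)) z))"

definition density0 :: "nat \<Rightarrow> par \<Rightarrow> (nat \<Rightarrow> complex) \<Rightarrow> complex" where
  "density0 n p z = (\<Prod>i<n. site_density n i p z) * (\<Prod>j<n. \<Prod>i<j. pair_density n i j p z)"

lemma qpoch_inf_0: "qpoch_inf x 0 = 1 - x"
  by (simp add: qpoch_inf_eq euler_tail_def)

lemma koorn_density_0: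
  assumes "z \<in> torus"
  shows "koorn_density n (0, t, a, b, c, d) z = density0 n (t, a, b, c, d) z"
  unfolding koorn_density.simps density0_def
proof (intro arg_cong2[of _ _ _ _ "(*)"] prod.cong refl)
  fix i assume "i \<in> {..<n}"
  thus "qp 0 [(z i)\<^sup>2, 0 / (z i)\<^sup>2] /
      qp 0 [a * z i, b * z i, c * z i, d * z i, a * 0 / z i, b * 0 / z i, c / z i, d / z i] =
      site_density n i (t, a, b, c, d) z"
    by (simp add: qp_def qpoch_inf_0 zpow_single power_int_minus divide_inverse mult_ac)
next
  fix j i assume "j \<in> {..<n}" "i \<in> {..<j}"
  thus "qp 0 [z i * z j, z i / z j, 0 * z j / z i, 0 / (z i * z j)] /
        qp 0 [t * z i * z j, t * z i / z j, 0 * t * z j / z i, 0 * t / (z i * z j)] =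
        pair_density n i j (t, a, b, c, d) z"
    using assms by (simp add: qp_def qpoch_inf_0 zpow_pair power_int_minus divide_inverse mult_ac)
qed

lemma factored_density0: "factored n (density0 n)"
proof -
  have site: "factored n (site_density n i)" if "i < n" for i
  proof -
    have g: "factored n (\<lambda>p z. 1 / (1 - m p * zpow n (Poly_Mapping.single i s) z))"
      if "is_poly m" "\<And>p. p \<in> polydisc \<Longrightarrow> norm (m p) < 1" "s \<in> {1, -1}" for m s
      using that \<open>i < n\<close> by (intro factored_denominator short_exponents.one) auto
    have eq: "site_density n i = (\<lambda>p z. (1 - zpow n (Poly_Mapping.single i 2) z) *
     (1 / (1 - (\<lambda>(t, a, b, c, d). a) p * zpow n (Poly_Mapping.single i 1) z)) *
     (1 / (1 - (\<lambda>(t, a, b, c, d). b) p * zpow n (Poly_Mapping.single i 1) z)) *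
     (1 / (1 - (\<lambda>(t, a, b, c, d). c) p * zpow n (Poly_Mapping.single i 1) z)) *
     (1 / (1 - (\<lambda>(t, a, b, c, d). d) p * zpow n (Poly_Mapping.single i 1) z)) *
     ((1 / (1 - (\<lambda>(t, a, b, c, d). c) p * zpow n (Poly_Mapping.single i (-1)) z)) *
      (1 / (1 - (\<lambda>(t, a, b, c, d). d) p * zpow n (Poly_Mapping.single i (-1)) z))))"
      by (auto simp: fun_eq_iff)
    show ?thesis unfolding eq
      using that by (intro factored_mult g is_poly_coord factored_numerator) (auto simp: polydisc_def)
  qed
  have pair: "factored n (pair_density n i j)" if "i < j" "j < n" for i j
  proof -
    have g: "factored n (\<lambda>p z. 1 / (1 - (\<lambda>(t, a, b, c, d). t) p * zpow n (Poly_Mapping.single i 1 + Poly_Mapping.single j s) z))"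
      if "s \<in> {1, -1}" for s
      using that \<open>i < j\<close> \<open>j < n\<close> by (intro factored_denominator short_exponents.two is_poly_coord) (auto simp: polydisc_def)
    have eq: "pair_density n i j = (\<lambda>p z. (1 - zpow n (Poly_Mapping.single i 1 + Poly_Mapping.single j 1) z) *
     (1 - zpow n (Poly_Mapping.single i 1 + Poly_Mapping.single j (-1)) z) *
     (1 / (1 - (\<lambda>(t, a, b, c, d). t) p * zpow n (Poly_Mapping.single i 1 + Poly_Mapping.single j 1) z)) *
     (1 / (1 - (\<lambda>(t, a, b, c, d). t) p * zpow n (Poly_Mapping.single i 1 + Poly_Mapping.single j (-1)) z)))"
      by (auto simp: fun_eq_iff)
    show ?thesis unfolding eq
      using that by (intro factored_mult g factored_numerator compositions_add compositions_single) auto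
  qed
  have eq: "density0 n = (\<lambda>p z. (\<Prod>i<n. site_density n i p z) * (\<Prod>j<n. \<Prod>i<j. pair_density n i j p z))"
    by (simp add: fun_eq_iff density0_def)
  show ?thesis unfolding eq
    by (intro factored_mult factored_prod site pair) auto
qed

definition moment :: "nat \<Rightarrow> par \<Rightarrow> complex \<Rightarrow> comp \<Rightarrow> complex" where
  "moment n p q \<rho> = torus_integral n (\<lambda>z. zpow n \<rho> z * koorn_density n (q, p) z)"

lemma moment_0: "moment n p 0 \<rho> = torus_integral n (\<lambda>z. zpow n \<rho> z * density0 n p z)"
  unfolding moment_def by (rule torus_integral_cong) (cases p, simp add: koorn_density_0 del: koorn_density.simps)

lemma is_rational_moment_0: "\<rho> \<in> compositions n \<Longrightarrow> is_rational (\<lambda>p. moment n p 0 \<rho>)"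
  unfolding moment_0 by (rule is_rational_torus_integral[OF factored_density0])

lemma tame_moment: "p \<in> polydisc \<Longrightarrow> tame n (\<lambda>q z. zpow n \<rho> z * koorn_density n (q, p) z)"
  by (cases p) (simp del: koorn_density.simps add: tame_mult tame_zpow tame_koorn_density)

lemma tendsto_moment: "p \<in> polydisc \<Longrightarrow> ((\<lambda>q. moment n p q \<rho>) \<longlongrightarrow> moment n p 0 \<rho>) (at 0)"
  unfolding moment_def by (rule tendsto_torus_integral_tame[OF tame_moment])

lemma bar_monomial: "bar (Poly_Mapping.single \<nu> 1) = Poly_Mapping.single (- \<nu>) 1"
  using map_key_single[of uminus "- \<nu>" "1::complex"] by (simp add: bar_def)

lemma koorn_inner_eq_moment_sum:
  assumes "p \<in> polydisc" "norm q \<le> 1 / 8" "finite A" "Poly_Mapping.keys U \<subseteq> A"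
  shows "koorn_inner n (\<lambda>_. U) (\<lambda>_. Poly_Mapping.single \<nu> 1) (q, p) =
         (\<Sum>\<kappa>\<in>A. moment n p q (\<kappa> - \<nu>) * Poly_Mapping.lookup U \<kappa>)"
proof -
  have int: "integrable (torus_measure n)
      (\<lambda>\<theta>. Poly_Mapping.lookup U \<kappa> * (zpow n (\<kappa> - \<nu>) (torus_point \<theta>) * koorn_density n (q, p) (torus_point \<theta>)))" for \<kappa>
    using integrable_tame[OF tame_moment[OF assms(1)] assms(2), of n "\<kappa> - \<nu>"] by simp
  have "koorn_inner n (\<lambda>_. U) (\<lambda>_. Poly_Mapping.single \<nu> 1) (q, p) =
        torus_integral n (\<lambda>z. \<Sum>\<kappa>\<in>A. Poly_Mapping.lookup U \<kappa> * (zpow n (\<kappa> - \<nu>) z * koorn_density n (q, p) z))"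
    unfolding koorn_inner_def
  proof (rule torus_integral_cong)
    fix z assume z: "z \<in> torus"
    have "zpow n (\<kappa> - \<nu>) z = zpow n \<kappa> z * zpow n (- \<nu>) z" for \<kappa>
      using zpow_add[OF z, of n \<kappa> "- \<nu>"] by simp
    thus "laurent_eval n U z * laurent_eval n (bar (Poly_Mapping.single \<nu> 1)) z * koorn_density n (q, p) z =
      (\<Sum>\<kappa>\<in>A. Poly_Mapping.lookup U \<kappa> * (zpow n (\<kappa> - \<nu>) z * koorn_density n (q, p) z))"
      unfolding bar_monomial laurent_eval_superset[OF assms(3,4)] laurent_eval_single
      by (simp add: sum_distrib_left sum_distrib_right mult_ac)
  qed
  also have "\<dots> = (\<Sum>\<kappa>\<in>A. Poly_Mapping.lookup U \<kappa> * moment n p q (\<kappa> - \<nu>))"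
    unfolding torus_integral_torus_point moment_def
    by (subst Bochner_Integration.integral_sum) (use int in auto)
  finally show ?thesis by (simp add: mult.commute)
qed

definition lower_set :: "nat \<Rightarrow> comp \<Rightarrow> comp set" where
  "lower_set n \<mu> = {\<nu> \<in> compositions n. prec n \<nu> \<mu>}"

lemma finite_lower_set [simp]: "finite (lower_set n \<mu>)"
  by (simp add: lower_set_def finite_prec)

lemma not_in_lower_set [simp]: "\<mu> \<notin> lower_set n \<mu>"
  by (simp add: lower_set_def prec_def)

abbreviation moment_matrix :: "nat \<Rightarrow> par \<Rightarrow> complex \<Rightarrow> comp \<Rightarrow> comp \<Rightarrow> complex" where
  "moment_matrix n p q \<equiv> \<lambda>\<nu> \<kappa>. moment n p q (\<kappa> - \<nu>)"

text \<open>The leading coefficient is one, so the contribution of the leading monomial to the orthogonality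
  relations is known and becomes the right-hand side of a square linear system.\<close>

lemma is_koornwinder_iff:
  assumes "p \<in> polydisc" "norm q \<le> 1 / 8"
  shows "is_koornwinder n \<mu> (q, p) U \<longleftrightarrow>
     Poly_Mapping.lookup U \<mu> = 1 \<and> Poly_Mapping.keys U \<subseteq> insert \<mu> (lower_set n \<mu>) \<and>
     (\<forall>\<nu>\<in>lower_set n \<mu>. (\<Sum>\<kappa>\<in>lower_set n \<mu>. moment_matrix n p q \<nu> \<kappa> * Poly_Mapping.lookup U \<kappa>) =
        - moment n p q (\<mu> - \<nu>))"
proof -
  have "koorn_inner n (\<lambda>_. U) (\<lambda>_. Poly_Mapping.single \<nu> 1) (q, p) = 0 \<longleftrightarrow>
     (\<Sum>\<kappa>\<in>lower_set n \<mu>. moment_matrix n p q \<nu> \<kappa> * Poly_Mapping.lookup U \<kappa>) = - moment n p q (\<mu> - \<nu>)"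
    if "Poly_Mapping.keys U \<subseteq> insert \<mu> (lower_set n \<mu>)" "Poly_Mapping.lookup U \<mu> = 1" for \<nu>
    using that by (simp add: koorn_inner_eq_moment_sum[OF assms _ that(1)] eq_neg_iff_add_eq_0 add.commute)
  thus ?thesis unfolding is_koornwinder_def by (auto simp: lower_set_def)
qed

lemma is_koornwinder_unique:
  assumes p: "p \<in> polydisc" "norm q \<le> 1 / 8"
    and nd: "nondegenerate_on (lower_set n \<mu>) (moment_matrix n p q)"
    and U: "is_koornwinder n \<mu> (q, p) U" and V: "is_koornwinder n \<mu> (q, p) V"
  shows "U = V"
proof (rule poly_mapping_eqI)
  fix \<kappa>
  note U' = U[unfolded is_koornwinder_iff[OF p]] and V' = V[unfolded is_koornwinder_iff[OF p]]
  define w where "w = (\<lambda>\<kappa>. Poly_Mapping.lookup U \<kappa> - Poly_Mapping.lookup V \<kappa>)"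
  have "\<forall>\<nu>\<in>lower_set n \<mu>. (\<Sum>\<kappa>\<in>lower_set n \<mu>. moment_matrix n p q \<nu> \<kappa> * w \<kappa>) = 0"
    using U' V' by (simp add: w_def right_diff_distrib sum_subtractf)
  hence "\<forall>\<kappa>\<in>lower_set n \<mu>. w \<kappa> = 0" using nd unfolding nondegenerate_on_def by blast
  hence on: "Poly_Mapping.lookup U \<kappa> = Poly_Mapping.lookup V \<kappa>" if "\<kappa> \<in> lower_set n \<mu>"
    using that by (simp add: w_def)
  have off: "Poly_Mapping.lookup U \<kappa> = 0" "Poly_Mapping.lookup V \<kappa> = 0" if "\<kappa> \<notin> insert \<mu> (lower_set n \<mu>)"
    using U' V' that by (meson in_keys_iff subsetD)+
  show "Poly_Mapping.lookup U \<kappa> = Poly_Mapping.lookup V \<kappa>"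
    using on off U' V' by (cases "\<kappa> = \<mu>"; cases "\<kappa> \<in> lower_set n \<mu>") auto
qed

definition triangular_laurent :: "nat \<Rightarrow> comp \<Rightarrow> (comp \<Rightarrow> complex) \<Rightarrow> laurent" where
  "triangular_laurent n \<mu> w =
     Poly_Mapping.single \<mu> 1 + (\<Sum>\<kappa>\<in>lower_set n \<mu>. Poly_Mapping.single \<kappa> (w \<kappa>))"

lemma lookup_triangular_laurent:
  "Poly_Mapping.lookup (triangular_laurent n \<mu> w) \<kappa> =
     (if \<kappa> = \<mu> then 1 else if \<kappa> \<in> lower_set n \<mu> then w \<kappa> else 0)"
  by (auto simp: triangular_laurent_def lookup_add lookup_sum lookup_single when_def)

lemma keys_triangular_laurent:
  "Poly_Mapping.keys (triangular_laurent n \<mu> w) \<subseteq> insert \<mu> (lower_set n \<mu>)"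
  by (auto simp: in_keys_iff lookup_triangular_laurent split: if_splits)

lemma is_koornwinder_triangular_laurent:
  assumes "p \<in> polydisc" "norm q \<le> 1 / 8"
    and "\<And>\<nu>. \<nu> \<in> lower_set n \<mu> \<Longrightarrow>
      (\<Sum>\<kappa>\<in>lower_set n \<mu>. moment_matrix n p q \<nu> \<kappa> * w \<kappa>) = - moment n p q (\<mu> - \<nu>)"
  shows "is_koornwinder n \<mu> (q, p) (triangular_laurent n \<mu> w)"
  unfolding is_koornwinder_iff[OF assms(1,2)]
proof (intro conjI ballI)
  fix \<nu> assume "\<nu> \<in> lower_set n \<mu>"
  have "(\<Sum>\<kappa>\<in>lower_set n \<mu>. moment_matrix n p q \<nu> \<kappa> * Poly_Mapping.lookup (triangular_laurent n \<mu> w) \<kappa>) =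
        (\<Sum>\<kappa>\<in>lower_set n \<mu>. moment_matrix n p q \<nu> \<kappa> * w \<kappa>)"
    by (intro sum.cong) (auto simp: lookup_triangular_laurent)
  thus "(\<Sum>\<kappa>\<in>lower_set n \<mu>. moment_matrix n p q \<nu> \<kappa> * Poly_Mapping.lookup (triangular_laurent n \<mu> w) \<kappa>) =
        - moment n p q (\<mu> - \<nu>)" using assms(3) \<open>\<nu> \<in> lower_set n \<mu>\<close> by simp
qed (simp_all add: lookup_triangular_laurent keys_triangular_laurent)

text \<open>The limit is identified as a solution of the relations at \<open>q = 0\<close>, where uniqueness also holds. So
  for partitions it is enough to exhibit one solution there.\<close>

lemma koornwinder_limit:
  assumes p: "p \<in> polydisc"
    and nd: "nondegenerate_on (lower_set n \<mu>) (moment_matrix n p 0)"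
  obtains L where "\<forall>\<^sub>F q in at 0. \<exists>!U. is_koornwinder n \<mu> (q, p) U"
    "coeffwise_limit (\<lambda>q. koornwinder n \<mu> (q, p)) L" "is_koornwinder n \<mu> (0, p) L"
proof -
  obtain w w0 where lim: "\<And>\<kappa>. \<kappa> \<in> lower_set n \<mu> \<Longrightarrow> ((\<lambda>q. w q \<kappa>) \<longlongrightarrow> w0 \<kappa>) (at 0)"
    and w0: "\<And>\<nu>. \<nu> \<in> lower_set n \<mu> \<Longrightarrow>
       (\<Sum>\<kappa>\<in>lower_set n \<mu>. moment_matrix n p 0 \<nu> \<kappa> * w0 \<kappa>) = - moment n p 0 (\<mu> - \<nu>)"
    and w: "\<forall>\<^sub>F q in at 0. nondegenerate_on (lower_set n \<mu>) (moment_matrix n p q) \<and>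
       (\<forall>\<nu>\<in>lower_set n \<mu>. (\<Sum>\<kappa>\<in>lower_set n \<mu>. moment_matrix n p q \<nu> \<kappa> * w q \<kappa>) = - moment n p q (\<mu> - \<nu>))"
    using cramer_limit[of "lower_set n \<mu>" "moment_matrix n p 0" "moment_matrix n p" "at 0"
        "\<lambda>q \<nu>. - moment n p q (\<mu> - \<nu>)" "\<lambda>\<nu>. - moment n p 0 (\<mu> - \<nu>)"]
      nd tendsto_moment[OF p] tendsto_minus[OF tendsto_moment[OF p]] by auto
  have "\<forall>\<^sub>F q::complex in at 0. norm q \<le> 1 / 8"
    unfolding eventually_at by (intro exI[of _ "1/8"]) auto
  with w have ev: "\<forall>\<^sub>F q in at 0. is_koornwinder n \<mu> (q, p) (triangular_laurent n \<mu> (w q)) \<and>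
      (\<forall>U. is_koornwinder n \<mu> (q, p) U \<longrightarrow> U = triangular_laurent n \<mu> (w q))"
  proof eventually_elim
    case (elim q)
    have "is_koornwinder n \<mu> (q, p) (triangular_laurent n \<mu> (w q))"
      using elim by (intro is_koornwinder_triangular_laurent[OF p]) auto
    thus ?case using is_koornwinder_unique[OF p] elim by blast
  qed
  have eq: "\<forall>\<^sub>F q in at 0. triangular_laurent n \<mu> (w q) = koornwinder n \<mu> (q, p)"
    using ev by eventually_elim (metis koornwinder_def the_equality)
  show thesis
  proof (rule that)
    show "\<forall>\<^sub>F q in at 0. \<exists>!U. is_koornwinder n \<mu> (q, p) U" using ev by eventually_elim blast
    show "is_koornwinder n \<mu> (0, p) (triangular_laurent n \<mu> w0)"
      using w0 by (intro is_koornwinder_triangular_laurent[OF p]) auto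
    have lim_w: "((\<lambda>q. Poly_Mapping.lookup (triangular_laurent n \<mu> (w q)) \<nu>) \<longlongrightarrow>
            Poly_Mapping.lookup (triangular_laurent n \<mu> w0) \<nu>) (at 0)" for \<nu>
      using lim by (auto simp: lookup_triangular_laurent)
    show "coeffwise_limit (\<lambda>q. koornwinder n \<mu> (q, p)) (triangular_laurent n \<mu> w0)"
      unfolding coeffwise_limit_def
    proof
      fix \<nu>
      have "\<forall>\<^sub>F q in at 0. Poly_Mapping.lookup (triangular_laurent n \<mu> (w q)) \<nu> =
              Poly_Mapping.lookup (koornwinder n \<mu> (q, p)) \<nu>"
        using eq by (rule eventually_mono) simp
      with lim_w show "((\<lambda>q. Poly_Mapping.lookup (koornwinder n \<mu> (q, p)) \<nu>) \<longlongrightarrow>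
              Poly_Mapping.lookup (triangular_laurent n \<mu> w0) \<nu>) (at 0)"
        by (rule Lim_transform_eventually)
    qed
  qed
qed

section \<open>Nondegeneracy for generic parameters\<close>

lemma weight_limit_weaken:
  assumes "weight_limit n w s F" "s' \<le> s"
  shows "weight_limit n w s' F"
  using assms unfolding weight_limit_def by (meson order.trans)

lemma weight_limit_zero: "weight_limit n w s (\<lambda>z. 0)"
proof -
  have "weight_limit n w s (laurent_eval n 0)" by (rule weight_limit_laurent) simp
  moreover have "laurent_eval n 0 = (\<lambda>z. 0)" by (simp add: fun_eq_iff)
  ultimately show ?thesis by simp
qed

lemma weight_limit_numerator:
  assumes "\<gamma> \<in> compositions n" "0 \<le> weight n w \<gamma>"
  shows "weight_limit n w 0 (\<lambda>z. 1 - zpow n \<gamma> z)"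
  using weight_limit_add[OF weight_limit_const[of n w 1] weight_limit_zpow[OF assms, of "-1"]] by simp

text \<open>This is \<open>(1 + A) (1 + B) - 1 = A B + A + B\<close>, where all terms on the right have positive weight.\<close>

lemma unit_plus_positive_weight_mult:
  assumes "weight_limit n w 1 (\<lambda>z. F z - 1)" "weight_limit n w 1 (\<lambda>z. G z - 1)"
  shows "weight_limit n w 1 (\<lambda>z. F z * G z - 1)"
proof -
  have "weight_limit n w 1 (\<lambda>z. (F z - 1) * (G z - 1))"
    using weight_limit_mult[OF assms] by (rule weight_limit_weaken) simp
  from weight_limit_add[OF this weight_limit_add[OF assms]]
  show ?thesis by (simp add: algebra_simps)
qed

lemma unit_plus_positive_weight_prod:
  assumes "\<And>i. i \<in> A \<Longrightarrow> weight_limit n w 1 (\<lambda>z. F i z - 1)"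
  shows "weight_limit n w 1 (\<lambda>z. (\<Prod>i\<in>A. F i z) - 1)"
  using assms
proof (induction A rule: infinite_finite_induct)
  case (insert x A)
  thus ?case by (auto intro!: unit_plus_positive_weight_mult)
qed (simp_all add: weight_limit_zero)

abbreviation zero_params :: par where "zero_params \<equiv> (0, 0, 0, 0, 0)"

text \<open>A weight that is positive on the exponents \<open>e_i\<close>, \<open>e_i + e_j\<close> and \<open>e_i - e_j\<close> for \<open>i < j\<close>.\<close>

definition staircase :: "nat \<Rightarrow> nat \<Rightarrow> int" where
  "staircase n i = int n - int i"

lemma density0_zero_params:
  "weight_limit n (staircase n) 1 (\<lambda>z. density0 n zero_params z - 1)"
proof -
  have num: "weight_limit n (staircase n) 1 (\<lambda>z. (1 - zpow n \<gamma> z) - 1)"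
    if "\<gamma> \<in> compositions n" "1 \<le> weight n (staircase n) \<gamma>" for \<gamma>
    using weight_limit_zpow[OF that, of "-1"] by simp
  have site: "weight_limit n (staircase n) 1 (\<lambda>z. site_density n i zero_params z - 1)" if "i < n" for i
    using num[of "Poly_Mapping.single i 2"] that by (simp add: weight_single staircase_def)
  have pair: "weight_limit n (staircase n) 1 (\<lambda>z. pair_density n i j zero_params z - 1)"
    if "i < j" "j < n" for i j
  proof -
    have "weight_limit n (staircase n) 1
      (\<lambda>z. (1 - zpow n (Poly_Mapping.single i 1 + Poly_Mapping.single j 1) z) *
           (1 - zpow n (Poly_Mapping.single i 1 + Poly_Mapping.single j (-1)) z) - 1)"
      using that by (intro unit_plus_positive_weight_mult num compositions_add compositions_single)
        (auto simp: weight_add weight_single staircase_def)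
    thus ?thesis by simp
  qed
  show ?thesis unfolding density0_def
    by (intro unit_plus_positive_weight_mult unit_plus_positive_weight_prod site pair) auto
qed

text \<open>If the parameters vanish, multiplying \<open>z^\<rho>\<close> by the density only adds terms of larger weight than \<open>\<rho>\<close>.\<close>

lemma moment_zero_params:
  assumes "\<rho> \<in> compositions n" "0 \<le> weight n (staircase n) \<rho>"
  shows "moment n zero_params 0 \<rho> = (if \<rho> = 0 then 1 else 0)"
proof -
  have 1: "weight_limit n (staircase n) (weight n (staircase n) \<rho>) (zpow n \<rho>)"
    using weight_limit_zpow[OF assms(1) order.refl, of _ 1] by simp
  have 2: "weight_limit n (staircase n) (weight n (staircase n) \<rho> + 1)
             (\<lambda>z. zpow n \<rho> z * (density0 n zero_params z - 1))"
    by (rule weight_limit_mult[OF 1 density0_zero_params])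
  have "moment n zero_params 0 \<rho> =
        torus_integral n (\<lambda>z. zpow n \<rho> z + zpow n \<rho> z * (density0 n zero_params z - 1))"
    unfolding moment_0 by (rule torus_integral_cong) (simp add: algebra_simps)
  also have "\<dots> = torus_integral n (zpow n \<rho>) + torus_integral n (\<lambda>z. zpow n \<rho> z * (density0 n zero_params z - 1))"
    by (rule torus_integral_add[OF 1 2])
  also have "\<dots> = (if \<rho> = 0 then 1 else 0)"
    using torus_integral_positive_weight[OF 2] assms by (simp add: torus_integral_zpow)
  finally show ?thesis .
qed

text \<open>The matrix is unitriangular for any ordering by weight: in a kernel vector, the equation indexed by
  an entry of least weight among the nonzero ones reduces to that entry.\<close>

lemma nondegenerate_zero_params:
  assumes "finite S" "S \<subseteq> compositions n"
  shows "nondegenerate_on S (moment_matrix n zero_params 0)"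
  unfolding nondegenerate_on_def
proof (intro allI impI ballI, rule ccontr)
  fix w \<kappa>
  assume sol: "\<forall>\<nu>\<in>S. (\<Sum>\<kappa>\<in>S. moment_matrix n zero_params 0 \<nu> \<kappa> * w \<kappa>) = 0" and "\<kappa> \<in> S" "w \<kappa> \<noteq> 0"
  define T where "T = {\<kappa> \<in> S. w \<kappa> \<noteq> 0}"
  have "finite T" "T \<noteq> {}" using assms \<open>\<kappa> \<in> S\<close> \<open>w \<kappa> \<noteq> 0\<close> by (auto simp: T_def)
  then obtain \<kappa>0 where \<kappa>0: "is_arg_min (weight n (staircase n)) (\<lambda>x. x \<in> T) \<kappa>0"
    using ex_is_arg_min_if_finite by blast
  hence min: "\<kappa>0 \<in> T" "\<And>\<kappa>. \<kappa> \<in> T \<Longrightarrow> weight n (staircase n) \<kappa>0 \<le> weight n (staircase n) \<kappa>"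
    by (auto simp: is_arg_min_linorder)
  have "0 = (\<Sum>\<kappa>\<in>S. moment_matrix n zero_params 0 \<kappa>0 \<kappa> * w \<kappa>)" using sol min(1) by (auto simp: T_def)
  also have "\<dots> = (\<Sum>\<kappa>\<in>T. moment_matrix n zero_params 0 \<kappa>0 \<kappa> * w \<kappa>)"
    using assms(1) by (intro sum.mono_neutral_right) (auto simp: T_def)
  also have "\<dots> = (\<Sum>\<kappa>\<in>T. if \<kappa> = \<kappa>0 then w \<kappa> else 0)"
  proof (rule sum.cong)
    fix \<kappa> assume "\<kappa> \<in> T"
    hence "\<kappa> - \<kappa>0 \<in> compositions n" "0 \<le> weight n (staircase n) (\<kappa> - \<kappa>0)"
      using min assms(2) by (auto simp: T_def weight_diff intro!: compositions_diff)
    thus "moment_matrix n zero_params 0 \<kappa>0 \<kappa> * w \<kappa> = (if \<kappa> = \<kappa>0 then w \<kappa> else 0)"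
      by (simp add: moment_zero_params)
  qed simp
  also have "\<dots> = w \<kappa>0" using min(1) \<open>finite T\<close> by simp
  finally show False using min(1) by (simp add: T_def)
qed

lemma is_rational_gram_det:
  assumes "\<And>i j. i \<in> set xs \<Longrightarrow> j \<in> set xs \<Longrightarrow> is_rational (\<lambda>p. G p i j)"
  shows "is_rational (\<lambda>p. gram_det xs (G p))"
proof -
  define N where "N = length xs"
  have "is_rational (\<lambda>p. \<Sum>\<pi>\<in>{\<pi>. \<pi> permutes {0..<N}}. signof \<pi> * (\<Prod>i = 0..<N. G p (xs ! i) (xs ! \<pi> i)))"
  proof (intro is_rational_sum is_rational_mult is_rational_const is_rational_prod)
    fix \<pi> i assume "\<pi> \<in> {\<pi>. \<pi> permutes {0..<N}}" "i \<in> {0..<N}"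
    hence "i < N" "\<pi> i < N" using permutes_in_image[of \<pi> "{0..<N}" i] by auto
    thus "is_rational (\<lambda>p. G p (xs ! i) (xs ! \<pi> i))" by (intro assms) (auto simp: N_def)
  qed
  moreover have "gram_det xs (G p) =
      (\<Sum>\<pi>\<in>{\<pi>. \<pi> permutes {0..<N}}. signof \<pi> * (\<Prod>i = 0..<N. G p (xs ! i) (xs ! \<pi> i)))" for p
    unfolding gram_det_def N_def[symmetric]
    by (subst det_def'[of _ N]) (auto intro!: sum.cong prod.cong dest: permutes_in_image)
  ultimately show ?thesis by simp
qed

lemma generic_nondegenerate:
  assumes "\<And>t a b c d. (t, a, b, c, d) \<in> polydisc \<Longrightarrow>
    nondegenerate_on (lower_set n \<mu>) (moment_matrix n (t, a, b, c, d) 0) \<Longrightarrow> Q t a b c d"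
  shows "generic_params Q"
proof -
  obtain xs where xs: "set xs = lower_set n \<mu>" "distinct xs"
    using finite_distinct_list[OF finite_lower_set] by blast
  have comps: "lower_set n \<mu> \<subseteq> compositions n" by (auto simp: lower_set_def)
  have nd: "nondegenerate_on (lower_set n \<mu>) G \<longleftrightarrow> gram_det xs G \<noteq> 0" for G
    using nondegenerate_on_iff_gram_det[OF xs(2)] xs(1) by simp
  show ?thesis
  proof (rule generic_params_rational_nonzero)
    show "is_rational (\<lambda>p. gram_det xs (moment_matrix n p 0))"
      using comps by (intro is_rational_gram_det is_rational_moment_0 compositions_diff) (auto simp: xs)
    show "gram_det xs (moment_matrix n zero_params 0) \<noteq> 0"
      using nondegenerate_zero_params[OF finite_lower_set comps] nd by blast
  qed (use assms nd in blast)
qed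

section \<open>The limit for partitions\<close>

text \<open>Exponents dominated in modulus by the parts \<open>\<kappa>_i\<close> with \<open>i \<in> A\<close> and zero elsewhere. They contain those of
  the partial products of \<open>E_poly\<close>, because \<open>\<kappa>_i - 2 \<ge> - \<kappa>_i\<close> for \<open>\<kappa>_i \<ge> 1\<close>.\<close>

definition exponent_box :: "nat \<Rightarrow> comp \<Rightarrow> nat set \<Rightarrow> comp set" where
  "exponent_box n \<kappa> A = {\<nu> \<in> compositions n. \<forall>i.
     (i \<in> A \<longrightarrow> \<bar>Poly_Mapping.lookup \<nu> i\<bar> \<le> Poly_Mapping.lookup \<kappa> i) \<and>
     (i \<notin> A \<longrightarrow> Poly_Mapping.lookup \<nu> i = 0)}"

lemma E_poly_factor_expand:
  fixes c d :: complex and k :: int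
  shows "Poly_Mapping.single (Poly_Mapping.single i k) 1 *
       (1 - Poly_Mapping.single (Poly_Mapping.single i (- 1)) c) *
       (1 - Poly_Mapping.single (Poly_Mapping.single i (- 1)) d) =
     Poly_Mapping.single (Poly_Mapping.single i k) 1 +
     (Poly_Mapping.single (Poly_Mapping.single i (k - 1)) (- c - d) +
      Poly_Mapping.single (Poly_Mapping.single i (k - 2)) (c * d) :: laurent)"
proof -
  have e: "Poly_Mapping.single i k + Poly_Mapping.single i (-1) = Poly_Mapping.single i (k - 1)"
    "Poly_Mapping.single i (k - 1) + Poly_Mapping.single i (-1) = Poly_Mapping.single i (k - 2)"
    by (simp_all flip: single_add)
  have s: "Poly_Mapping.single x (- c - d) = - Poly_Mapping.single x c - Poly_Mapping.single x d" for x :: comp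
    by (simp add: single_diff single_uminus)
  show ?thesis
    by (simp add: right_diff_distrib left_diff_distrib mult_single e s)
qed

text \<open>Separating the leading monomial gives both the leading coefficient and the support of \<open>E_poly\<close>.\<close>

lemma E_product_expand:
  assumes "finite A" "A \<subseteq> {..<n}" "\<And>i. i \<in> A \<Longrightarrow> 0 < Poly_Mapping.lookup \<kappa> i"
  shows "\<exists>G. (\<Prod>i\<in>A. Poly_Mapping.single (Poly_Mapping.single i (Poly_Mapping.lookup \<kappa> i)) 1 *
        (1 - Poly_Mapping.single (Poly_Mapping.single i (- 1)) c) *
        (1 - Poly_Mapping.single (Poly_Mapping.single i (- 1)) d)) =
      (Poly_Mapping.single (\<Sum>i\<in>A. Poly_Mapping.single i (Poly_Mapping.lookup \<kappa> i)) 1 + G :: laurent) \<and>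
      Poly_Mapping.keys G \<subseteq> exponent_box n \<kappa> A - {\<Sum>i\<in>A. Poly_Mapping.single i (Poly_Mapping.lookup \<kappa> i)}"
  using assms
proof (induction A rule: finite_induct)
  case empty
  show ?case by (rule exI[of _ 0]) simp
next
  case (insert j A)
  define f where "f = (\<lambda>i. Poly_Mapping.single (Poly_Mapping.single i (Poly_Mapping.lookup \<kappa> i)) 1 *
        (1 - Poly_Mapping.single (Poly_Mapping.single i (- 1)) c) *
        (1 - Poly_Mapping.single (Poly_Mapping.single i (- 1)) d) :: laurent)"
  define lead where "lead = (\<lambda>A. \<Sum>i\<in>A. Poly_Mapping.single i (Poly_Mapping.lookup \<kappa> i))"
  obtain G where G: "prod f A = Poly_Mapping.single (lead A) 1 + G" "Poly_Mapping.keys G \<subseteq> exponent_box n \<kappa> A - {lead A}"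
    using insert unfolding f_def lead_def by auto
  define k where "k = Poly_Mapping.lookup \<kappa> j"
  have k: "k > 0" "j < n" using insert.prems by (auto simp: k_def)
  define h where "h = (Poly_Mapping.single (Poly_Mapping.single j (k - 1)) (- c - d) +
      Poly_Mapping.single (Poly_Mapping.single j (k - 2)) (c * d) :: laurent)"
  have fj: "f j = Poly_Mapping.single (Poly_Mapping.single j k) 1 + h"
    unfolding f_def h_def k_def by (rule E_poly_factor_expand)
  have lead_lookup: "Poly_Mapping.lookup (lead A) i = (if i \<in> A then Poly_Mapping.lookup \<kappa> i else 0)" for i
    using insert.hyps by (simp add: lead_def lookup_sum lookup_single when_def)
  have lead_insert: "lead (insert j A) = Poly_Mapping.single j k + lead A"
    using insert.hyps by (simp add: lead_def k_def)
  have lead_box: "lead A \<in> exponent_box n \<kappa> A"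
    using insert.prems by (fastforce simp: exponent_box_def compositions_def lead_lookup in_keys_iff split: if_splits)
  define G' where "G' = Poly_Mapping.single (Poly_Mapping.single j k) 1 * G + h * prod f A"
  have "prod f (insert j A) = f j * prod f A" using insert.hyps by simp
  also have "\<dots> = Poly_Mapping.single (lead (insert j A)) 1 + G'"
    unfolding fj G'_def lead_insert by (simp add: distrib_right) (simp add: G(1) distrib_left mult_single)
  finally have eq: "prod f (insert j A) = Poly_Mapping.single (lead (insert j A)) 1 + G'" .
  have box_shift: "Poly_Mapping.single j m + \<rho> \<in> exponent_box n \<kappa> (insert j A)"
    if "\<rho> \<in> exponent_box n \<kappa> A" "\<bar>m\<bar> \<le> k" for m \<rho>
    using that insert.hyps k
    by (auto simp: exponent_box_def lookup_add lookup_single when_def k_def intro!: compositions_add)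
  have keys_h: "\<exists>m. \<alpha> = Poly_Mapping.single j m \<and> \<bar>m\<bar> \<le> k \<and> m < k" if "\<alpha> \<in> Poly_Mapping.keys h" for \<alpha>
  proof -
    have "\<alpha> \<in> {Poly_Mapping.single j (k - 1), Poly_Mapping.single j (k - 2)}"
      using that keys_add[of "Poly_Mapping.single (Poly_Mapping.single j (k - 1)) (- c - d)"
          "Poly_Mapping.single (Poly_Mapping.single j (k - 2)) (c * d)"]
      by (auto simp: h_def split: if_splits)
    thus ?thesis using k by auto
  qed
  have keys_prod: "Poly_Mapping.keys (prod f A) \<subseteq> exponent_box n \<kappa> A"
    using keys_add[of "Poly_Mapping.single (lead A) (1::complex)" G] G lead_box by auto
  have "Poly_Mapping.keys G' \<subseteq> exponent_box n \<kappa> (insert j A) - {lead (insert j A)}"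
  proof
    fix \<rho> assume "\<rho> \<in> Poly_Mapping.keys G'"
    hence "\<rho> \<in> Poly_Mapping.keys (Poly_Mapping.single (Poly_Mapping.single j k) 1 * G) \<or> \<rho> \<in> Poly_Mapping.keys (h * prod f A)"
      using keys_add[of "Poly_Mapping.single (Poly_Mapping.single j k) 1 * G" "h * prod f A"]
      unfolding G'_def by blast
    thus "\<rho> \<in> exponent_box n \<kappa> (insert j A) - {lead (insert j A)}"
    proof
      assume "\<rho> \<in> Poly_Mapping.keys (Poly_Mapping.single (Poly_Mapping.single j k) 1 * G)"
      then obtain \<beta> where "\<rho> = Poly_Mapping.single j k + \<beta>" "\<beta> \<in> Poly_Mapping.keys G"
        using keys_mult[of "Poly_Mapping.single (Poly_Mapping.single j k) (1::complex)" G] by auto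
      thus ?thesis using G(2) box_shift[of \<beta> k] k by (auto simp: lead_insert)
    next
      assume "\<rho> \<in> Poly_Mapping.keys (h * prod f A)"
      then obtain \<alpha> \<beta> where \<alpha>\<beta>: "\<rho> = \<alpha> + \<beta>" "\<alpha> \<in> Poly_Mapping.keys h" "\<beta> \<in> Poly_Mapping.keys (prod f A)"
        using keys_mult[of h "prod f A"] by blast
      then obtain m where m: "\<alpha> = Poly_Mapping.single j m" "\<bar>m\<bar> \<le> k" "m < k" using keys_h by blast
      have \<beta>: "\<beta> \<in> exponent_box n \<kappa> A" using \<alpha>\<beta> keys_prod by blast
      hence "Poly_Mapping.lookup \<rho> j = m"
        using insert.hyps by (auto simp: \<alpha>\<beta>(1) m(1) lookup_add exponent_box_def)
      moreover have "Poly_Mapping.lookup (lead (insert j A)) j = k"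
        using insert.hyps by (simp add: lead_insert lookup_add lead_lookup)
      ultimately show ?thesis using box_shift[OF \<beta> m(2)] m \<alpha>\<beta>(1) by auto
    qed
  qed
  thus ?case using eq unfolding f_def lead_def by blast
qed

lemma E_poly_triangular:
  assumes "\<kappa> \<in> partitions n"
  shows "Poly_Mapping.lookup (E_poly n \<kappa> c d) \<kappa> = 1"
    "Poly_Mapping.keys (E_poly n \<kappa> c d) \<subseteq> insert \<kappa> (lower_set n \<kappa>)"
proof -
  define A where "A = {i. i < n \<and> 0 < Poly_Mapping.lookup \<kappa> i}"
  have \<kappa>: "\<kappa> \<in> compositions n" "\<And>i. i < n \<Longrightarrow> 0 \<le> Poly_Mapping.lookup \<kappa> i"
    using assms by (auto simp: partitions_def)
  have A: "finite A" "A \<subseteq> {..<n}" by (auto simp: A_def)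
  have lead: "(\<Sum>i\<in>A. Poly_Mapping.single i (Poly_Mapping.lookup \<kappa> i)) = \<kappa>"
  proof (rule poly_mapping_eqI)
    fix j
    have "j \<notin> A \<Longrightarrow> Poly_Mapping.lookup \<kappa> j = 0"
      using \<kappa>(2)[of j] lookup_compositions_eq_0[OF \<kappa>(1), of j] by (force simp: A_def)
    thus "Poly_Mapping.lookup (\<Sum>i\<in>A. Poly_Mapping.single i (Poly_Mapping.lookup \<kappa> i)) j = Poly_Mapping.lookup \<kappa> j"
      using A by (simp add: lookup_sum lookup_single when_def)
  qed
  obtain G where G: "E_poly n \<kappa> c d = Poly_Mapping.single \<kappa> 1 + G" "Poly_Mapping.keys G \<subseteq> exponent_box n \<kappa> A - {\<kappa>}"
    using E_product_expand[OF A, of \<kappa> c d] unfolding lead E_poly_def A_def[symmetric] by (auto simp: A_def)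
  have "\<nu> \<in> lower_set n \<kappa>" if "\<nu> \<in> exponent_box n \<kappa> A - {\<kappa>}" for \<nu>
  proof -
    have b: "\<nu> \<in> compositions n" "\<nu> \<noteq> \<kappa>" "\<bar>Poly_Mapping.lookup \<nu> i\<bar> \<le> Poly_Mapping.lookup \<kappa> i" if "i < n" for i
      using \<open>\<nu> \<in> exponent_box n \<kappa> A - {\<kappa>}\<close> \<kappa>(2)[OF that] by (cases "i \<in> A"; force simp: exponent_box_def)+
    have b1: "\<nu> \<in> compositions n" "\<nu> \<noteq> \<kappa>" using that by (auto simp: exponent_box_def)
    have "dom_le n (plus_part n \<nu>) (plus_part n \<kappa>)"
      using b(3) \<kappa>(2) by (intro dom_le_plus_part_mono) auto
    moreover have "dom_le n \<nu> \<kappa>"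
      unfolding dom_le_def using b(3) by (intro ballI sum_mono) (fastforce simp: abs_le_iff)
    ultimately have "prec n \<nu> \<kappa>" using b1 by (auto simp: prec_def dom_less_def)
    thus ?thesis using b1 by (simp add: lower_set_def)
  qed
  hence "Poly_Mapping.keys G \<subseteq> lower_set n \<kappa>" using G(2) by blast
  thus "Poly_Mapping.keys (E_poly n \<kappa> c d) \<subseteq> insert \<kappa> (lower_set n \<kappa>)"
    using keys_add[of "Poly_Mapping.single \<kappa> (1::complex)" G] by (auto simp: G(1))
  have "\<kappa> \<notin> Poly_Mapping.keys G" using G(2) by blast
  thus "Poly_Mapping.lookup (E_poly n \<kappa> c d) \<kappa> = 1"
    by (simp add: G(1) lookup_add in_keys_iff)
qed

text \<open>The number of positive parts of \<open>\<kappa>\<close> from position \<open>j\<close> on. As weights, these numbers add up the partial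
  sums that end at a positive part. For a partition they vanish where \<open>\<kappa>\<close> does, which is where the negative powers of
  the density are not cancelled.\<close>

definition tail_count :: "nat \<Rightarrow> comp \<Rightarrow> nat \<Rightarrow> int" where
  "tail_count n \<kappa> j = (\<Sum>k<n. if j \<le> k \<and> 0 < Poly_Mapping.lookup \<kappa> k then 1 else 0)"

lemma tail_count_nonneg: "0 \<le> tail_count n \<kappa> j"
  unfolding tail_count_def by (intro sum_nonneg) auto

lemma tail_count_antimono: "i \<le> j \<Longrightarrow> tail_count n \<kappa> j \<le> tail_count n \<kappa> i"
  unfolding tail_count_def by (intro sum_mono) auto

lemma tail_count_eq_0:
  assumes "\<kappa> \<in> partitions n" "Poly_Mapping.lookup \<kappa> i \<le> 0"
  shows "tail_count n \<kappa> i = 0"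
  unfolding tail_count_def using assms by (intro sum.neutral) (fastforce simp: partitions_def)

lemma weight_tail_count:
  "weight n (tail_count n \<kappa>) \<rho> =
     (\<Sum>k | k < n \<and> 0 < Poly_Mapping.lookup \<kappa> k. \<Sum>j<Suc k. Poly_Mapping.lookup \<rho> j)"
proof -
  have "weight n (tail_count n \<kappa>) \<rho> =
    (\<Sum>j<n. \<Sum>k<n. if j \<le> k \<and> 0 < Poly_Mapping.lookup \<kappa> k then Poly_Mapping.lookup \<rho> j else 0)"
    unfolding weight_def tail_count_def sum_distrib_right by (intro sum.cong) auto
  also have "\<dots> = (\<Sum>k<n. \<Sum>j<n. if j \<le> k \<and> 0 < Poly_Mapping.lookup \<kappa> k then Poly_Mapping.lookup \<rho> j else 0)"
    by (rule sum.swap)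
  also have "\<dots> = (\<Sum>k<n. if 0 < Poly_Mapping.lookup \<kappa> k then \<Sum>j<Suc k. Poly_Mapping.lookup \<rho> j else 0)"
  proof (rule sum.cong)
    fix k assume "k \<in> {..<n}"
    hence "(\<Sum>j<n. if j \<le> k then Poly_Mapping.lookup \<rho> j else 0) = (\<Sum>j<Suc k. Poly_Mapping.lookup \<rho> j)"
      by (intro sum.mono_neutral_cong_right) auto
    thus "(\<Sum>j<n. if j \<le> k \<and> 0 < Poly_Mapping.lookup \<kappa> k then Poly_Mapping.lookup \<rho> j else 0) =
      (if 0 < Poly_Mapping.lookup \<kappa> k then \<Sum>j<Suc k. Poly_Mapping.lookup \<rho> j else 0)" by simp
  qed simp
  also have "\<dots> = (\<Sum>k | k < n \<and> 0 < Poly_Mapping.lookup \<kappa> k. \<Sum>j<Suc k. Poly_Mapping.lookup \<rho> j)"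
    by (intro sum.mono_neutral_cong_right) auto
  finally show ?thesis .
qed

text \<open>All partial sums of \<open>\<kappa> - \<nu>\<close> are nonnegative by dominance. If those that enter the weight were all zero,
  then \<open>\<nu>\<close> would agree with \<open>\<kappa>\<close> on the positive parts of \<open>\<kappa>\<close>; since the absolute values of \<open>\<nu>\<close> have at
  most the same sum as \<open>\<kappa>\<close>, nothing would be left for the other positions.\<close>

lemma weight_tail_count_positive:
  assumes \<kappa>: "\<kappa> \<in> partitions n" and \<nu>: "\<nu> \<in> lower_set n \<kappa>"
  shows "0 < weight n (tail_count n \<kappa>) (\<kappa> - \<nu>)"
proof -
  define D where "D = (\<lambda>k. \<Sum>j<k. Poly_Mapping.lookup (\<kappa> - \<nu>) j)"
  define A where "A = {k. k < n \<and> 0 < Poly_Mapping.lookup \<kappa> k}"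
  have "finite A" by (simp add: A_def)
  have p: "\<kappa> \<in> compositions n" "\<And>i. i < n \<Longrightarrow> 0 \<le> Poly_Mapping.lookup \<kappa> i"
    "\<And>i j. i \<le> j \<Longrightarrow> j < n \<Longrightarrow> Poly_Mapping.lookup \<kappa> j \<le> Poly_Mapping.lookup \<kappa> i"
    using \<kappa> by (auto simp: partitions_def)
  have n: "\<nu> \<in> compositions n" "prec n \<nu> \<kappa>" "\<nu> \<noteq> \<kappa>" using \<nu> by (auto simp: lower_set_def prec_def)
  have dom: "(\<Sum>i<k. Poly_Mapping.lookup (plus_part n \<nu>) i) \<le> (\<Sum>i<k. Poly_Mapping.lookup \<kappa> i)"
    if "1 \<le> k" "k \<le> n" for k
    using prec_imp_dom_le_plus_part[OF n(2)] plus_part_partition[OF \<kappa>] that by (auto simp: dom_le_def)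
  have D_nonneg: "0 \<le> D k" if "1 \<le> k" "k \<le> n" for k
  proof -
    have "(\<Sum>i<k. Poly_Mapping.lookup \<nu> i) \<le> (\<Sum>i<k. \<bar>Poly_Mapping.lookup \<nu> i\<bar>)"
      by (intro sum_mono) auto
    also have "\<dots> \<le> (\<Sum>i<k. Poly_Mapping.lookup \<kappa> i)"
      using sum_le_sum_plus_part[OF that, of \<nu>] dom[OF that] by simp
    finally show ?thesis by (simp add: D_def lookup_minus sum_subtractf)
  qed
  have W: "weight n (tail_count n \<kappa>) (\<kappa> - \<nu>) = (\<Sum>k\<in>A. D (Suc k))"
    by (simp add: weight_tail_count A_def D_def)
  have nonneg: "\<forall>k\<in>A. 0 \<le> D (Suc k)" using D_nonneg by (auto simp: A_def)
  have "(\<Sum>k\<in>A. D (Suc k)) \<noteq> 0"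
  proof
    assume "(\<Sum>k\<in>A. D (Suc k)) = 0"
    hence D0: "D (Suc k) = 0" if "k \<in> A" for k
      using sum_nonneg_eq_0_iff[OF \<open>finite A\<close>, of "\<lambda>k. D (Suc k)"] nonneg that by auto
    \<comment> \<open>the positive parts form an initial segment, so consecutive partial sums vanish\<close>
    have agree: "Poly_Mapping.lookup \<nu> k = Poly_Mapping.lookup \<kappa> k" if k: "k \<in> A" for k
    proof -
      have "D k = 0"
      proof (cases k)
        case (Suc m)
        hence "m \<in> A" using k p(3)[of m k] by (auto simp: A_def)
        thus ?thesis using D0 Suc by simp
      qed (simp add: D_def)
      thus ?thesis using D0[OF k] by (simp add: D_def lookup_minus)
    qed
    have zero: "Poly_Mapping.lookup \<kappa> k = 0" if "k \<in> {..<n} - A" for k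
      using that p(2)[of k] by (auto simp: A_def)
    have split: "(\<Sum>i<n. f i) = (\<Sum>i\<in>A. f i) + (\<Sum>i\<in>{..<n} - A. f i)" for f :: "nat \<Rightarrow> int"
      using sum.subset_diff[of A "{..<n}" f] by (simp add: A_def add.commute subset_iff)
    have "(\<Sum>i<n. \<bar>Poly_Mapping.lookup \<nu> i\<bar>) \<le> (\<Sum>i<n. Poly_Mapping.lookup \<kappa> i)"
      using dom[of n] sum_plus_part_all[of n \<nu>] by (cases "n = 0") auto
    also have "(\<Sum>i<n. Poly_Mapping.lookup \<kappa> i) = (\<Sum>i\<in>A. \<bar>Poly_Mapping.lookup \<nu> i\<bar>)"
    proof -
      have "(\<Sum>i\<in>{..<n} - A. Poly_Mapping.lookup \<kappa> i) = 0" using zero by (intro sum.neutral) auto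
      moreover have "(\<Sum>i\<in>A. Poly_Mapping.lookup \<kappa> i) = (\<Sum>i\<in>A. \<bar>Poly_Mapping.lookup \<nu> i\<bar>)"
        using agree by (intro sum.cong) (auto simp: A_def)
      ultimately show ?thesis using split[of "Poly_Mapping.lookup \<kappa>"] by simp
    qed
    finally have "(\<Sum>i\<in>{..<n} - A. \<bar>Poly_Mapping.lookup \<nu> i\<bar>) \<le> 0" unfolding split by simp
    hence "(\<Sum>i\<in>{..<n} - A. \<bar>Poly_Mapping.lookup \<nu> i\<bar>) = 0" by (intro antisym sum_nonneg) auto
    hence \<nu>0: "Poly_Mapping.lookup \<nu> i = 0" if "i \<in> {..<n} - A" for i
      using sum_nonneg_eq_0_iff[of "{..<n} - A" "\<lambda>i. \<bar>Poly_Mapping.lookup \<nu> i\<bar>"] that by auto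
    have "\<nu> = \<kappa>"
    proof (rule poly_mapping_eqI)
      fix i show "Poly_Mapping.lookup \<nu> i = Poly_Mapping.lookup \<kappa> i"
      proof (cases "i < n")
        case True
        thus ?thesis using agree[of i] zero[of i] \<nu>0[of i] by (cases "i \<in> A") auto
      next
        case False
        thus ?thesis using lookup_compositions_eq_0 p(1) n(1) by simp
      qed
    qed
    thus False using n(3) by simp
  qed
  moreover have "0 \<le> (\<Sum>k\<in>A. D (Suc k))" using nonneg by (intro sum_nonneg) auto
  ultimately show ?thesis using W by simp
qed

text \<open>The negative powers at positions with \<open>\<kappa>_i > 0\<close> are cancelled, those at the other positions have
  weight zero, and the exponents of the remaining factors have nonnegative weight because the weights
  are nonnegative and decrease with the position.\<close>

lemma cancelled_density_weight_limit:
  assumes \<kappa>: "\<kappa> \<in> partitions n" and p: "(t, a, b, c, d) \<in> polydisc"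
  shows "weight_limit n (tail_count n \<kappa>) 0
    (\<lambda>z. (\<Prod>i\<in>{i. i < n \<and> 0 < Poly_Mapping.lookup \<kappa> i}.
            (1 - c * zpow n (Poly_Mapping.single i (-1)) z) * (1 - d * zpow n (Poly_Mapping.single i (-1)) z)) *
         density0 n (t, a, b, c, d) z)"
proof -
  define w where "w = tail_count n \<kappa>"
  define A where "A = {i. i < n \<and> 0 < Poly_Mapping.lookup \<kappa> i}"
  have n: "norm t < 1" "norm a < 1" "norm b < 1" "norm c < 1" "norm d < 1"
    using p by (auto simp: polydisc_def)
  have w: "0 \<le> w i" "i \<le> j \<Longrightarrow> w j \<le> w i" for i j
    by (auto simp: w_def tail_count_nonneg tail_count_antimono)
  have w0: "w i = 0" if "i < n" "i \<notin> A" for i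
    using that tail_count_eq_0[OF \<kappa>] by (simp add: w_def A_def)
  have one: "weight_limit n w 0 (\<lambda>z. 1 / (1 - x * zpow n (Poly_Mapping.single i 1) z))"
    if "i < n" "norm x < 1" for i x
    using that w by (intro weight_limit_geometric) (auto simp: weight_single)
  have neg: "weight_limit n w 0 (\<lambda>z. 1 / (1 - x * zpow n (Poly_Mapping.single i (-1)) z))"
    if "i < n" "norm x < 1" "i \<notin> A" for i x
    using that w0 by (intro weight_limit_geometric) (auto simp: weight_single)
  have sq: "weight_limit n w 0 (\<lambda>z. 1 - zpow n (Poly_Mapping.single i 2) z)" if "i < n" for i
    using that w by (intro weight_limit_numerator) (auto simp: weight_single)
  have pair: "weight_limit n w 0 (pair_density n i j (t, a, b, c, d))" if "i < j" "j < n" for i j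
  proof -
    have e: "Poly_Mapping.single i 1 + Poly_Mapping.single j s \<in> compositions n"
      "0 \<le> weight n w (Poly_Mapping.single i 1 + Poly_Mapping.single j s)" if "s \<in> {1, -1}" for s
      using that \<open>i < j\<close> \<open>j < n\<close> w(1)[of i] w(1)[of j] w(2)[of i j]
      by (auto simp: weight_add weight_single intro!: compositions_add)
    show ?thesis unfolding pair_density.simps
      by (intro weight_limit_mult0 weight_limit_numerator weight_limit_geometric e) (use n in auto)
  qed
  define site where "site = (\<lambda>i z. (if i \<in> A then (1 - c * zpow n (Poly_Mapping.single i (-1)) z) *
       (1 - d * zpow n (Poly_Mapping.single i (-1)) z) else 1) * site_density n i (t, a, b, c, d) z)"
  have site: "weight_limit n w 0 (site i)" if i: "i < n" for i
  proof (cases "i \<in> A")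
    case False
    hence "site i = site_density n i (t, a, b, c, d)" by (simp add: site_def fun_eq_iff)
    thus ?thesis unfolding site_density.simps using i n False
      by (simp only: site_density.simps[abs_def]) (intro weight_limit_mult0 one neg sq; simp)
  next
    case True
    have lim: "weight_limit n w 0 (\<lambda>z. (1 - zpow n (Poly_Mapping.single i 2) z) *
     (1 / (1 - a * zpow n (Poly_Mapping.single i 1) z)) *
     (1 / (1 - b * zpow n (Poly_Mapping.single i 1) z)) *
     (1 / (1 - c * zpow n (Poly_Mapping.single i 1) z)) *
     (1 / (1 - d * zpow n (Poly_Mapping.single i 1) z)))"
      using i n by (intro weight_limit_mult0 one sq)
    show ?thesis
    proof (rule weight_limit_cong[THEN iffD1, OF _ lim])
      fix z assume z: "z \<in> torus"
      have "1 - x * zpow n (Poly_Mapping.single i (-1)) z \<noteq> 0" if "norm x < 1" for x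
      proof -
        have "norm (x * zpow n (Poly_Mapping.single i (-1)) z) < 1" using that by (simp add: norm_mult norm_zpow z)
        thus ?thesis by auto
      qed
      from this[OF n(4)] this[OF n(5)]
      show "(1 - zpow n (Poly_Mapping.single i 2) z) *
         (1 / (1 - a * zpow n (Poly_Mapping.single i 1) z)) *
         (1 / (1 - b * zpow n (Poly_Mapping.single i 1) z)) *
         (1 / (1 - c * zpow n (Poly_Mapping.single i 1) z)) *
         (1 / (1 - d * zpow n (Poly_Mapping.single i 1) z)) = site i z"
        using True by (simp add: site_def)
    qed
  qed
  have "(\<Prod>i\<in>A. (1 - c * zpow n (Poly_Mapping.single i (-1)) z) * (1 - d * zpow n (Poly_Mapping.single i (-1)) z)) *
         density0 n (t, a, b, c, d) z =
        (\<Prod>i<n. site i z) * (\<Prod>j<n. \<Prod>i<j. pair_density n i j (t, a, b, c, d) z)" for z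
  proof -
    have "(\<Prod>i\<in>A. (1 - c * zpow n (Poly_Mapping.single i (-1)) z) * (1 - d * zpow n (Poly_Mapping.single i (-1)) z)) =
      (\<Prod>i<n. if i \<in> A then (1 - c * zpow n (Poly_Mapping.single i (-1)) z) *
         (1 - d * zpow n (Poly_Mapping.single i (-1)) z) else 1)"
      by (rule prod.mono_neutral_cong_left) (auto simp: A_def)
    thus ?thesis by (simp only: density0_def site_def prod.distrib mult.assoc)
  qed
  moreover have "weight_limit n w 0 (\<lambda>z. (\<Prod>i<n. site i z) * (\<Prod>j<n. \<Prod>i<j. pair_density n i j (t, a, b, c, d) z))"
    by (intro weight_limit_mult0 weight_limit_prod site pair) auto
  ultimately show ?thesis unfolding w_def[symmetric] A_def[symmetric] by simp
qed

lemma laurent_eval_E_poly: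
  assumes \<kappa>: "\<kappa> \<in> partitions n" and z: "z \<in> torus"
  shows "laurent_eval n (E_poly n \<kappa> c d) z = zpow n \<kappa> z *
    (\<Prod>i\<in>{i. i < n \<and> 0 < Poly_Mapping.lookup \<kappa> i}.
       (1 - c * zpow n (Poly_Mapping.single i (-1)) z) * (1 - d * zpow n (Poly_Mapping.single i (-1)) z))"
proof -
  have "zpow n \<kappa> z = (\<Prod>i\<in>{i. i < n \<and> 0 < Poly_Mapping.lookup \<kappa> i}. zpow n (Poly_Mapping.single i (Poly_Mapping.lookup \<kappa> i)) z)"
    unfolding zpow_def[of n \<kappa>]
  proof (rule prod.mono_neutral_cong_right)
    have "Poly_Mapping.lookup \<kappa> i = 0" if "i < n" "\<not> 0 < Poly_Mapping.lookup \<kappa> i" for i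
      using \<kappa> that unfolding partitions_def by fastforce
    hence "z i powi Poly_Mapping.lookup \<kappa> i = 1" if "i < n" "\<not> 0 < Poly_Mapping.lookup \<kappa> i" for i
      using that by (metis power_int_0_right)
    thus "\<forall>i\<in>{..<n} - {i. i < n \<and> 0 < Poly_Mapping.lookup \<kappa> i}. z i powi Poly_Mapping.lookup \<kappa> i = 1"
      by blast
  qed (auto simp: zpow_single)
  thus ?thesis
    unfolding E_poly_def laurent_eval_prod[OF z]
    by (simp add: laurent_eval_mult[OF z] laurent_eval_diff prod.distrib mult.assoc)
qed

lemma is_koornwinder_E_poly:
  assumes \<kappa>: "\<kappa> \<in> partitions n" and p: "(t, a, b, c, d) \<in> polydisc"
  shows "is_koornwinder n \<kappa> (0, t, a, b, c, d) (E_poly n \<kappa> c d)"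
  unfolding is_koornwinder_def
proof (intro conjI ballI impI)
  fix \<nu> assume \<nu>: "\<nu> \<in> compositions n" "prec n \<nu> \<kappa>"
  have \<kappa>c: "\<kappa> \<in> compositions n" using \<kappa> by (simp add: partitions_def)
  define F where "F = (\<lambda>z. (\<Prod>i\<in>{i. i < n \<and> 0 < Poly_Mapping.lookup \<kappa> i}.
            (1 - c * zpow n (Poly_Mapping.single i (-1)) z) * (1 - d * zpow n (Poly_Mapping.single i (-1)) z)) *
         density0 n (t, a, b, c, d) z)"
  have "koorn_inner n (\<lambda>_. E_poly n \<kappa> c d) (\<lambda>_. Poly_Mapping.single \<nu> 1) (0, t, a, b, c, d) =
        torus_integral n (\<lambda>z. zpow n (\<kappa> - \<nu>) z * F z)"
    unfolding koorn_inner_def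
  proof (rule torus_integral_cong)
    fix z assume z: "z \<in> torus"
    have "zpow n (\<kappa> - \<nu>) z = zpow n \<kappa> z * zpow n (- \<nu>) z"
      using zpow_add[OF z, of n \<kappa> "- \<nu>"] by simp
    thus "laurent_eval n (E_poly n \<kappa> c d) z * laurent_eval n (bar (Poly_Mapping.single \<nu> 1)) z *
        koorn_density n (0, t, a, b, c, d) z = zpow n (\<kappa> - \<nu>) z * F z"
      by (simp only: bar_monomial laurent_eval_E_poly[OF \<kappa> z] koorn_density_0[OF z] laurent_eval_single F_def mult_ac mult_1)
  qed
  also have "\<dots> = 0"
  proof (rule torus_integral_positive_weight)
    have "\<nu> \<in> lower_set n \<kappa>" using \<nu> by (simp add: lower_set_def)
    thus "0 < weight n (tail_count n \<kappa>) (\<kappa> - \<nu>)" by (rule weight_tail_count_positive[OF \<kappa>])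
    show "weight_limit n (tail_count n \<kappa>) (weight n (tail_count n \<kappa>) (\<kappa> - \<nu>)) (\<lambda>z. zpow n (\<kappa> - \<nu>) z * F z)"
      using weight_limit_mult[OF weight_limit_zpow[OF compositions_diff[OF \<kappa>c \<nu>(1)] order.refl, where c = 1]
          cancelled_density_weight_limit[OF \<kappa> p]] by (simp add: F_def)
  qed
  finally show "koorn_inner n (\<lambda>_. E_poly n \<kappa> c d) (\<lambda>_. Poly_Mapping.single \<nu> 1) (0, t, a, b, c, d) = 0" .
qed (use E_poly_triangular[OF \<kappa>] in \<open>auto simp: lower_set_def\<close>)

theorem theorem3p7:
  fixes n :: nat
  assumes "n \<ge> 1"
  shows "(\<forall>\<mu>\<in>compositions n. generic_params (\<lambda>t a b c d.
            (\<forall>\<^sub>F q in at 0. \<exists>!U. is_koornwinder n \<mu> (q, t, a, b, c, d) U) \<and>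
            (\<exists>L. coeffwise_limit (\<lambda>q. koornwinder n \<mu> (q, t, a, b, c, d)) L))) \<and>
         (\<forall>\<kappa>\<in>partitions n. generic_params (\<lambda>t a b c d.
            (\<forall>\<^sub>F q in at 0. \<exists>!U. is_koornwinder n \<kappa> (q, t, a, b, c, d) U) \<and>
            coeffwise_limit (\<lambda>q. koornwinder n \<kappa> (q, t, a, b, c, d)) (E_poly n \<kappa> c d)))"
proof (intro conjI ballI)
  fix \<mu> assume "\<mu> \<in> compositions n"
  show "generic_params (\<lambda>t a b c d.
            (\<forall>\<^sub>F q in at 0. \<exists>!U. is_koornwinder n \<mu> (q, t, a, b, c, d) U) \<and>
            (\<exists>L. coeffwise_limit (\<lambda>q. koornwinder n \<mu> (q, t, a, b, c, d)) L))"
  proof (rule generic_nondegenerate[of n \<mu>])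
    fix t a b c d
    assume "(t, a, b, c, d) \<in> polydisc"
      "nondegenerate_on (lower_set n \<mu>) (moment_matrix n (t, a, b, c, d) 0)"
    then obtain L where "\<forall>\<^sub>F q in at 0. \<exists>!U. is_koornwinder n \<mu> (q, t, a, b, c, d) U"
      "coeffwise_limit (\<lambda>q. koornwinder n \<mu> (q, t, a, b, c, d)) L"
      by (rule koornwinder_limit)
    thus "(\<forall>\<^sub>F q in at 0. \<exists>!U. is_koornwinder n \<mu> (q, t, a, b, c, d) U) \<and>
            (\<exists>L. coeffwise_limit (\<lambda>q. koornwinder n \<mu> (q, t, a, b, c, d)) L)"
      by blast
  qed
next
  fix \<kappa> assume \<kappa>: "\<kappa> \<in> partitions n"
  show "generic_params (\<lambda>t a b c d.
            (\<forall>\<^sub>F q in at 0. \<exists>!U. is_koornwinder n \<kappa> (q, t, a, b, c, d) U) \<and>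
            coeffwise_limit (\<lambda>q. koornwinder n \<kappa> (q, t, a, b, c, d)) (E_poly n \<kappa> c d))"
  proof (rule generic_nondegenerate[of n \<kappa>])
    fix t a b c d
    assume p: "(t, a, b, c, d) \<in> polydisc"
      and nd: "nondegenerate_on (lower_set n \<kappa>) (moment_matrix n (t, a, b, c, d) 0)"
    obtain L where L: "\<forall>\<^sub>F q in at 0. \<exists>!U. is_koornwinder n \<kappa> (q, t, a, b, c, d) U"
      "coeffwise_limit (\<lambda>q. koornwinder n \<kappa> (q, t, a, b, c, d)) L" "is_koornwinder n \<kappa> (0, t, a, b, c, d) L"
      using koornwinder_limit[OF p nd] .
    have "L = E_poly n \<kappa> c d"
      using is_koornwinder_unique[OF p _ nd L(3) is_koornwinder_E_poly[OF \<kappa> p]] by simp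
    thus "(\<forall>\<^sub>F q in at 0. \<exists>!U. is_koornwinder n \<kappa> (q, t, a, b, c, d) U) \<and>
            coeffwise_limit (\<lambda>q. koornwinder n \<kappa> (q, t, a, b, c, d)) (E_poly n \<kappa> c d)"
      using L by simp
  qed
qed

end
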